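(* (a) There exists a unique $\hat p_n\in\mathcal P(t,\zeta,D)$ such that $L_n(\hat p_n)=\sup_{p\in\mathcal P(t,\zeta,D)}L_n(p)$ holds. The resulting mapping $\hat p_n:\Omega^n\to\mathcal P(t,\zeta,D)$ is measurable with respect to the $\sigma$-fields $\mathcal B(\Omega)^n$ and $\mathcal B(\mathcal P(t,\zeta,D),\|\cdot\|_\Omega)$. Moreover, $\hat p_n$ always satisfies $\|\hat p_n\|_{t,2}=D$. (b) For each $\theta\in\Theta$ there exists a unique $\tilde p_k(\theta)\in\mathcal P(t,\zeta,D)$ such that $L_k(\theta,\tilde p_k(\theta))=\sup_{p\in\mathcal P(t,\zeta,D)}L_k(\theta,p)$ holds. The resulting mapping $\tilde p_k(\theta):V^k\to\mathcal P(t,\zeta,D)$ is measurable with respect to the $\sigma$-fields $\mathcal V^k$ and $\mathcal B(\mathcal P(t,\zeta,D),\|\cdot\|_\Omega)$. Moreover, $\tilde p_k(\theta)$ always satisfies $\|\tilde p_k(\theta)\|_{t,2}=D$. Furthermore, if $\theta\mapsto\rho(v,\theta)$ is continuous on $\Theta$ for every $v\in V$, then, for arbitrary fixed values of $V_1,\dots,V_k$, $\theta\mapsto\tilde p_k(\theta)$ is continuous as a mapping from $\Theta$ into the space $(\mathcal P(t,\zeta,D),\|\cdot\|_\Omega)$.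
   Context: $\Omega\subseteq\mathbb R$ is a non-empty bounded open interval with Borel $\sigma$-field $\mathcal B(\Omega)$ and Lebesgue measure $\lambda$. $\|f\|_\Omega=\sup_{x\in\Omega}|f(x)|$, $\|f\|_2=(\int_\Omega f^2d\lambda)^{1/2}$, and $\mathcal L^2(\Omega)$ is the set of Borel functions with $\|f\|_2<\infty$. For real $s\ge0$ and $f\in\mathcal L^2(\Omega)$ with weak derivatives $f^{(\alpha)}$, $\|f\|_{s,2}^2=\sum_{0\le\alpha\le\lfloor s\rfloor}\|f^{(\alpha)}\|_2^2$ if $s$ is an integer, and for non-integer $s$ the term $\int_\Omega\int_\Omega\frac{(f^{(\lfloor s\rfloor)}(x)-f^{(\lfloor s\rfloor)}(y))^2}{|x-y|^{1+2(s-\lfloor s\rfloor)}}d\lambda(x)d\lambda(y)$ is added. For $s>1/2$, $\mathsf W_2^s(\Omega)$ is the Hilbert space of bounded continuous $f:\Omega\to\mathbb R$ with $\|f\|_{s,2}<\infty$. Let $\mathcal P(t,\zeta,D)=\{p\in\mathsf W_2^t(\Omega):\int_\Omega p\,d\lambda=1,\ \inf_\Omega p\ge\zeta,\ \|p\|_{t,2}\le D\}$, with fixed numbers $t>1/2$ and $0\le\zeta<\lambda(\Omega)^{-1}<D^2<\infty$. $\mathcal B(T,d)$ denotes the Borel $\sigma$-field of a metric space; $(\mathcal P(t,\zeta,D),\|\cdot\|_\Omega)$ is $\mathcal P(t,\zeta,D)$ with the sup-norm metric. Set-up: $X_1,\dots,X_n$ denote the data, taking values in $\Omega$ (coordinate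 projections on $\Omega^n$). $\Theta\subseteq\mathbb R^m$ is non-empty and compact and $\{p_\theta:\theta\in\Theta\}$ is a family of probability density functions on $\Omega$. $(V,\mathcal V,\mu)$ is a probability space and $\rho:V\times\Theta\to\Omega$ is $\mathcal V$-$\mathcal B(\Omega)$-measurable in its first argument and such that for every $\theta\in\Theta$ the law of $\rho(\cdot,\theta)$ under $\mu$ has density $p_\theta$. $V_1,\dots,V_k$ are the coordinate projections on $V^k$. With $\log0=-\infty$, define for $p\in\mathcal P(t,\zeta,D)$ and $\theta\in\Theta$ $L_n(p)=n^{-1}\sum_{i=1}^n\log p(X_i)$ and $L_k(\theta,p)=k^{-1}\sum_{i=1}^k\log p(\rho(V_i,\theta))$, with values in $[-\infty,\infty)$. The statement in (a) is for every $n\ge1$ and every value of $(X_1,\dots,X_n)\in\Omega^n$, the one in (b) for every $k\ge1$ and every value of $(V_1,\dots,V_k)\in V^k$. *)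

theory Defs
  imports "HOL-Probability.Probability"
begin

section \<open>Weak derivatives and fractional Sobolev norms on an open set of reals\<close>

definition locally_integrable_on :: "real set \<Rightarrow> (real \<Rightarrow> real) \<Rightarrow> bool" where
  "locally_integrable_on \<Omega> f \<longleftrightarrow>
     (\<forall>K. compact K \<and> K \<subseteq> \<Omega> \<longrightarrow> set_integrable lborel K f)"

definition test_functions :: "real set \<Rightarrow> (real \<Rightarrow> real) set" where
  "test_functions \<Omega> =
     {\<phi>. (\<forall>k. (deriv ^^ k) \<phi> differentiable_on UNIV) \<and>
         compact (closure {x. \<phi> x \<noteq> 0}) \<and> closure {x. \<phi> x \<noteq> 0} \<subseteq> \<Omega>}"

definition is_weak_deriv :: "real set \<Rightarrow> nat \<Rightarrow> (real \<Rightarrow> real) \<Rightarrow> (real \<Rightarrow> real) \<Rightarrow> bool" where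
  "is_weak_deriv \<Omega> \<alpha> f g \<longleftrightarrow>
     locally_integrable_on \<Omega> f \<and> locally_integrable_on \<Omega> g \<and>
     (\<forall>\<phi>\<in>test_functions \<Omega>.
        (LINT x:\<Omega>|lborel. f x * (deriv ^^ \<alpha>) \<phi> x) =
        (-1) ^ \<alpha> * (LINT x:\<Omega>|lborel. g x * \<phi> x))"

text \<open>Weak derivatives are unique only up to null sets; every quantity below is an integral
  that does not depend on the version picked here.\<close>

definition weak_deriv :: "real set \<Rightarrow> nat \<Rightarrow> (real \<Rightarrow> real) \<Rightarrow> real \<Rightarrow> real" where
  "weak_deriv \<Omega> \<alpha> f = (SOME g. is_weak_deriv \<Omega> \<alpha> f g)"

definition l2_norm_sq :: "real set \<Rightarrow> (real \<Rightarrow> real) \<Rightarrow> ennreal" where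
  "l2_norm_sq \<Omega> f = (\<integral>\<^sup>+x\<in>\<Omega>. ennreal ((f x)\<^sup>2) \<partial>lborel)"

text \<open>The diagonal \<open>x = y\<close>, where HOL reads the quotient as 0, is a null set.\<close>

definition gagliardo_sq :: "real set \<Rightarrow> real \<Rightarrow> (real \<Rightarrow> real) \<Rightarrow> ennreal" where
  "gagliardo_sq \<Omega> r g =
     (\<integral>\<^sup>+y\<in>\<Omega>. (\<integral>\<^sup>+x\<in>\<Omega>. ennreal ((g x - g y)\<^sup>2 / \<bar>x - y\<bar> powr (1 + 2 * r)) \<partial>lborel) \<partial>lborel)"

text \<open>The norm takes the value \<open>\<infinity>\<close> if some weak derivative of order at most \<open>\<lfloor>s\<rfloor>\<close> does not exist.\<close>

definition sobolev_norm_sq :: "real set \<Rightarrow> real \<Rightarrow> (real \<Rightarrow> real) \<Rightarrow> ennreal" where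
  "sobolev_norm_sq \<Omega> s f =
     (if \<forall>\<alpha>\<le>nat \<lfloor>s\<rfloor>. \<exists>g. is_weak_deriv \<Omega> \<alpha> f g
      then (\<Sum>\<alpha>\<le>nat \<lfloor>s\<rfloor>. l2_norm_sq \<Omega> (weak_deriv \<Omega> \<alpha> f)) +
           (if s \<in> \<int> then 0
            else gagliardo_sq \<Omega> (s - \<lfloor>s\<rfloor>) (weak_deriv \<Omega> (nat \<lfloor>s\<rfloor>) f))
      else \<infinity>)"

definition sobolev_norm :: "real set \<Rightarrow> real \<Rightarrow> (real \<Rightarrow> real) \<Rightarrow> ennreal" where
  "sobolev_norm \<Omega> s f =
     (if sobolev_norm_sq \<Omega> s f = \<infinity> then \<infinity> else ennreal (sqrt (enn2real (sobolev_norm_sq \<Omega> s f))))"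


section \<open>Function spaces with the sup-norm metric\<close>

text \<open>Functions on \<open>\<Omega>\<close> are HOL functions that are \<^const>\<open>extensional\<close> on \<open>\<Omega>\<close>, so
  equality of elements is equality on \<open>\<Omega>\<close>. The metric space of bounded continuous real functions
  on \<open>\<Omega>\<close> is the library's \<^const>\<open>cfunspace\<close>; the two lemmas spell out carrier and distance.\<close>

definition bounded_cont :: "real set \<Rightarrow> (real \<Rightarrow> real) metric" where
  "bounded_cont \<Omega> = cfunspace (top_of_set \<Omega>) euclidean_metric"

lemma mspace_bounded_cont:
  "mspace (bounded_cont \<Omega>) = {f. f \<in> extensional \<Omega> \<and> continuous_on \<Omega> f \<and> bounded (f ` \<Omega>)}"
  by (auto simp: bounded_cont_def Met_TC.fspace_def)

lemma mdist_bounded_cont: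
  assumes "f \<in> mspace (bounded_cont \<Omega>)" "g \<in> mspace (bounded_cont \<Omega>)" "\<Omega> \<noteq> {}"
  shows "mdist (bounded_cont \<Omega>) f g = (SUP x\<in>\<Omega>. \<bar>f x - g x\<bar>)"
  using assms
  by (auto simp: bounded_cont_def cfunspace_def Met_TC.fspace_def Met_TC.fdist_def dist_real_def)

definition sobolev_space :: "real set \<Rightarrow> real \<Rightarrow> (real \<Rightarrow> real) set" where
  "sobolev_space \<Omega> s = {f \<in> mspace (bounded_cont \<Omega>). sobolev_norm \<Omega> s f < \<infinity>}"

definition sieve :: "real set \<Rightarrow> real \<Rightarrow> real \<Rightarrow> real \<Rightarrow> (real \<Rightarrow> real) set" where
  "sieve \<Omega> t \<zeta> D =
     {p \<in> sobolev_space \<Omega> t. (LINT x:\<Omega>|lborel. p x) = 1 \<and> \<zeta> \<le> (INF x\<in>\<Omega>. p x) \<and>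
        sobolev_norm \<Omega> t p \<le> ennreal D}"

definition sieve_metric :: "real set \<Rightarrow> real \<Rightarrow> real \<Rightarrow> real \<Rightarrow> (real \<Rightarrow> real) metric" where
  "sieve_metric \<Omega> t \<zeta> D = submetric (bounded_cont \<Omega>) (sieve \<Omega> t \<zeta> D)"

lemma mspace_sieve_metric: "mspace (sieve_metric \<Omega> t \<zeta> D) = sieve \<Omega> t \<zeta> D"
  by (auto simp: sieve_metric_def sieve_def sobolev_space_def)

definition metric_borel :: "'a metric \<Rightarrow> 'a measure" where
  "metric_borel m = sigma (mspace m) {U. openin (mtopology_of m) U}"


section \<open>Densities and log-likelihoods\<close>

definition prob_density_on :: "real set \<Rightarrow> (real \<Rightarrow> real) \<Rightarrow> bool" where
  "prob_density_on \<Omega> p \<longleftrightarrow>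
     p \<in> borel_measurable (restrict_space borel \<Omega>) \<and> (\<forall>x\<in>\<Omega>. 0 \<le> p x) \<and>
     (\<integral>\<^sup>+x\<in>\<Omega>. ennreal (p x) \<partial>lborel) = 1"

text \<open>HOL has \<open>ln 0 = 0\<close>, hence the explicit case distinction. Only arguments \<open>x \<ge> 0\<close> matter.\<close>

definition log_ext :: "real \<Rightarrow> ereal" where
  "log_ext x = (if x \<le> 0 then -\<infinity> else ereal (ln x))"

definition log_lik :: "nat \<Rightarrow> (nat \<Rightarrow> real) \<Rightarrow> (real \<Rightarrow> real) \<Rightarrow> ereal" where
  "log_lik n X p = ereal (1 / real n) * (\<Sum>i=1..n. log_ext (p (X i)))"

definition sim_log_lik ::
  "('v \<Rightarrow> 'th \<Rightarrow> real) \<Rightarrow> nat \<Rightarrow> (nat \<Rightarrow> 'v) \<Rightarrow> 'th \<Rightarrow> (real \<Rightarrow> real) \<Rightarrow> ereal" where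
  "sim_log_lik \<rho> k V \<theta> p = ereal (1 / real k) * (\<Sum>i=1..k. log_ext (p (\<rho> (V i) \<theta>)))"

definition maximizes_on :: "'a set \<Rightarrow> ('a \<Rightarrow> ereal) \<Rightarrow> 'a \<Rightarrow> bool" where
  "maximizes_on A F p \<longleftrightarrow> p \<in> A \<and> F p = (SUP q\<in>A. F q)"

definition the_maximizer :: "'a set \<Rightarrow> ('a \<Rightarrow> ereal) \<Rightarrow> 'a" where
  "the_maximizer A F = (THE p. maximizes_on A F p)"

end

theory Submission
  imports Defs
begin

text \<open>Everything is reduced to the quadratic form \<open>Q = sobolev_norm_sq\<close>, with no appeal to weak compactness
  or to the Arzela--Ascoli theorem. On the sieve all densities are nonnegative, so maximising the
  log-likelihood is maximising the product \<open>F p = (\<Prod>i. p (X i))\<close>, and by AM--GM the superlevel sets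
  \<open>A\<^sub>e = {p. F p \<ge> sup F - e}\<close> are closed under midpoints. By the parallelogram law, near-minimisers of
  \<open>Q\<close> on the sets \<open>A\<^sub>e\<close>, as \<open>e\<close> tends to 0, form a Cauchy sequence in the Sobolev norm; its limit \<open>g\<close>
  (completeness and the embedding into a Hoelder space) is a maximiser, and the infimum of \<open>Q\<close> over
  \<open>A\<^sub>e\<close> tends to \<open>Q g\<close>. If \<open>Q g < D\<^sup>2\<close>, moving a little mass from a small interval away from the
  sample, where \<open>g > \<zeta>\<close>, to a constant function would increase \<open>F\<close>; hence \<open>Q g = D\<^sup>2\<close>. Now the
  parallelogram law forces every \<open>p \<in> A\<^sub>e\<close> to be close to \<open>g\<close> when \<open>e\<close> is small. This gives uniqueness and,
  since the sieve is uniformly Hoelder, continuity of the maximiser in the sample, from which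
  measurability and continuity in \<open>\<theta>\<close> follow by composition.\<close>

section \<open>Smooth functions on the line\<close>

text \<open>The sample sees a density at finitely many points only, so concavity of the logarithm
  cannot separate two maximisers that agree there. Uniqueness on the whole interval has to come from
  the strict convexity of the norm ball, and this helps only once the norm bound is known to be
  attained. The product is preferred to the sum of logarithms because it stays finite and continuous
  where a density vanishes at a sample point, as may happen for \<zeta> = 0. Stability has this
  source: a near-maximiser p satisfies Q p \<le> D^2 = Q g, and the midpoint of p and g is again a
  near-maximiser, so its form is almost D^2; the parallelogram law then leaves little room for Q (p
  - g). Norms take values in \<open>ennreal\<close> and weak derivatives come from a choice
  operator, hence the estimates are proved for arbitrary Borel versions of the derivatives and in a
  form free of subtraction.\<close>

definition smooth :: "(real \<Rightarrow> real) \<Rightarrow> bool" where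
  "smooth f \<longleftrightarrow> (\<forall>k. (deriv ^^ k) f differentiable_on UNIV)"

text \<open>The recursion peels off the innermost derivative, so that closure under products and
  affine substitution becomes an induction with the functions left arbitrary, in place of a formula
  for the k-th derivative of a product.\<close>

fun times_diff :: "nat \<Rightarrow> (real \<Rightarrow> real) \<Rightarrow> bool" where
  "times_diff 0 f \<longleftrightarrow> True"
| "times_diff (Suc k) f \<longleftrightarrow> f differentiable_on UNIV \<and> times_diff k (deriv f)"

lemma differentiable_on_UNIV_iff:
  "(f :: real \<Rightarrow> real) differentiable_on UNIV \<longleftrightarrow> (\<forall>x. (f has_real_derivative deriv f x) (at x))"
  unfolding differentiable_on_def DERIV_deriv_iff_real_differentiable by simp

lemma times_diff_iff: "times_diff n f \<longleftrightarrow> (\<forall>k<n. (deriv ^^ k) f differentiable_on UNIV)"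
proof (induction n arbitrary: f)
  case (Suc n)
  show ?case
    by (auto simp: Suc less_Suc_eq_0_disj funpow_Suc_right simp del: funpow.simps(2))
qed auto

lemma smooth_iff_times_diff: "smooth f \<longleftrightarrow> (\<forall>n. times_diff n f)"
  unfolding smooth_def times_diff_iff by blast

lemma times_diffI:
  assumes "\<And>x. (f has_real_derivative g x) (at x)" "times_diff n g"
  shows "times_diff (Suc n) f"
proof -
  have "deriv f = g" using assms(1) DERIV_imp_deriv by blast
  then show ?thesis using assms by (auto simp: differentiable_on_UNIV_iff)
qed

lemma smooth_DERIV: "smooth f \<Longrightarrow> (f has_real_derivative deriv f x) (at x)"
  using differentiable_on_UNIV_iff[of f] unfolding smooth_def
  by (metis funpow_0)

lemma smooth_deriv: "smooth f \<Longrightarrow> smooth (deriv f)"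
  unfolding smooth_iff_times_diff by (metis times_diff.simps(2))

lemma smooth_higher_deriv: "smooth f \<Longrightarrow> smooth ((deriv ^^ k) f)"
  by (induction k) (auto intro: smooth_deriv)

lemma smooth_continuous: "smooth f \<Longrightarrow> continuous_on A f"
  using smooth_DERIV by (meson DERIV_continuous_on has_field_derivative_at_within)

lemma smooth_antideriv:
  assumes "\<And>x. (f has_real_derivative g x) (at x)" "smooth g"
  shows "smooth f"
proof -
  have "times_diff n f" for n
    using times_diffI[OF assms(1), of "n - 1"] assms(2) unfolding smooth_iff_times_diff
    by (cases n) auto
  then show ?thesis by (simp add: smooth_iff_times_diff)
qed

lemma times_diff_Suc_lower: "times_diff (Suc n) f \<Longrightarrow> times_diff n f"
  by (simp add: times_diff_iff)

lemma times_diff_const: "times_diff n (\<lambda>x. c)"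
proof (induction n arbitrary: c)
  case (Suc n)
  show ?case by (rule times_diffI[OF _ Suc[of 0]]) (auto intro!: derivative_eq_intros)
qed auto

lemma times_diff_add: "times_diff n f \<Longrightarrow> times_diff n g \<Longrightarrow> times_diff n (\<lambda>x. f x + g x)"
proof (induction n arbitrary: f g)
  case (Suc n)
  then have "times_diff n (\<lambda>x. deriv f x + deriv g x)" by simp
  moreover have "((\<lambda>x. f x + g x) has_real_derivative deriv f x + deriv g x) (at x)" for x
    using Suc.prems by (auto simp: differentiable_on_UNIV_iff intro!: DERIV_add)
  ultimately show ?case by (intro times_diffI)
qed auto

lemma times_diff_mult: "times_diff n f \<Longrightarrow> times_diff n g \<Longrightarrow> times_diff n (\<lambda>x. f x * g x)"
proof (induction n arbitrary: f g)
  case (Suc n)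
  \<comment> \<open>The undifferentiated factors have one derivative to spare, so the induction
    hypothesis applies to both products.\<close>
  have *: "times_diff n (\<lambda>x. deriv f x * g x + deriv g x * f x)"
    using Suc.prems times_diff_Suc_lower Suc.IH by (intro times_diff_add) auto
  have "((\<lambda>x. f x * g x) has_real_derivative deriv f x * g x + deriv g x * f x) (at x)" for x
    using Suc.prems by (auto simp: differentiable_on_UNIV_iff intro!: DERIV_mult)
  from times_diffI[OF this *] show ?case .
qed auto

lemma times_diff_affine: "times_diff n f \<Longrightarrow> times_diff n (\<lambda>x. f (a * x + b))"
proof (induction n arbitrary: f)
  case (Suc n)
  have *: "times_diff n (\<lambda>x. deriv f (a * x + b) * a)"
    using Suc by (intro times_diff_mult times_diff_const) auto
  have "((\<lambda>x. f (a * x + b)) has_real_derivative deriv f (a * x + b) * a) (at x)" for x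
    using Suc.prems
    by (intro DERIV_chain2[where f = f]) (auto simp: differentiable_on_UNIV_iff intro!: derivative_eq_intros)
  from times_diffI[OF this *] show ?case .
qed auto

lemma smooth_const: "smooth (\<lambda>x. c)"
  and smooth_add: "smooth f \<Longrightarrow> smooth g \<Longrightarrow> smooth (\<lambda>x. f x + g x)"
  and smooth_mult: "smooth f \<Longrightarrow> smooth g \<Longrightarrow> smooth (\<lambda>x. f x * g x)"
  and smooth_affine: "smooth f \<Longrightarrow> smooth (\<lambda>x. f (a * x + b))"
  by (simp_all add: smooth_iff_times_diff times_diff_const times_diff_add times_diff_mult times_diff_affine)

lemma smooth_diff: "smooth f \<Longrightarrow> smooth g \<Longrightarrow> smooth (\<lambda>x. f x - g x)"
  using smooth_add[of f "\<lambda>x. (-1) * g x"] smooth_mult[OF smooth_const[of "-1"], of g] by simp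

text \<open>The functions p(1/x) exp(-c/x), extended by 0 to x \<le> 0, form a class closed under
  differentiation: with y = 1/x the derivative has the same shape with the polynomial y^2 (c p(y) -
  p'(y)). Smoothness then follows by induction over all p at once; only the origin requires a
  limit.\<close>

lemma poly_exp_inverse_DERIV:
  fixes p :: "real poly"
  assumes "c > 0"
  shows "((\<lambda>x. if x > 0 then poly p (inverse x) * exp (- c * inverse x) else 0) has_real_derivative
          (if x > 0 then poly ([:0, 0, 1:] * (smult c p - pderiv p)) (inverse x) * exp (- c * inverse x) else 0))
         (at x)" (is "(?F has_real_derivative ?G) _")
proof -
  consider "x > 0" | "x < 0" | "x = 0" by linarith
  then show ?thesis
  proof cases
    case 1
    have ev: "eventually (\<lambda>y. y \<in> {0<..}) (nhds x)" using 1 by (intro eventually_nhds_in_open) auto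
    have "((\<lambda>x. poly p (inverse x) * exp (- c * inverse x)) has_real_derivative ?G) (at x)"
      using 1 by (auto intro!: derivative_eq_intros poly_DERIV[THEN DERIV_chain2]
          simp: power2_eq_square algebra_simps)
    then show ?thesis
      by (rule DERIV_cong_ev[THEN iffD1, rotated -1]) (use ev in \<open>auto elim!: eventually_mono\<close>)
  next
    case 2
    have ev: "eventually (\<lambda>y. y \<in> {..<0}) (nhds x)" using 2 by (intro eventually_nhds_in_open) auto
    have "((\<lambda>x. 0) has_real_derivative 0) (at x)" by simp
    then have "(?F has_real_derivative 0) (at x)"
      by (rule DERIV_cong_ev[THEN iffD1, rotated -1]) (use ev in \<open>auto elim!: eventually_mono\<close>)
    then show ?thesis using 2 by simp
  next
    case 3
    \<comment> \<open>With y = 1/h the difference quotient at 0 from the right is y p(y) exp(-c y),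
      so it suffices that the exponential beats every power.\<close>
    have mono: "((\<lambda>y::real. y ^ k * exp (- c * y)) \<longlongrightarrow> 0) at_top" for k
    proof -
      have "((\<lambda>y. (1 / c ^ k) * ((c * y) ^ k / exp (c * y))) \<longlongrightarrow> (1 / c ^ k) * 0) at_top"
        by (intro tendsto_intros filterlim_compose[OF tendsto_power_div_exp_0]
            filterlim_tendsto_pos_mult_at_top[OF tendsto_const \<open>c > 0\<close>] filterlim_ident)
      then show ?thesis using \<open>c > 0\<close> by (simp add: power_mult_distrib exp_minus field_simps)
    qed
    have lim: "((\<lambda>y. y * (poly p y * exp (- c * y))) \<longlongrightarrow> 0) at_top"
    proof -
      have "((\<lambda>y. \<Sum>i\<le>degree p. coeff p i * (y ^ Suc i * exp (- c * y))) \<longlongrightarrow> (\<Sum>i\<le>degree p. coeff p i * 0)) at_top"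
        by (intro tendsto_intros mono)
      then show ?thesis
        by (simp add: poly_altdef sum_distrib_left sum_distrib_right mult_ac)
    qed
    have "((\<lambda>h. ?F h / h) \<longlongrightarrow> 0) (at_right 0)"
    proof (rule Lim_transform_eventually)
      show "((\<lambda>h. inverse h * (poly p (inverse h) * exp (- c * inverse h))) \<longlongrightarrow> 0) (at_right 0)"
        by (rule filterlim_compose[OF lim filterlim_inverse_at_top_right])
      show "\<forall>\<^sub>F h in at_right 0. inverse h * (poly p (inverse h) * exp (- c * inverse h)) = ?F h / h"
        by (auto simp: eventually_at_filter field_simps)
    qed
    moreover have "((\<lambda>h. ?F h / h) \<longlongrightarrow> 0) (at_left 0)"
    proof (rule Lim_transform_eventually[OF tendsto_const])
      show "\<forall>\<^sub>F h in at_left 0. 0 = ?F h / h"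
        by (auto simp: eventually_at_filter)
    qed
    ultimately have "((\<lambda>h. ?F h / h) \<longlongrightarrow> 0) (at 0)" by (simp add: filterlim_split_at_real)
    then show ?thesis using 3 by (simp add: DERIV_def cong: if_cong)
  qed
qed

lemma smooth_poly_exp_inverse:
  fixes p :: "real poly"
  assumes "c > 0"
  shows "smooth (\<lambda>x. if x > 0 then poly p (inverse x) * exp (- c * inverse x) else 0)"
proof -
  have "times_diff n (\<lambda>x. if x > 0 then poly p (inverse x) * exp (- c * inverse x) else 0)" for n
  proof (induction n arbitrary: p)
    case (Suc n)
    show ?case by (rule times_diffI[OF poly_exp_inverse_DERIV[OF assms] Suc])
  qed auto
  then show ?thesis by (simp add: smooth_iff_times_diff)
qed

text \<open>The parameter c controls the steepness: as c decreases to 0 the function tends, bounded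
  by 1, to the indicator of the open interval, which makes integrals over intervals accessible to
  test functions. The value c = 1 serves as raw material for mollifiers.\<close>

definition bump :: "real \<Rightarrow> real \<Rightarrow> real \<Rightarrow> real \<Rightarrow> real" where
  "bump a b c x = (if a < x \<and> x < b then exp (- c * (inverse (x - a) + inverse (b - x))) else 0)"

lemma smooth_bump:
  assumes "c > 0"
  shows "smooth (bump a b c)"
proof -
  let ?\<sigma> = "\<lambda>x::real. if x > 0 then poly 1 (inverse x) * exp (- c * inverse x) else 0"
  have "smooth (\<lambda>x. ?\<sigma> (1 * x + (- a)) * ?\<sigma> ((-1) * x + b))"
    by (rule smooth_mult; rule smooth_affine; rule smooth_poly_exp_inverse[OF assms])
  also have "(\<lambda>x. ?\<sigma> (1 * x + (- a)) * ?\<sigma> ((-1) * x + b)) = bump a b c"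
    by (auto simp: bump_def fun_eq_iff mult_exp_exp algebra_simps)
  finally show ?thesis .
qed

lemma bump_nonneg: "0 \<le> bump a b c x"
  and bump_le_1: "c \<ge> 0 \<Longrightarrow> bump a b c x \<le> 1"
  and bump_pos: "a < x \<Longrightarrow> x < b \<Longrightarrow> 0 < bump a b c x"
  by (auto simp: bump_def)

lemma bump_outside: "x \<notin> {a<..<b} \<Longrightarrow> bump a b c x = 0"
  by (auto simp: bump_def)

lemma bump_tendsto: "(\<lambda>n. bump a b (inverse (real (Suc n))) x) \<longlonglongrightarrow> indicator {a<..<b} x"
proof (cases "a < x \<and> x < b")
  case True
  have "(\<lambda>n. exp (- inverse (real (Suc n)) * (inverse (x - a) + inverse (b - x)))) \<longlonglongrightarrow> exp (- 0 * (inverse (x - a) + inverse (b - x)))"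
    by (intro tendsto_intros LIMSEQ_inverse_real_of_nat)
  then show ?thesis using True by (simp add: bump_def)
next
  case False
  then show ?thesis by (auto simp: bump_def)
qed

section \<open>Test functions\<close>

lemma test_functionsI:
  assumes "smooth \<phi>" "\<And>x. x \<notin> {a..b} \<Longrightarrow> \<phi> x = 0" "{a..b} \<subseteq> \<Omega>"
  shows "\<phi> \<in> test_functions \<Omega>"
proof -
  have sub: "closure {x. \<phi> x \<noteq> 0} \<subseteq> {a..b}"
    by (rule closure_minimal) (use assms(2) in fastforce, auto)
  then have "compact (closure {x. \<phi> x \<noteq> 0})"
    by (meson bounded_closed_interval bounded_subset closed_closure compact_eq_bounded_closed)
  then show ?thesis
    using assms(1,3) sub unfolding test_functions_def smooth_def by blast
qed

lemma bump_in_test_functions: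
  assumes "c > 0" "{a..b} \<subseteq> \<Omega>"
  shows "bump a b c \<in> test_functions \<Omega>"
  using assms by (intro test_functionsI[of _ a b] smooth_bump bump_outside) auto

lemma test_function_smooth: "\<phi> \<in> test_functions \<Omega> \<Longrightarrow> smooth \<phi>"
  by (simp add: test_functions_def smooth_def)

lemma deriv_zero_outside_support:
  assumes "x \<notin> closure {x. \<phi> x \<noteq> 0}"
  shows "deriv \<phi> x = (0::real)"
proof -
  have "eventually (\<lambda>y. y \<in> - closure {x. \<phi> x \<noteq> 0}) (nhds x)"
    using assms by (intro eventually_nhds_in_open) auto
  then have ev: "eventually (\<lambda>y. \<phi> y = (\<lambda>_. 0) y) (nhds x)"
    by (rule eventually_mono) (use closure_subset[of "{x. \<phi> x \<noteq> 0}"] in auto)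
  show ?thesis using deriv_cong_ev[OF ev refl] by simp
qed

lemma test_function_deriv:
  assumes "\<phi> \<in> test_functions \<Omega>"
  shows "deriv \<phi> \<in> test_functions \<Omega>"
proof -
  let ?S = "closure {x. \<phi> x \<noteq> 0}"
  have S: "compact ?S" "?S \<subseteq> \<Omega>" using assms by (auto simp: test_functions_def)
  have sub: "closure {x. deriv \<phi> x \<noteq> 0} \<subseteq> ?S"
    by (rule closure_minimal) (use deriv_zero_outside_support in auto)
  then have "compact (closure {x. deriv \<phi> x \<noteq> 0})"
    using S(1) by (meson bounded_subset closed_closure compact_eq_bounded_closed)
  then show ?thesis
    using smooth_deriv[OF test_function_smooth[OF assms]] sub S(2)
    unfolding test_functions_def smooth_def by blast
qed

lemma test_function_higher_deriv: "\<phi> \<in> test_functions \<Omega> \<Longrightarrow> (deriv ^^ k) \<phi> \<in> test_functions \<Omega>"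
  by (induction k) (auto intro: test_function_deriv)

lemma test_function_mult:
  assumes "smooth u" "\<phi> \<in> test_functions \<Omega>"
  shows "(\<lambda>x. u x * \<phi> x) \<in> test_functions \<Omega>"
proof -
  let ?S = "closure {x. \<phi> x \<noteq> 0}"
  have S: "compact ?S" "?S \<subseteq> \<Omega>" using assms by (auto simp: test_functions_def)
  have sub: "closure {x. u x * \<phi> x \<noteq> 0} \<subseteq> ?S"
    by (rule closure_mono) auto
  then have "compact (closure {x. u x * \<phi> x \<noteq> 0})"
    using S(1) by (meson bounded_subset closed_closure compact_eq_bounded_closed)
  then show ?thesis
    using smooth_mult[OF assms(1) test_function_smooth[OF assms(2)]] sub S(2)
    unfolding test_functions_def smooth_def by blast
qed

lemma test_function_bounded:
  assumes "\<phi> \<in> test_functions \<Omega>"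
  obtains B where "\<And>x. \<bar>\<phi> x\<bar> \<le> B" "B > 0"
proof -
  let ?S = "closure {x. \<phi> x \<noteq> 0}"
  have "compact (\<phi> ` ?S)"
    using assms by (intro compact_continuous_image smooth_continuous test_function_smooth)
      (auto simp: test_functions_def)
  then obtain B where B: "B > 0" "\<forall>x\<in>?S. norm (\<phi> x) \<le> B"
    by (metis bounded_pos compact_imp_bounded image_iff)
  have "\<bar>\<phi> x\<bar> \<le> B" for x
    using B closure_subset[of "{x. \<phi> x \<noteq> 0}"] by (cases "\<phi> x = 0") auto
  then show ?thesis using that B(1) by blast
qed

lemma test_function_outside: "\<phi> \<in> test_functions \<Omega> \<Longrightarrow> x \<notin> \<Omega> \<Longrightarrow> \<phi> x = 0"
  using closure_subset[of "{x. \<phi> x \<noteq> 0}"] unfolding test_functions_def by blast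

lemma smooth_measurable: "smooth u \<Longrightarrow> u \<in> borel_measurable borel"
  by (intro borel_measurable_continuous_onI smooth_continuous)

lemma integral_deriv_test_function:
  assumes "\<phi> \<in> test_functions \<Omega>"
  shows "(LINT x:\<Omega>|lborel. deriv \<phi> x) = 0"
proof -
  have "bounded (closure {x. \<phi> x \<noteq> 0})"
    using assms by (auto simp: test_functions_def compact_imp_bounded)
  then obtain R where R: "R > 0" "closure {x. \<phi> x \<noteq> 0} \<subseteq> {-R..R}"
    by (auto simp: bounded_pos abs_le_iff subset_eq minus_le_iff)
  have z: "\<phi> x = 0" "deriv \<phi> x = 0" if "x \<notin> {-R..R}" for x
  proof -
    have "x \<notin> closure {x. \<phi> x \<noteq> 0}" using R(2) that by blast
    then show "\<phi> x = 0" "deriv \<phi> x = 0"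
      using closure_subset[of "{x. \<phi> x \<noteq> 0}"] deriv_zero_outside_support[of x \<phi>] by auto
  qed
  \<comment> \<open>\<open>z\<close> speaks of points strictly outside [-R, R] only, so the
    endpoints are moved one unit outwards.\<close>
  let ?R = "R + 1"
  have "integral\<^sup>L lborel (\<lambda>x. indicator {-?R..?R} x *\<^sub>R deriv \<phi> x) = \<phi> ?R - \<phi> (-?R)"
  proof (rule integral_FTC_Icc)
    show "continuous_on {-?R..?R} (deriv \<phi>)"
      by (intro smooth_continuous smooth_deriv test_function_smooth[OF assms])
    show "(\<phi> has_vector_derivative deriv \<phi> x) (at x within {-?R..?R})" for x
      using smooth_DERIV[OF test_function_smooth[OF assms], of x]
      by (simp add: has_field_derivative_at_within has_real_derivative_iff_has_vector_derivative
          has_vector_derivative_at_within)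
  qed (use R(1) in simp)
  also have "\<dots> = 0" using z(1)[of ?R] z(1)[of "-?R"] by auto
  also have "integral\<^sup>L lborel (\<lambda>x. indicator {-?R..?R} x *\<^sub>R deriv \<phi> x) = (LINT x:\<Omega>|lborel. deriv \<phi> x)"
    unfolding set_lebesgue_integral_def
    using z(2) test_function_outside[OF test_function_deriv[OF assms]]
    by (intro Bochner_Integration.integral_cong) (fastforce simp: indicator_def)+
  finally show ?thesis .
qed

section \<open>Weak derivatives\<close>

text \<open>The positive and the negative part of g are densities of two measures that agree and are
  finite on every half-line unbounded to the right. Such measures coincide, and densities are unique
  almost everywhere.\<close>

lemma AE_zero_of_tail_integrals_zero:
  fixes g :: "real \<Rightarrow> real"
  assumes int: "integrable lborel g"
    and zero: "\<And>s. (LINT x:{s<..}|lborel. g x) = 0"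
  shows "AE x in lborel. g x = 0"
proof -
  let ?p = "\<lambda>x. ennreal (g x)" and ?n = "\<lambda>x. ennreal (- g x)"
  have [measurable]: "g \<in> borel_measurable borel" using int by auto
  have fin: "(\<integral>\<^sup>+x. ?p x * indicator A x \<partial>lborel) < \<infinity>" "(\<integral>\<^sup>+x. ?n x * indicator A x \<partial>lborel) < \<infinity>" for A
  proof -
    have B: "(\<integral>\<^sup>+x. ennreal \<bar>g x\<bar> \<partial>lborel) < \<infinity>" using int by (simp add: integrable_iff_bounded)
    have "(\<integral>\<^sup>+x. ?p x * indicator A x \<partial>lborel) \<le> (\<integral>\<^sup>+x. ennreal \<bar>g x\<bar> \<partial>lborel)"
      by (intro nn_integral_mono) (auto simp: indicator_def intro: ennreal_leI)
    moreover have "(\<integral>\<^sup>+x. ?n x * indicator A x \<partial>lborel) \<le> (\<integral>\<^sup>+x. ennreal \<bar>g x\<bar> \<partial>lborel)"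
      by (intro nn_integral_mono) (auto simp: indicator_def intro: ennreal_leI)
    ultimately show "(\<integral>\<^sup>+x. ?p x * indicator A x \<partial>lborel) < \<infinity>" "(\<integral>\<^sup>+x. ?n x * indicator A x \<partial>lborel) < \<infinity>"
      using B by auto
  qed
  have "density lborel ?p = density lborel ?n"
  proof (rule measure_eqI_lessThan)
    fix s :: real
    show "emeasure (density lborel ?p) {s<..} < \<infinity>" using fin by (simp add: emeasure_density)
    have i: "integrable lborel (\<lambda>x. indicator {s<..} x * g x)"
      using integrable_real_mult_indicator[OF _ int, of "{s<..}"] by (simp add: mult.commute)
    have "0 = (LINT x|lborel. indicator {s<..} x * g x)" using zero[of s] by (simp add: set_lebesgue_integral_def)
    also have "\<dots> = enn2real (\<integral>\<^sup>+x. ennreal (indicator {s<..} x * g x) \<partial>lborel) - enn2real (\<integral>\<^sup>+x. ennreal (- (indicator {s<..} x * g x)) \<partial>lborel)"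
      by (rule real_lebesgue_integral_def[OF i])
    also have "(\<integral>\<^sup>+x. ennreal (indicator {s<..} x * g x) \<partial>lborel) = (\<integral>\<^sup>+x. ?p x * indicator {s<..} x \<partial>lborel)"
      by (intro nn_integral_cong) (auto simp: indicator_def)
    also have "(\<integral>\<^sup>+x. ennreal (- (indicator {s<..} x * g x)) \<partial>lborel) = (\<integral>\<^sup>+x. ?n x * indicator {s<..} x \<partial>lborel)"
      by (intro nn_integral_cong) (auto simp: indicator_def)
    finally have "(\<integral>\<^sup>+x. ?p x * indicator {s<..} x \<partial>lborel) = (\<integral>\<^sup>+x. ?n x * indicator {s<..} x \<partial>lborel)"
      using fin[of "{s<..}"] by (metis eq_iff_diff_eq_0 ennreal_enn2real infinity_ennreal_def)
    then show "emeasure (density lborel ?p) {s<..} = emeasure (density lborel ?n) {s<..}"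
      by (simp add: emeasure_density)
  qed auto
  then have "AE x in lborel. ?p x = ?n x"
    by (intro sigma_finite_measure.density_unique[OF sigma_finite_lborel]) auto
  then show ?thesis
    proof eventually_elim
    case (elim x)
    \<comment> \<open>\<open>ennreal\<close> truncates negative reals to 0, so equality of the
      truncations of g x and - g x leaves only g x = 0.\<close>
    then show ?case by (cases "g x \<ge> 0") (auto simp: ennreal_neg)
  qed
qed

text \<open>The factor \<phi> is bounded and vanishes off a compact subset of \<Omega>, so the
  integrability of f on that subset decides.\<close>

lemma set_integrable_locally_integrable_test_function:
  assumes f: "locally_integrable_on \<Omega> f" and \<phi>: "\<phi> \<in> test_functions \<Omega>"
  shows "set_integrable lborel \<Omega> (\<lambda>x. f x * \<phi> x)"
proof -
  let ?S = "closure {x. \<phi> x \<noteq> 0}"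
  have "set_integrable lborel ?S f"
    using assms by (auto simp: locally_integrable_on_def test_functions_def)
  then have i: "integrable lborel (\<lambda>x. indicator ?S x * f x)" by (simp add: set_integrable_def)
  have [measurable]: "\<phi> \<in> borel_measurable borel"
    by (rule smooth_measurable[OF test_function_smooth[OF \<phi>]])
  obtain B where B: "\<And>x. \<bar>\<phi> x\<bar> \<le> B" using test_function_bounded[OF \<phi>] by blast
  have [measurable]: "(\<lambda>x. indicator ?S x * f x) \<in> borel_measurable borel" using i by auto
  have "integrable lborel (\<lambda>x. (indicator ?S x * f x) * \<phi> x)"
  proof (rule Bochner_Integration.integrable_bound)
    show "integrable lborel (\<lambda>x. B * (indicator ?S x * f x))" using i by simp
    show "AE x in lborel. norm (indicator ?S x * f x * \<phi> x) \<le> norm (B * (indicator ?S x * f x))"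
    proof (intro AE_I2)
      fix x
      have "\<bar>indicator ?S x * f x\<bar> * \<bar>\<phi> x\<bar> \<le> \<bar>indicator ?S x * f x\<bar> * \<bar>B\<bar>"
        using B[of x] by (intro mult_left_mono) auto
      then show "norm (indicator ?S x * f x * \<phi> x) \<le> norm (B * (indicator ?S x * f x))"
        by (simp add: abs_mult mult_ac)
    qed
  qed auto
  also have "(\<lambda>x. (indicator ?S x * f x) * \<phi> x) = (\<lambda>x. indicator \<Omega> x *\<^sub>R (f x * \<phi> x))"
  proof
    fix x
    show "(indicator ?S x * f x) * \<phi> x = indicator \<Omega> x *\<^sub>R (f x * \<phi> x)"
      using test_function_outside[OF \<phi>, of x] closure_subset[of "{x. \<phi> x \<noteq> 0}"]
      by (cases "\<phi> x = 0") (auto simp: indicator_def)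
  qed
  finally show ?thesis by (simp add: set_integrable_def)
qed

lemma locally_integrable_lincomb:
  assumes "locally_integrable_on \<Omega> f" "locally_integrable_on \<Omega> g"
  shows "locally_integrable_on \<Omega> (\<lambda>x. A * f x + B * g x)"
proof -
  have "set_integrable lborel K (\<lambda>x. A * f x + B * g x)" if "compact K \<and> K \<subseteq> \<Omega>" for K
    using assms that unfolding locally_integrable_on_def
    by (intro set_integral_add(1) set_integrable_mult_right; blast)
  then show ?thesis by (simp add: locally_integrable_on_def)
qed

lemma is_weak_deriv_lincomb:
  assumes "is_weak_deriv \<Omega> \<alpha> f u" "is_weak_deriv \<Omega> \<alpha> g v"
  shows "is_weak_deriv \<Omega> \<alpha> (\<lambda>x. A * f x + B * g x) (\<lambda>x. A * u x + B * v x)"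
proof -
  have lin: "(LINT x:\<Omega>|lborel. (A * p x + B * q x) * \<phi> x) =
      A * (LINT x:\<Omega>|lborel. p x * \<phi> x) + B * (LINT x:\<Omega>|lborel. q x * \<phi> x)"
    if "locally_integrable_on \<Omega> p" "locally_integrable_on \<Omega> q" "\<phi> \<in> test_functions \<Omega>" for p q \<phi>
  proof -
    note i = set_integrable_locally_integrable_test_function[OF that(1,3)]
      set_integrable_locally_integrable_test_function[OF that(2,3)]
    have "(LINT x:\<Omega>|lborel. (A * p x + B * q x) * \<phi> x) =
        (LINT x:\<Omega>|lborel. A * (p x * \<phi> x) + B * (q x * \<phi> x))"
      by (simp add: algebra_simps)
    also have "\<dots> = (LINT x:\<Omega>|lborel. A * (p x * \<phi> x)) + (LINT x:\<Omega>|lborel. B * (q x * \<phi> x))"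
      by (intro set_integral_add set_integrable_mult_right i)
    finally show ?thesis by simp
  qed
  show ?thesis
    using assms unfolding is_weak_deriv_def
    by (auto simp: lin test_function_higher_deriv locally_integrable_lincomb distrib_left)
qed

lemma is_weak_deriv_cong:
  assumes "\<And>x. x \<in> \<Omega> \<Longrightarrow> f x = g x"
  shows "is_weak_deriv \<Omega> \<alpha> f = is_weak_deriv \<Omega> \<alpha> g"
proof -
  have "set_integrable lborel K f = set_integrable lborel K g" if "K \<subseteq> \<Omega>" for K
    unfolding set_integrable_def using assms that
    by (intro Bochner_Integration.integrable_cong) (auto simp: indicator_def)
  then have "locally_integrable_on \<Omega> f = locally_integrable_on \<Omega> g"
    unfolding locally_integrable_on_def by blast
  moreover have "(LINT x:\<Omega>|lborel. f x * \<psi> x) = (LINT x:\<Omega>|lborel. g x * \<psi> x)" for \<psi>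
    unfolding set_lebesgue_integral_def using assms
    by (intro Bochner_Integration.integral_cong) (auto simp: indicator_def)
  ultimately show ?thesis unfolding is_weak_deriv_def fun_eq_iff by simp
qed

lemma weak_deriv_cong: "(\<And>x. x \<in> \<Omega> \<Longrightarrow> f x = g x) \<Longrightarrow> weak_deriv \<Omega> \<alpha> f = weak_deriv \<Omega> \<alpha> g"
  unfolding weak_deriv_def using is_weak_deriv_cong[of \<Omega> f g] by simp

lemma sobolev_norm_sq_cong:
  assumes "\<And>x. x \<in> \<Omega> \<Longrightarrow> f x = g x"
  shows "sobolev_norm_sq \<Omega> t f = sobolev_norm_sq \<Omega> t g"
proof -
  have "is_weak_deriv \<Omega> \<alpha> f = is_weak_deriv \<Omega> \<alpha> g" "weak_deriv \<Omega> \<alpha> f = weak_deriv \<Omega> \<alpha> g" for \<alpha>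
    using is_weak_deriv_cong[of \<Omega> f g] weak_deriv_cong[of \<Omega> f g] assms by auto
  then show ?thesis unfolding sobolev_norm_sq_def by (simp only:)
qed

lemma locally_integrable_continuous: "continuous_on \<Omega> u \<Longrightarrow> locally_integrable_on \<Omega> u"
  unfolding locally_integrable_on_def set_integrable_def
  by (metis borel_integrable_compact continuous_on_subset)

text \<open>Integration by parts, one order per induction step: a derivative of u times a test
  function is again a test function, so the integral of its derivative is 0 and no boundary terms
  arise.\<close>

lemma is_weak_deriv_smooth:
  assumes "smooth u"
  shows "is_weak_deriv \<Omega> \<alpha> u ((deriv ^^ \<alpha>) u)"
proof (induction \<alpha>)
  case 0
  show ?case using assms by (auto simp: is_weak_deriv_def intro!: locally_integrable_continuous smooth_continuous)
next
  case (Suc \<alpha>)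
  let ?v = "(deriv ^^ \<alpha>) u"
  have v: "smooth ?v" by (rule smooth_higher_deriv[OF assms])
  have l: "locally_integrable_on \<Omega> ?v" "locally_integrable_on \<Omega> (deriv ?v)"
    using v smooth_deriv by (auto intro!: locally_integrable_continuous smooth_continuous)
  have "(LINT x:\<Omega>|lborel. u x * (deriv ^^ Suc \<alpha>) \<phi> x) =
        (-1) ^ Suc \<alpha> * (LINT x:\<Omega>|lborel. (deriv ^^ Suc \<alpha>) u x * \<phi> x)"
    if \<phi>: "\<phi> \<in> test_functions \<Omega>" for \<phi>
  proof -
    have "deriv (\<lambda>x. ?v x * \<phi> x) x = deriv ?v x * \<phi> x + ?v x * deriv \<phi> x" for x
      using DERIV_mult[OF smooth_DERIV[OF v] smooth_DERIV[OF test_function_smooth[OF \<phi>]], of x]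
      by (auto intro!: DERIV_imp_deriv simp: mult.commute)
    then have "0 = (LINT x:\<Omega>|lborel. deriv ?v x * \<phi> x + ?v x * deriv \<phi> x)"
      using integral_deriv_test_function[OF test_function_mult[OF v \<phi>]] by simp
    also have "\<dots> = (LINT x:\<Omega>|lborel. deriv ?v x * \<phi> x) + (LINT x:\<Omega>|lborel. ?v x * deriv \<phi> x)"
      by (intro set_integral_add set_integrable_locally_integrable_test_function l \<phi> test_function_deriv)
    finally have "(LINT x:\<Omega>|lborel. ?v x * deriv \<phi> x) = - (LINT x:\<Omega>|lborel. deriv ?v x * \<phi> x)" by simp
    \<comment> \<open>The extra derivative of \<phi> is taken first: the induction hypothesis is
      applied to the test function \<open>deriv \<phi>\<close>.\<close>
    moreover have "(LINT x:\<Omega>|lborel. u x * (deriv ^^ \<alpha>) (deriv \<phi>) x) = (-1) ^ \<alpha> * (LINT x:\<Omega>|lborel. ?v x * deriv \<phi> x)"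
      using Suc test_function_deriv[OF \<phi>] unfolding is_weak_deriv_def by blast
    moreover have "(deriv ^^ Suc \<alpha>) \<phi> = (deriv ^^ \<alpha>) (deriv \<phi>)" by (simp only: funpow_Suc_right o_apply)
    moreover have "(deriv ^^ Suc \<alpha>) u = deriv ?v" by simp
    ultimately show ?thesis by (simp only:) simp
  qed
  moreover have "locally_integrable_on \<Omega> u"
    using assms by (auto intro!: locally_integrable_continuous smooth_continuous)
  ultimately show ?case using l unfolding is_weak_deriv_def by simp
qed

text \<open>Local integrability controls a function on compact subintervals only; countably many of
  them exhaust the open interval, and the exceptional null sets add up to a null set.\<close>

lemma AE_on_interval_of_compact_subintervals:
  fixes a b :: real
  assumes "\<And>c d. a < c \<Longrightarrow> d < b \<Longrightarrow> AE x in lborel. x \<in> {c..d} \<longrightarrow> P x"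
  shows "AE x in lborel. x \<in> {a<..<b} \<longrightarrow> P x"
proof -
  have "AE x in lborel. \<forall>n. x \<in> {a + inverse (real (Suc n))..b - inverse (real (Suc n))} \<longrightarrow> P x"
    unfolding AE_all_countable by (intro allI assms) auto
  then show ?thesis
  proof eventually_elim
    case (elim x)
    show ?case
    proof
      assume "x \<in> {a<..<b}"
      then have "min (x - a) (b - x) > 0" by simp
      then obtain n where "inverse (real (Suc n)) < min (x - a) (b - x)" using reals_Archimedean by blast
      then have "x \<in> {a + inverse (real (Suc n))..b - inverse (real (Suc n))}" by auto
      then show "P x" using elim by blast
    qed
  qed
qed

text \<open>Fundamental lemma of the calculus of variations. Bumps with parameter 1/(n + 1) converge
  to the indicator of an open subinterval and are bounded by 1, so by dominated convergence g has
  integral 0 over every open interval compactly contained in (a, b). The half-line criterion for the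
  cut-off of g to [c, d] does the rest.\<close>

lemma AE_zero_of_test_functions:
  assumes g: "locally_integrable_on {a<..<b} g"
    and zero: "\<And>\<phi>. \<phi> \<in> test_functions {a<..<b} \<Longrightarrow> (LINT x:{a<..<b}|lborel. g x * \<phi> x) = 0"
  shows "AE x in lborel. x \<in> {a<..<b} \<longrightarrow> g x = 0"
proof (rule AE_on_interval_of_compact_subintervals)
  fix c d :: real assume cd: "a < c" "d < b"
  let ?h = "\<lambda>x. indicator {c..d} x * g x"
  have int: "set_integrable lborel {c'..d'} g" if "a < c'" "d' < b" for c' d'
  proof -
    have "{c'..d'} \<subseteq> {a<..<b}" using that by auto
    then show ?thesis using g unfolding locally_integrable_on_def by blast
  qed
  have z: "(LINT x:{c'<..<d'}|lborel. g x) = 0" if c': "a < c'" "d' < b" for c' d'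
  proof -
    have "(\<lambda>n. LINT x|lborel. indicator {c'..d'} x * g x * bump c' d' (inverse (real (Suc n))) x)
        \<longlonglongrightarrow> (LINT x|lborel. indicator {c'..d'} x * g x * indicator {c'<..<d'} x)"
    proof (rule integral_dominated_convergence[where w = "\<lambda>x. indicator {c'..d'} x * \<bar>g x\<bar>"])
      have i: "integrable lborel (\<lambda>x. indicator {c'..d'} x * g x)"
        using int[OF c'] by (simp add: set_integrable_def)
      then have [measurable]: "(\<lambda>x. indicator {c'..d'} x * g x) \<in> borel_measurable borel" by auto
      show "integrable lborel (\<lambda>x. indicator {c'..d'} x * \<bar>g x\<bar>)"
        using integrable_abs[OF i] by (simp add: abs_mult)
      show "(\<lambda>x. indicator {c'..d'} x * g x * indicator {c'<..<d'} x) \<in> borel_measurable lborel"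
        by measurable
      show "(\<lambda>x. indicator {c'..d'} x * g x * bump c' d' (inverse (real (Suc n))) x) \<in> borel_measurable lborel" for n
        using smooth_measurable[OF smooth_bump, of "inverse (real (Suc n))" c' d'] by measurable
      show "AE x in lborel. (\<lambda>n. indicator {c'..d'} x * g x * bump c' d' (inverse (real (Suc n))) x)
          \<longlonglongrightarrow> indicator {c'..d'} x * g x * indicator {c'<..<d'} x"
        by (intro AE_I2 tendsto_intros bump_tendsto)
      show "AE x in lborel. norm (indicator {c'..d'} x * g x * bump c' d' (inverse (real (Suc n))) x)
          \<le> indicator {c'..d'} x * \<bar>g x\<bar>" for n
        using bump_le_1[of "inverse (real (Suc n))" c' d'] bump_nonneg[of c' d' "inverse (real (Suc n))"]
        by (intro AE_I2) (auto simp: abs_mult indicator_def intro!: mult_left_le)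
    qed
    moreover have "(LINT x|lborel. indicator {c'..d'} x * g x * bump c' d' (inverse (real (Suc n))) x) = 0" for n
    proof -
      have "bump c' d' (inverse (real (Suc n))) \<in> test_functions {a<..<b}"
        using c' by (intro bump_in_test_functions) auto
      from zero[OF this]
      have "(LINT x|lborel. indicator {a<..<b} x *\<^sub>R (g x * bump c' d' (inverse (real (Suc n))) x)) = 0"
        by (simp add: set_lebesgue_integral_def)
      also have "(\<lambda>x. indicator {a<..<b} x *\<^sub>R (g x * bump c' d' (inverse (real (Suc n))) x)) =
          (\<lambda>x. indicator {c'..d'} x * g x * bump c' d' (inverse (real (Suc n))) x)"
        using c' by (auto simp: fun_eq_iff indicator_def bump_def)
      finally show ?thesis .
    qed
    ultimately have "(LINT x|lborel. indicator {c'..d'} x * g x * indicator {c'<..<d'} x) = 0"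
      by (simp add: LIMSEQ_const_iff)
    also have "(\<lambda>x. indicator {c'..d'} x * g x * indicator {c'<..<d'} x) = (\<lambda>x. indicator {c'<..<d'} x *\<^sub>R g x)"
      by (auto simp: fun_eq_iff indicator_def)
    finally show ?thesis by (simp add: set_lebesgue_integral_def)
  qed
  have "AE x in lborel. ?h x = 0"
  proof (rule AE_zero_of_tail_integrals_zero)
    show "integrable lborel ?h" using int[OF cd] by (simp add: set_integrable_def)
    then have [measurable]: "?h \<in> borel_measurable borel" by auto
    fix s :: real
    \<comment> \<open>A tail integral of the cut-off function is an integral over an open
      subinterval, up to the values at c and d.\<close>
    have "(LINT x:{s<..}|lborel. ?h x) = (LINT x:{max s c<..<d}|lborel. g x)"
      unfolding set_lebesgue_integral_def
    proof (rule integral_cong_AE)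
      have "(\<lambda>x. indicator {max s c<..<d} x *\<^sub>R g x) = (\<lambda>x. indicator {max s c<..<d} x * ?h x)"
        by (auto simp: fun_eq_iff indicator_def)
      then show "(\<lambda>x. indicator {max s c<..<d} x *\<^sub>R g x) \<in> borel_measurable lborel" by simp
      show "AE x in lborel. indicator {s<..} x *\<^sub>R ?h x = indicator {max s c<..<d} x *\<^sub>R g x"
        using AE_lborel_singleton[of c] AE_lborel_singleton[of d]
        by eventually_elim (auto simp: indicator_def)
    qed auto
    also have "\<dots> = 0" using cd by (intro z) auto
    finally show "(LINT x:{s<..}|lborel. ?h x) = 0" .
  qed
  then show "AE x in lborel. x \<in> {c..d} \<longrightarrow> g x = 0"
    by eventually_elim auto
qed

lemma is_weak_deriv_unique:
  assumes "is_weak_deriv {a<..<b} \<alpha> f u" "is_weak_deriv {a<..<b} \<alpha> f v"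
  shows "AE x in lborel. x \<in> {a<..<b} \<longrightarrow> u x = v x"
proof -
  from is_weak_deriv_lincomb[OF assms, of 1 "-1"]
  have w: "is_weak_deriv {a<..<b} \<alpha> (\<lambda>x. 0) (\<lambda>x. u x - v x)" by simp
  then have "AE x in lborel. x \<in> {a<..<b} \<longrightarrow> u x - v x = 0"
    unfolding is_weak_deriv_def by (intro AE_zero_of_test_functions) auto
  then show ?thesis by simp
qed

text \<open>Nothing is known of g outside the interval, hence the cut-off. It is the pointwise limit
  of cut-offs to compact subintervals, each of which is integrable.\<close>

lemma locally_integrable_measurable:
  fixes a b :: real
  assumes "locally_integrable_on {a<..<b} g"
  shows "(\<lambda>x. indicator {a<..<b} x * g x) \<in> borel_measurable borel"
proof -
  define r :: "nat \<Rightarrow> real" where "r = (\<lambda>n. inverse (real (Suc n)))"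
  have pos: "r n > 0" for n by (simp add: r_def)
  have lim: "r \<longlonglongrightarrow> 0" unfolding r_def by (rule LIMSEQ_inverse_real_of_nat)
  let ?K = "\<lambda>n. {a + r n..b - r n}"
  have sub: "x \<in> {a<..<b}" if "x \<in> ?K n" for x n
    using that pos[of n] by auto
  show ?thesis
  proof (rule borel_measurable_LIMSEQ_real)
    show "(\<lambda>x. indicator (?K n) x * g x) \<in> borel_measurable borel" for n
    proof -
      have "compact (?K n)" "?K n \<subseteq> {a<..<b}" using sub by blast+
      then have "set_integrable lborel (?K n) g" using assms unfolding locally_integrable_on_def by blast
      then show ?thesis unfolding set_integrable_def by auto
    qed
    fix x
    show "(\<lambda>n. indicator (?K n) x * g x) \<longlonglongrightarrow> indicator {a<..<b} x * g x"
    proof (cases "x \<in> {a<..<b}")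
      case True
      then have "min (x - a) (b - x) > 0" by simp
      then have "\<forall>\<^sub>F n in sequentially. r n < min (x - a) (b - x)"
        using lim by (rule order_tendstoD(2)[rotated])
      then have "\<forall>\<^sub>F n in sequentially. indicator (?K n) x * g x = indicator {a<..<b} x * g x"
        by eventually_elim (use True in \<open>auto simp: indicator_def\<close>)
      then show ?thesis by (rule tendsto_eventually)
    next
      case False
      then have "indicator (?K n) x * g x = indicator {a<..<b} x * g x" for n
        using sub[of x n] by (auto simp: indicator_def)
      then show ?thesis by (simp only: tendsto_const)
    qed
  qed
qed

section \<open>The Sobolev norm as a quadratic form\<close>

text \<open>The squared Sobolev norm with the chosen weak derivatives replaced by an arbitrary
  family: \<open>u \<alpha>\<close> stands for the derivative of order \<alpha>. This permits Borel
  versions in place of those picked by \<open>weak_deriv\<close>.\<close>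

definition tuple_norm_sq :: "real set \<Rightarrow> real \<Rightarrow> (nat \<Rightarrow> real \<Rightarrow> real) \<Rightarrow> ennreal" where
  "tuple_norm_sq \<Omega> t u =
     (\<Sum>\<alpha>\<le>nat \<lfloor>t\<rfloor>. l2_norm_sq \<Omega> (u \<alpha>)) +
     (if t \<in> \<int> then 0 else gagliardo_sq \<Omega> (t - \<lfloor>t\<rfloor>) (u (nat \<lfloor>t\<rfloor>)))"

lemma l2_norm_sq_cong_AE:
  assumes "AE x in lborel. x \<in> \<Omega> \<longrightarrow> u x = v x"
  shows "l2_norm_sq \<Omega> u = l2_norm_sq \<Omega> v"
  unfolding l2_norm_sq_def
  by (intro nn_integral_cong_AE) (use assms in eventually_elim, auto simp: indicator_def)

lemma gagliardo_sq_cong_AE: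
  assumes "AE x in lborel. x \<in> \<Omega> \<longrightarrow> u x = v x"
  shows "gagliardo_sq \<Omega> r u = gagliardo_sq \<Omega> r v"
  unfolding gagliardo_sq_def
proof (intro nn_integral_cong_AE, use assms in eventually_elim)
  case (elim y)
  have "(\<integral>\<^sup>+x\<in>\<Omega>. ennreal ((u x - u y)\<^sup>2 / \<bar>x - y\<bar> powr (1 + 2 * r)) \<partial>lborel) =
        (\<integral>\<^sup>+x\<in>\<Omega>. ennreal ((v x - v y)\<^sup>2 / \<bar>x - y\<bar> powr (1 + 2 * r)) \<partial>lborel)" if "y \<in> \<Omega>"
    by (intro nn_integral_cong_AE) (use assms in eventually_elim, use elim that in \<open>auto simp: indicator_def\<close>)
  then show ?case by (auto simp: indicator_def)
qed

lemma tuple_norm_sq_cong_AE: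
  assumes "\<And>\<alpha>. \<alpha> \<le> nat \<lfloor>t\<rfloor> \<Longrightarrow> AE x in lborel. x \<in> \<Omega> \<longrightarrow> u \<alpha> x = v \<alpha> x"
  shows "tuple_norm_sq \<Omega> t u = tuple_norm_sq \<Omega> t v"
  unfolding tuple_norm_sq_def
  using l2_norm_sq_cong_AE[OF assms] gagliardo_sq_cong_AE[OF assms[of "nat \<lfloor>t\<rfloor>"]]
  by (auto intro!: arg_cong2[where f = "(+)"] sum.cong)

text \<open>A pointwise inequality between quadratic forms survives multiplication by a weight and
  integration. The later norm estimates, from the parallelogram law to Young's inequality, are
  instances that differ in the coefficients; there are two squares on the left so that the
  parallelogram law fits into \<open>ennreal\<close>, where differences are awkward.\<close>

lemma nn_integral_quadratic_le:
  fixes P Q :: "'a \<Rightarrow> real" and W :: "'a \<Rightarrow> ennreal"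
  assumes [measurable]: "P \<in> borel_measurable N" "Q \<in> borel_measurable N" "W \<in> borel_measurable N"
    and nn: "c1 \<ge> 0" "c2 \<ge> 0" "c3 \<ge> 0" "c4 \<ge> 0"
    and le: "\<And>x y :: real. c1 * (A * x + B * y)\<^sup>2 + c2 * (A' * x + B' * y)\<^sup>2 \<le> c3 * x\<^sup>2 + c4 * y\<^sup>2"
  shows "ennreal c1 * (\<integral>\<^sup>+z. ennreal ((A * P z + B * Q z)\<^sup>2) * W z \<partial>N)
       + ennreal c2 * (\<integral>\<^sup>+z. ennreal ((A' * P z + B' * Q z)\<^sup>2) * W z \<partial>N)
      \<le> ennreal c3 * (\<integral>\<^sup>+z. ennreal ((P z)\<^sup>2) * W z \<partial>N) + ennreal c4 * (\<integral>\<^sup>+z. ennreal ((Q z)\<^sup>2) * W z \<partial>N)"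
proof -
  have "ennreal c1 * ennreal ((A * x + B * y)\<^sup>2) + ennreal c2 * ennreal ((A' * x + B' * y)\<^sup>2)
      \<le> ennreal c3 * ennreal (x\<^sup>2) + ennreal c4 * ennreal (y\<^sup>2)" for x y
    using nn le[of x y] by (simp add: ennreal_leI flip: ennreal_mult ennreal_plus)
  then have pt: "ennreal c1 * (ennreal ((A * x + B * y)\<^sup>2) * w) + ennreal c2 * (ennreal ((A' * x + B' * y)\<^sup>2) * w)
      \<le> ennreal c3 * (ennreal (x\<^sup>2) * w) + ennreal c4 * (ennreal (y\<^sup>2) * w)" for x y w
    by (simp add: mult.assoc[symmetric] mult_right_mono flip: distrib_right)
  have "ennreal c1 * (\<integral>\<^sup>+z. ennreal ((A * P z + B * Q z)\<^sup>2) * W z \<partial>N)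
       + ennreal c2 * (\<integral>\<^sup>+z. ennreal ((A' * P z + B' * Q z)\<^sup>2) * W z \<partial>N)
     = (\<integral>\<^sup>+z. ennreal c1 * (ennreal ((A * P z + B * Q z)\<^sup>2) * W z) + ennreal c2 * (ennreal ((A' * P z + B' * Q z)\<^sup>2) * W z) \<partial>N)"
    by (simp add: nn_integral_add nn_integral_cmult)
  also have "\<dots> \<le> (\<integral>\<^sup>+z. ennreal c3 * (ennreal ((P z)\<^sup>2) * W z) + ennreal c4 * (ennreal ((Q z)\<^sup>2) * W z) \<partial>N)"
    by (intro nn_integral_mono pt)
  also have "\<dots> = ennreal c3 * (\<integral>\<^sup>+z. ennreal ((P z)\<^sup>2) * W z \<partial>N) + ennreal c4 * (\<integral>\<^sup>+z. ennreal ((Q z)\<^sup>2) * W z \<partial>N)"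
    by (simp add: nn_integral_add nn_integral_cmult)
  finally show ?thesis .
qed

text \<open>Over pairs z = (y, x) the seminorm is a weighted integral of the square of u(x) - u(y),
  an expression linear in u, so that the quadratic inequality above applies. On the diagonal the
  weight is 0, because HOL divides by 0 there.\<close>

definition gagliardo_weight :: "real set \<Rightarrow> real \<Rightarrow> real \<times> real \<Rightarrow> ennreal" where
  "gagliardo_weight \<Omega> r z =
     ennreal (1 / \<bar>snd z - fst z\<bar> powr (1 + 2 * r)) * (indicator \<Omega> (snd z) * indicator \<Omega> (fst z))"

lemma gagliardo_weight_measurable [measurable]:
  assumes [measurable]: "\<Omega> \<in> sets borel"
  shows "gagliardo_weight \<Omega> r \<in> borel_measurable (lborel \<Otimes>\<^sub>M lborel)"
  unfolding gagliardo_weight_def by measurable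

lemma gagliardo_sq_product:
  assumes [measurable]: "\<Omega> \<in> sets borel" "u \<in> borel_measurable borel"
  shows "gagliardo_sq \<Omega> r u =
    (\<integral>\<^sup>+z. ennreal ((u (snd z) - u (fst z))\<^sup>2) * gagliardo_weight \<Omega> r z \<partial>(lborel \<Otimes>\<^sub>M lborel))"
proof -
  have "gagliardo_sq \<Omega> r u = (\<integral>\<^sup>+y. \<integral>\<^sup>+x. ennreal ((u x - u y)\<^sup>2) * gagliardo_weight \<Omega> r (y, x) \<partial>lborel \<partial>lborel)"
    unfolding gagliardo_sq_def gagliardo_weight_def
    by (intro nn_integral_cong) (auto simp: indicator_def divide_inverse ennreal_mult intro!: nn_integral_cong)
  also have "\<dots> = (\<integral>\<^sup>+z. ennreal ((u (snd z) - u (fst z))\<^sup>2) * gagliardo_weight \<Omega> r z \<partial>(lborel \<Otimes>\<^sub>M lborel))"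
    by (subst lborel.nn_integral_fst[symmetric]) auto
  finally show ?thesis .
qed

lemma tuple_norm_sq_lincomb_le:
  assumes [measurable]: "\<Omega> \<in> sets borel" "\<And>\<alpha>. u \<alpha> \<in> borel_measurable borel" "\<And>\<alpha>. v \<alpha> \<in> borel_measurable borel"
    and nn: "c1 \<ge> 0" "c2 \<ge> 0" "c3 \<ge> 0" "c4 \<ge> 0"
    and le: "\<And>x y :: real. c1 * (A * x + B * y)\<^sup>2 + c2 * (A' * x + B' * y)\<^sup>2 \<le> c3 * x\<^sup>2 + c4 * y\<^sup>2"
  shows "ennreal c1 * tuple_norm_sq \<Omega> t (\<lambda>\<alpha> x. A * u \<alpha> x + B * v \<alpha> x)
      + ennreal c2 * tuple_norm_sq \<Omega> t (\<lambda>\<alpha> x. A' * u \<alpha> x + B' * v \<alpha> x)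
      \<le> ennreal c3 * tuple_norm_sq \<Omega> t u + ennreal c4 * tuple_norm_sq \<Omega> t v"
proof -
  have l2: "ennreal c1 * l2_norm_sq \<Omega> (\<lambda>x. A * u \<alpha> x + B * v \<alpha> x) + ennreal c2 * l2_norm_sq \<Omega> (\<lambda>x. A' * u \<alpha> x + B' * v \<alpha> x)
      \<le> ennreal c3 * l2_norm_sq \<Omega> (u \<alpha>) + ennreal c4 * l2_norm_sq \<Omega> (v \<alpha>)" for \<alpha>
    unfolding l2_norm_sq_def by (rule nn_integral_quadratic_le[OF _ _ _ nn le]) auto
  have "ennreal c1 * (\<integral>\<^sup>+z. ennreal ((A * (u \<alpha> (snd z) - u \<alpha> (fst z)) + B * (v \<alpha> (snd z) - v \<alpha> (fst z)))\<^sup>2) * gagliardo_weight \<Omega> r z \<partial>(lborel \<Otimes>\<^sub>M lborel))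
      + ennreal c2 * (\<integral>\<^sup>+z. ennreal ((A' * (u \<alpha> (snd z) - u \<alpha> (fst z)) + B' * (v \<alpha> (snd z) - v \<alpha> (fst z)))\<^sup>2) * gagliardo_weight \<Omega> r z \<partial>(lborel \<Otimes>\<^sub>M lborel))
      \<le> ennreal c3 * gagliardo_sq \<Omega> r (u \<alpha>) + ennreal c4 * gagliardo_sq \<Omega> r (v \<alpha>)" for r \<alpha>
    unfolding gagliardo_sq_product[OF assms(1,2)] gagliardo_sq_product[OF assms(1,3)]
    by (rule nn_integral_quadratic_le[OF _ _ _ nn le]) auto
  then have gag: "ennreal c1 * gagliardo_sq \<Omega> r (\<lambda>x. A * u \<alpha> x + B * v \<alpha> x) + ennreal c2 * gagliardo_sq \<Omega> r (\<lambda>x. A' * u \<alpha> x + B' * v \<alpha> x)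
      \<le> ennreal c3 * gagliardo_sq \<Omega> r (u \<alpha>) + ennreal c4 * gagliardo_sq \<Omega> r (v \<alpha>)" for r \<alpha>
    by (simp add: gagliardo_sq_product[of _ "\<lambda>x. _ * u \<alpha> x + _ * v \<alpha> x"] algebra_simps)
  have "ennreal c1 * tuple_norm_sq \<Omega> t (\<lambda>\<alpha> x. A * u \<alpha> x + B * v \<alpha> x)
      + ennreal c2 * tuple_norm_sq \<Omega> t (\<lambda>\<alpha> x. A' * u \<alpha> x + B' * v \<alpha> x) =
      (\<Sum>\<alpha>\<le>nat \<lfloor>t\<rfloor>. ennreal c1 * l2_norm_sq \<Omega> (\<lambda>x. A * u \<alpha> x + B * v \<alpha> x) + ennreal c2 * l2_norm_sq \<Omega> (\<lambda>x. A' * u \<alpha> x + B' * v \<alpha> x)) +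
      (if t \<in> \<int> then 0 else
        ennreal c1 * gagliardo_sq \<Omega> (t - \<lfloor>t\<rfloor>) (\<lambda>x. A * u (nat \<lfloor>t\<rfloor>) x + B * v (nat \<lfloor>t\<rfloor>) x)
        + ennreal c2 * gagliardo_sq \<Omega> (t - \<lfloor>t\<rfloor>) (\<lambda>x. A' * u (nat \<lfloor>t\<rfloor>) x + B' * v (nat \<lfloor>t\<rfloor>) x))"
    unfolding tuple_norm_sq_def distrib_left sum_distrib_left by (simp add: sum.distrib ac_simps)
  also have "\<dots> \<le> (\<Sum>\<alpha>\<le>nat \<lfloor>t\<rfloor>. ennreal c3 * l2_norm_sq \<Omega> (u \<alpha>) + ennreal c4 * l2_norm_sq \<Omega> (v \<alpha>)) +
      (if t \<in> \<int> then 0 else ennreal c3 * gagliardo_sq \<Omega> (t - \<lfloor>t\<rfloor>) (u (nat \<lfloor>t\<rfloor>)) + ennreal c4 * gagliardo_sq \<Omega> (t - \<lfloor>t\<rfloor>) (v (nat \<lfloor>t\<rfloor>)))"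
    using gag by (intro add_mono sum_mono l2) auto
  also have "\<dots> = ennreal c3 * tuple_norm_sq \<Omega> t u + ennreal c4 * tuple_norm_sq \<Omega> t v"
    unfolding tuple_norm_sq_def distrib_left sum_distrib_left by (simp add: sum.distrib ac_simps)
  finally show ?thesis .
qed

section \<open>Lower semicontinuity of the norm under almost everywhere convergence\<close>

lemma l2_norm_sq_Fatou:
  assumes [measurable]: "\<Omega> \<in> sets borel" "\<And>n. u n \<in> borel_measurable borel"
    and lim: "AE x in lborel. x \<in> \<Omega> \<longrightarrow> (\<lambda>n. u n x) \<longlonglongrightarrow> U x"
  shows "l2_norm_sq \<Omega> U \<le> liminf (\<lambda>n. l2_norm_sq \<Omega> (u n))"
proof -
  have "l2_norm_sq \<Omega> U = (\<integral>\<^sup>+x. liminf (\<lambda>n. ennreal ((u n x)\<^sup>2) * indicator \<Omega> x) \<partial>lborel)"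
    unfolding l2_norm_sq_def
  proof (rule nn_integral_cong_AE, use lim in eventually_elim)
    case (elim x)
    show ?case
    proof (cases "x \<in> \<Omega>")
      case True
      then have "(\<lambda>n. ennreal ((u n x)\<^sup>2)) \<longlonglongrightarrow> ennreal ((U x)\<^sup>2)"
        using elim by (intro tendsto_ennrealI tendsto_power) auto
      then show ?thesis using True by (simp add: lim_imp_Liminf del: tendsto_ennreal_iff)
    qed (simp add: Liminf_const)
  qed
  also have "\<dots> \<le> liminf (\<lambda>n. l2_norm_sq \<Omega> (u n))"
    unfolding l2_norm_sq_def by (rule nn_integral_liminf) auto
  finally show ?thesis .
qed

text \<open>Almost everywhere convergence is available in each variable separately, so Fatou's lemma
  is applied twice, to the inner and to the outer integral.\<close>

lemma gagliardo_sq_Fatou: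
  assumes [measurable]: "\<Omega> \<in> sets borel" "\<And>n. u n \<in> borel_measurable borel"
    and lim: "AE x in lborel. x \<in> \<Omega> \<longrightarrow> (\<lambda>n. u n x) \<longlonglongrightarrow> U x"
  shows "gagliardo_sq \<Omega> r U \<le> liminf (\<lambda>n. gagliardo_sq \<Omega> r (u n))"
proof -
  let ?k = "\<lambda>n x y. ennreal ((u n x - u n y)\<^sup>2 / \<bar>x - y\<bar> powr (1 + 2 * r))"
  have "gagliardo_sq \<Omega> r U = (\<integral>\<^sup>+y\<in>\<Omega>. (\<integral>\<^sup>+x. liminf (\<lambda>n. ?k n x y * indicator \<Omega> x) \<partial>lborel) \<partial>lborel)"
    unfolding gagliardo_sq_def
  proof (rule nn_integral_cong_AE, use lim in eventually_elim)
    case (elim y)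
    have "(\<integral>\<^sup>+x\<in>\<Omega>. ennreal ((U x - U y)\<^sup>2 / \<bar>x - y\<bar> powr (1 + 2 * r)) \<partial>lborel) =
      (\<integral>\<^sup>+x. liminf (\<lambda>n. ?k n x y * indicator \<Omega> x) \<partial>lborel)"
      if y: "y \<in> \<Omega>"
    proof (rule nn_integral_cong_AE, use lim in eventually_elim)
      case x: (elim x)
      show ?case
      proof (cases "x \<in> \<Omega>")
        case True
        then have "(\<lambda>n. ?k n x y) \<longlonglongrightarrow> ennreal ((U x - U y)\<^sup>2 / \<bar>x - y\<bar> powr (1 + 2 * r))"
          using elim x y by (cases "x = y") (auto intro!: tendsto_intros)
        then show ?thesis using True by (simp add: lim_imp_Liminf del: tendsto_ennreal_iff)
      qed (simp add: Liminf_const)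
    qed
    then show ?case by (cases "y \<in> \<Omega>") auto
  qed
  also have "\<dots> \<le> (\<integral>\<^sup>+y. liminf (\<lambda>n. (\<integral>\<^sup>+x\<in>\<Omega>. ?k n x y \<partial>lborel) * indicator \<Omega> y) \<partial>lborel)"
  proof (rule nn_integral_mono)
    fix y
    have "(\<integral>\<^sup>+x. liminf (\<lambda>n. ?k n x y * indicator \<Omega> x) \<partial>lborel)
      \<le> liminf (\<lambda>n. \<integral>\<^sup>+x\<in>\<Omega>. ?k n x y \<partial>lborel)"
      by (rule nn_integral_liminf) auto
    then show "(\<integral>\<^sup>+x. liminf (\<lambda>n. ?k n x y * indicator \<Omega> x) \<partial>lborel) * indicator \<Omega> y
      \<le> liminf (\<lambda>n. (\<integral>\<^sup>+x\<in>\<Omega>. ?k n x y \<partial>lborel) * indicator \<Omega> y)"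
      by (cases "y \<in> \<Omega>") auto
  qed
  also have "\<dots> \<le> liminf (\<lambda>n. gagliardo_sq \<Omega> r (u n))"
    unfolding gagliardo_sq_def by (rule nn_integral_liminf) auto
  finally show ?thesis .
qed

lemma tuple_norm_sq_Fatou:
  assumes "\<Omega> \<in> sets borel" "\<And>n \<alpha>. u n \<alpha> \<in> borel_measurable borel"
    and lim: "\<And>\<alpha>. \<alpha> \<le> nat \<lfloor>t\<rfloor> \<Longrightarrow> AE x in lborel. x \<in> \<Omega> \<longrightarrow> (\<lambda>n. u n \<alpha> x) \<longlonglongrightarrow> U \<alpha> x"
  shows "tuple_norm_sq \<Omega> t U \<le> liminf (\<lambda>n. tuple_norm_sq \<Omega> t (u n))"
proof -
  let ?m = "nat \<lfloor>t\<rfloor>"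
  \<comment> \<open>Written as an integral over a counting measure, with one additional index for
    the Gagliardo term, the finite sum is covered by Fatou's lemma as well.\<close>
  define c where "c = (\<lambda>u i. if i \<le> ?m then l2_norm_sq \<Omega> (u i) else if t \<in> \<int> then 0 else gagliardo_sq \<Omega> (t - \<lfloor>t\<rfloor>) (u ?m))"
  have c: "tuple_norm_sq \<Omega> t u = (\<integral>\<^sup>+i. c u i \<partial>count_space {..Suc ?m})" for u
    unfolding nn_integral_count_space_finite[OF finite_atMost] tuple_norm_sq_def c_def by simp
  have "c U i \<le> liminf (\<lambda>n. c (u n) i)" for i
    unfolding c_def using assms
    by (auto intro!: l2_norm_sq_Fatou gagliardo_sq_Fatou)
  then have "tuple_norm_sq \<Omega> t U \<le> (\<integral>\<^sup>+i. liminf (\<lambda>n. c (u n) i) \<partial>count_space {..Suc ?m})"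
    unfolding c by (intro nn_integral_mono)
  also have "\<dots> \<le> liminf (\<lambda>n. tuple_norm_sq \<Omega> t (u n))"
    unfolding c by (rule nn_integral_liminf) auto
  finally show ?thesis .
qed

section \<open>From tuples of derivatives back to the Sobolev norm\<close>

lemma is_weak_deriv_cong_right:
  assumes w: "is_weak_deriv \<Omega> \<alpha> f u" and eq: "\<And>x. x \<in> \<Omega> \<Longrightarrow> u x = v x"
  shows "is_weak_deriv \<Omega> \<alpha> f v"
proof -
  have "set_integrable lborel K u = set_integrable lborel K v" if "K \<subseteq> \<Omega>" for K
    unfolding set_integrable_def using eq that
    by (intro Bochner_Integration.integrable_cong) (auto simp: indicator_def)
  then have "locally_integrable_on \<Omega> v"
    using w unfolding is_weak_deriv_def locally_integrable_on_def by blast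
  moreover have "(LINT x:\<Omega>|lborel. u x * \<psi> x) = (LINT x:\<Omega>|lborel. v x * \<psi> x)" for \<psi>
    unfolding set_lebesgue_integral_def using eq
    by (intro Bochner_Integration.integral_cong) (auto simp: indicator_def)
  ultimately show ?thesis using w unfolding is_weak_deriv_def by simp
qed

lemma is_weak_deriv_weak_deriv:
  assumes "is_weak_deriv \<Omega> \<alpha> f u"
  shows "is_weak_deriv \<Omega> \<alpha> f (weak_deriv \<Omega> \<alpha> f)"
  unfolding weak_deriv_def by (rule someI_ex[of "is_weak_deriv \<Omega> \<alpha> f"]) (use assms in blast)

text \<open>Weak derivatives of the same order agree almost everywhere on the interval, and the
  integrals do not see null sets; the choice made by \<open>weak_deriv\<close> is therefore
  immaterial.\<close>

lemma sobolev_norm_sq_eq_tuple: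
  assumes "\<And>\<alpha>. \<alpha> \<le> nat \<lfloor>t\<rfloor> \<Longrightarrow> is_weak_deriv {a<..<b} \<alpha> f (u \<alpha>)"
  shows "sobolev_norm_sq {a<..<b} t f = tuple_norm_sq {a<..<b} t u"
proof -
  have "is_weak_deriv {a<..<b} \<alpha> f (weak_deriv {a<..<b} \<alpha> f)" if "\<alpha> \<le> nat \<lfloor>t\<rfloor>" for \<alpha>
    by (rule is_weak_deriv_weak_deriv[OF assms[OF that]])
  then have "tuple_norm_sq {a<..<b} t (\<lambda>\<alpha>. weak_deriv {a<..<b} \<alpha> f) = tuple_norm_sq {a<..<b} t u"
    using assms by (intro tuple_norm_sq_cong_AE is_weak_deriv_unique) auto
  moreover have "\<forall>\<alpha>\<le>nat \<lfloor>t\<rfloor>. \<exists>g. is_weak_deriv {a<..<b} \<alpha> f g" using assms by blast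
  ultimately show ?thesis
    unfolding sobolev_norm_sq_def using tuple_norm_sq_def by (subst if_P) simp_all
qed

lemma sobolev_norm_sq_finiteE:
  assumes "sobolev_norm_sq {a<..<b} t f < \<infinity>"
  obtains u where "\<And>\<alpha>. \<alpha> \<le> nat \<lfloor>t\<rfloor> \<Longrightarrow> is_weak_deriv {a<..<b} \<alpha> f (u \<alpha>)"
    "\<And>\<alpha>. u \<alpha> \<in> borel_measurable borel"
    "sobolev_norm_sq {a<..<b} t f = tuple_norm_sq {a<..<b} t u"
proof -
  have ex: "\<forall>\<alpha>\<le>nat \<lfloor>t\<rfloor>. \<exists>g. is_weak_deriv {a<..<b} \<alpha> f g"
  proof (rule ccontr)
    assume "\<not> ?thesis"
    then have "sobolev_norm_sq {a<..<b} t f = \<infinity>" unfolding sobolev_norm_sq_def by (rule if_not_P)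
    with assms show False by simp
  qed
  \<comment> \<open>Cutting off outside the interval gives versions that are Borel on the whole
    line; orders above \<lfloor>t\<rfloor> are filled with 0 so that measurability holds for every
    index.\<close>
  define u where "u = (\<lambda>\<alpha> x. if \<alpha> \<le> nat \<lfloor>t\<rfloor> then indicator {a<..<b} x * weak_deriv {a<..<b} \<alpha> f x else 0)"
  have w: "is_weak_deriv {a<..<b} \<alpha> f (weak_deriv {a<..<b} \<alpha> f)" if "\<alpha> \<le> nat \<lfloor>t\<rfloor>" for \<alpha>
    using ex that is_weak_deriv_weak_deriv by blast
  have u: "is_weak_deriv {a<..<b} \<alpha> f (u \<alpha>)" if "\<alpha> \<le> nat \<lfloor>t\<rfloor>" for \<alpha>
    using w[OF that] by (rule is_weak_deriv_cong_right) (simp add: u_def that)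
  moreover have "u \<alpha> \<in> borel_measurable borel" for \<alpha>
  proof (cases "\<alpha> \<le> nat \<lfloor>t\<rfloor>")
    case True
    then show ?thesis using w[OF True] unfolding u_def is_weak_deriv_def
      by (simp add: locally_integrable_measurable)
  qed (simp add: u_def)
  ultimately show ?thesis using that sobolev_norm_sq_eq_tuple[of t a b f u] by blast
qed

lemma sobolev_norm_sq_lincomb2_le:
  assumes fin: "sobolev_norm_sq {a<..<b} t f < \<infinity>" "sobolev_norm_sq {a<..<b} t g < \<infinity>"
    and nn: "c1 \<ge> 0" "c2 \<ge> 0" "c3 \<ge> 0" "c4 \<ge> 0"
    and le: "\<And>x y :: real. c1 * (A * x + B * y)\<^sup>2 + c2 * (A' * x + B' * y)\<^sup>2 \<le> c3 * x\<^sup>2 + c4 * y\<^sup>2"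
  shows "ennreal c1 * sobolev_norm_sq {a<..<b} t (\<lambda>x. A * f x + B * g x)
      + ennreal c2 * sobolev_norm_sq {a<..<b} t (\<lambda>x. A' * f x + B' * g x)
      \<le> ennreal c3 * sobolev_norm_sq {a<..<b} t f + ennreal c4 * sobolev_norm_sq {a<..<b} t g"
proof -
  obtain u where u: "\<And>\<alpha>. \<alpha> \<le> nat \<lfloor>t\<rfloor> \<Longrightarrow> is_weak_deriv {a<..<b} \<alpha> f (u \<alpha>)"
    "\<And>\<alpha>. u \<alpha> \<in> borel_measurable borel" "sobolev_norm_sq {a<..<b} t f = tuple_norm_sq {a<..<b} t u"
    using sobolev_norm_sq_finiteE[OF fin(1)] by blast
  obtain v where v: "\<And>\<alpha>. \<alpha> \<le> nat \<lfloor>t\<rfloor> \<Longrightarrow> is_weak_deriv {a<..<b} \<alpha> g (v \<alpha>)"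
    "\<And>\<alpha>. v \<alpha> \<in> borel_measurable borel" "sobolev_norm_sq {a<..<b} t g = tuple_norm_sq {a<..<b} t v"
    using sobolev_norm_sq_finiteE[OF fin(2)] by blast
  have "sobolev_norm_sq {a<..<b} t (\<lambda>x. C * f x + C' * g x) = tuple_norm_sq {a<..<b} t (\<lambda>\<alpha> x. C * u \<alpha> x + C' * v \<alpha> x)" for C C'
    by (intro sobolev_norm_sq_eq_tuple is_weak_deriv_lincomb u(1) v(1))
  then show ?thesis
    using tuple_norm_sq_lincomb_le[OF _ u(2) v(2) nn le] u(3) v(3) by simp
qed

lemma sobolev_norm_sq_lincomb_le:
  assumes fin: "sobolev_norm_sq {a<..<b} t f < \<infinity>" "sobolev_norm_sq {a<..<b} t g < \<infinity>"
    and nn: "c3 \<ge> 0" "c4 \<ge> 0"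
    and le: "\<And>x y :: real. (A * x + B * y)\<^sup>2 \<le> c3 * x\<^sup>2 + c4 * y\<^sup>2"
  shows "sobolev_norm_sq {a<..<b} t (\<lambda>x. A * f x + B * g x)
      \<le> ennreal c3 * sobolev_norm_sq {a<..<b} t f + ennreal c4 * sobolev_norm_sq {a<..<b} t g"
  using sobolev_norm_sq_lincomb2_le[OF fin _ _ nn, of 1 0 A B 0 0] le by simp

lemma is_weak_deriv_0_AE:
  assumes "is_weak_deriv {a<..<b} 0 f u"
  shows "AE x in lborel. x \<in> {a<..<b} \<longrightarrow> f x = u x"
  by (rule is_weak_deriv_unique[OF _ assms]) (use assms in \<open>simp add: is_weak_deriv_def\<close>)

lemma l2_norm_sq_le_tuple: "\<alpha> \<le> nat \<lfloor>t\<rfloor> \<Longrightarrow> l2_norm_sq \<Omega> (u \<alpha>) \<le> tuple_norm_sq \<Omega> t u"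
  unfolding tuple_norm_sq_def
  by (rule add_increasing2) (auto intro!: member_le_sum)

lemma l2_norm_sq_le_sobolev: "l2_norm_sq {a<..<b} f \<le> sobolev_norm_sq {a<..<b} t f"
proof (cases "sobolev_norm_sq {a<..<b} t f < \<infinity>")
  case True
  then obtain u where u: "\<And>\<alpha>. \<alpha> \<le> nat \<lfloor>t\<rfloor> \<Longrightarrow> is_weak_deriv {a<..<b} \<alpha> f (u \<alpha>)"
    "sobolev_norm_sq {a<..<b} t f = tuple_norm_sq {a<..<b} t u"
    using sobolev_norm_sq_finiteE by blast
  have "l2_norm_sq {a<..<b} f = l2_norm_sq {a<..<b} (u 0)"
    by (intro l2_norm_sq_cong_AE is_weak_deriv_0_AE u(1)) simp
  then show ?thesis using l2_norm_sq_le_tuple[of 0 t "{a<..<b}" u] u(2) by simp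
qed (metis infinity_ennreal_def order.order_iff_strict top.not_eq_extremum top_greatest)

section \<open>Completeness\<close>

text \<open>AM--GM with a free weight. It takes the place of the Cauchy--Schwarz inequality:
  integrated over a set of finite measure it turns an L2 bound into an L1 bound, and s is chosen
  afterwards to balance the two terms.\<close>

lemma abs_le_weighted_square:
  fixes d s :: real
  assumes "s > 0"
  shows "\<bar>d\<bar> \<le> s * d\<^sup>2 + 1 / s"
proof -
  have "0 \<le> (s * \<bar>d\<bar> - 1)\<^sup>2 / s" using assms by simp
  also have "\<dots> = s * d\<^sup>2 + 1 / s - 2 * \<bar>d\<bar>"
    using assms by (simp add: power2_diff power_mult_distrib field_simps power2_eq_square)
  finally have "2 * \<bar>d\<bar> \<le> s * d\<^sup>2 + 1 / s" by simp
  then show ?thesis by linarith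
qed

text \<open>The squared increments, weighted by 2^n, have a finite total integral because 2^n
  (1/4)^n = (1/2)^n; so their sum is finite almost everywhere. There the weighted square inequality
  bounds the increments by a summable sequence.\<close>

lemma AE_convergent_of_l2_fast_Cauchy:
  assumes [measurable]: "\<Omega> \<in> sets borel" "\<And>n. u n \<in> borel_measurable borel"
    and cauchy: "\<And>n. l2_norm_sq \<Omega> (\<lambda>x. u (Suc n) x - u n x) \<le> ennreal ((1/4) ^ n)"
  shows "AE x in lborel. x \<in> \<Omega> \<longrightarrow> convergent (\<lambda>n. u n x)"
proof -
  let ?d = "\<lambda>n x. u (Suc n) x - u n x"
  let ?S = "\<lambda>x. \<Sum>n. ennreal (2 ^ n * (?d n x)\<^sup>2) * indicator \<Omega> x"
  have "(\<integral>\<^sup>+x. ?S x \<partial>lborel) = (\<Sum>n. \<integral>\<^sup>+x. ennreal (2 ^ n * (?d n x)\<^sup>2) * indicator \<Omega> x \<partial>lborel)"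
    by (intro nn_integral_suminf) auto
  also have "\<dots> = (\<Sum>n. ennreal (2 ^ n) * l2_norm_sq \<Omega> (?d n))"
    unfolding l2_norm_sq_def by (simp add: ennreal_mult mult.assoc nn_integral_cmult)
  also have "\<dots> \<le> (\<Sum>n. ennreal ((1/2) ^ n))"
  proof (intro suminf_le summableI)
    fix n
    have "ennreal (2 ^ n) * l2_norm_sq \<Omega> (?d n) \<le> ennreal (2 ^ n) * ennreal ((1/4) ^ n)"
      by (intro mult_left_mono cauchy) auto
    also have "\<dots> = ennreal ((1/2) ^ n)" by (simp flip: ennreal_mult power_mult_distrib)
    finally show "ennreal (2 ^ n) * l2_norm_sq \<Omega> (?d n) \<le> ennreal ((1/2) ^ n)" .
  qed
  also have "\<dots> < \<infinity>"
  proof -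
    have "(\<Sum>n. ennreal ((1/2) ^ n)) = ennreal (\<Sum>n. (1/2) ^ n)"
      by (rule suminf_ennreal2[OF _ summable_geometric]) auto
    then show ?thesis by simp
  qed
  finally have "AE x in lborel. ?S x \<noteq> \<infinity>"
    by (intro nn_integral_PInf_AE) auto
  then show ?thesis
  proof eventually_elim
    case (elim x)
    show ?case
    proof
      assume "x \<in> \<Omega>"
      then have "(\<Sum>n. ennreal (2 ^ n * (?d n x)\<^sup>2)) \<noteq> \<top>" using elim by simp
      then have s: "summable (\<lambda>n. 2 ^ n * (?d n x)\<^sup>2)" by (intro summable_suminf_not_top) auto
      have "summable (\<lambda>n. ?d n x)"
      proof (rule summable_comparison_test')
        show "summable (\<lambda>n. 2 ^ n * (?d n x)\<^sup>2 + (1/2) ^ n)"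
          by (intro summable_add s summable_geometric) simp
        fix n
        have "\<bar>?d n x\<bar> \<le> 2 ^ n * (?d n x)\<^sup>2 + (1/2) ^ n"
          using abs_le_weighted_square[of "2 ^ n" "?d n x"] by (simp add: power_divide)
        then show "norm (?d n x) \<le> 2 ^ n * (?d n x)\<^sup>2 + (1/2) ^ n" by simp
      qed
      then have "convergent (\<lambda>n. u n x - u 0 x)"
        using sum_lessThan_telescope[of "\<lambda>n. u n x"] by (simp add: summable_iff_convergent)
      then have "convergent (\<lambda>n. (u n x - u 0 x) + u 0 x)" by (intro convergent_add convergent_const)
      then show "convergent (\<lambda>n. u n x)" by simp
    qed
  qed
qed

text \<open>With weight 2^n the weighted square inequality bounds the L1 distance of u n and U by a
  multiple of (1/2)^n; here the finite length of the interval enters. A bounded factor \<phi>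
  preserves this rate.\<close>

lemma set_integral_tendsto_of_l2:
  fixes a b :: real
  assumes [measurable]: "U \<in> borel_measurable borel" "\<And>n. u n \<in> borel_measurable borel" "\<phi> \<in> borel_measurable borel"
    and B: "\<And>x. \<bar>\<phi> x\<bar> \<le> B" and int: "\<And>n. set_integrable lborel {a<..<b} (\<lambda>x. u n x * \<phi> x)"
    and l2: "\<And>n. l2_norm_sq {a<..<b} (\<lambda>x. U x - u n x) \<le> ennreal ((1/4) ^ n)"
  shows "(\<lambda>n. LINT x:{a<..<b}|lborel. u n x * \<phi> x) \<longlonglongrightarrow> (LINT x:{a<..<b}|lborel. U x * \<phi> x)"
proof -
  let ?I = "{a<..<b}" and ?len = "measure lborel {a<..<b}"
  let ?D = "\<lambda>n. LINT x:?I|lborel. (U x - u n x) * \<phi> x"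
  have le: "\<bar>d\<bar> \<le> 2 ^ n * d\<^sup>2 + (1/2) ^ n" for n and d :: real
    using abs_le_weighted_square[of "2 ^ n" d] by (simp add: power_divide)
  have B0: "B \<ge> 0" using B[of 0] by linarith
  have bnd: "(\<integral>\<^sup>+x. ennreal (norm (indicator ?I x *\<^sub>R ((U x - u n x) * \<phi> x))) \<partial>lborel) \<le> ennreal (B * (1 + ?len) * (1/2) ^ n)" for n
  proof -
    have "(\<integral>\<^sup>+x. ennreal (norm (indicator ?I x *\<^sub>R ((U x - u n x) * \<phi> x))) \<partial>lborel) \<le>
        (\<integral>\<^sup>+x. ennreal B * (ennreal (2 ^ n) * (ennreal ((U x - u n x)\<^sup>2) * indicator ?I x) + ennreal ((1/2) ^ n) * indicator ?I x) \<partial>lborel)"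
    proof (rule nn_integral_mono)
      fix x
      have "\<bar>(U x - u n x) * \<phi> x\<bar> \<le> B * (2 ^ n * (U x - u n x)\<^sup>2 + (1/2) ^ n)"
      proof -
        have "\<bar>(U x - u n x) * \<phi> x\<bar> \<le> \<bar>U x - u n x\<bar> * B"
          unfolding abs_mult by (intro mult_left_mono B) auto
        also have "\<dots> \<le> (2 ^ n * (U x - u n x)\<^sup>2 + (1/2) ^ n) * B"
          using le[of "U x - u n x" n] B0 by (intro mult_right_mono) auto
        finally show ?thesis by (simp add: mult.commute)
      qed
      then have "ennreal \<bar>(U x - u n x) * \<phi> x\<bar> \<le> ennreal B * (ennreal (2 ^ n) * ennreal ((U x - u n x)\<^sup>2) + ennreal ((1/2) ^ n))"
        using B0 by (simp add: ennreal_leI flip: ennreal_mult ennreal_plus)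
      then show "ennreal (norm (indicator ?I x *\<^sub>R ((U x - u n x) * \<phi> x))) \<le>
          ennreal B * (ennreal (2 ^ n) * (ennreal ((U x - u n x)\<^sup>2) * indicator ?I x) + ennreal ((1/2) ^ n) * indicator ?I x)"
        by (auto simp: indicator_def)
    qed
    also have "\<dots> = ennreal B * (ennreal (2 ^ n) * l2_norm_sq ?I (\<lambda>x. U x - u n x) + ennreal ((1/2) ^ n) * emeasure lborel ?I)"
      unfolding l2_norm_sq_def by (simp add: nn_integral_cmult nn_integral_add)
    also have "\<dots> \<le> ennreal B * (ennreal (2 ^ n) * ennreal ((1/4) ^ n) + ennreal ((1/2) ^ n) * ennreal ?len)"
      by (intro mult_left_mono add_mono l2) (use emeasure_bounded_finite[of ?I] in \<open>auto simp: emeasure_eq_ennreal_measure\<close>)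
    also have "\<dots> = ennreal (B * (1 + ?len) * (1/2) ^ n)"
      using B0 by (simp flip: ennreal_mult ennreal_plus power_mult_distrib) (simp add: algebra_simps)
    finally show ?thesis .
  qed
  have intD: "set_integrable lborel ?I (\<lambda>x. (U x - u n x) * \<phi> x)" for n
    unfolding set_integrable_def integrable_iff_bounded
    using le_less_trans[OF bnd[of n]] by auto
  have D: "(LINT x:?I|lborel. U x * \<phi> x) - (LINT x:?I|lborel. u n x * \<phi> x) = ?D n" for n
  proof -
    have "(LINT x:?I|lborel. U x * \<phi> x) = (LINT x:?I|lborel. (U x - u n x) * \<phi> x + u n x * \<phi> x)"
      by (simp add: algebra_simps)
    also have "\<dots> = ?D n + (LINT x:?I|lborel. u n x * \<phi> x)"
      by (intro set_integral_add intD int)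
    finally show ?thesis by simp
  qed
  have "norm (?D n) \<le> B * (1 + ?len) * (1/2) ^ n" for n
  proof -
    have "ennreal (norm (?D n)) \<le> ennreal (B * (1 + ?len) * (1/2) ^ n)"
      using integral_norm_bound_ennreal[OF intD[of n, unfolded set_integrable_def]] bnd[of n]
      unfolding set_lebesgue_integral_def by (rule order_trans)
    then show ?thesis using B0 by (subst (asm) ennreal_le_iff) auto
  qed
  moreover have "(\<lambda>n. B * (1 + ?len) * (1/2) ^ n) \<longlonglongrightarrow> 0"
    by (intro tendsto_mult_right_zero LIMSEQ_realpow_zero) auto
  ultimately have "?D \<longlonglongrightarrow> 0" by (intro Lim_null_comparison[of ?D]) auto
  then have "(\<lambda>n. (LINT x:?I|lborel. U x * \<phi> x) - ?D n) \<longlonglongrightarrow> (LINT x:?I|lborel. U x * \<phi> x) - 0"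
    by (intro tendsto_diff tendsto_const)
  then show ?thesis by (simp flip: D)
qed

lemma locally_integrable_of_l2:
  fixes a b :: real
  assumes [measurable]: "U \<in> borel_measurable borel" and l2: "l2_norm_sq {a<..<b} U < \<infinity>"
  shows "locally_integrable_on {a<..<b} U"
  unfolding locally_integrable_on_def
proof (intro allI impI)
  fix K assume K: "compact K \<and> K \<subseteq> {a<..<b}"
  let ?I = "{a<..<b}"
  have "set_integrable lborel ?I U"
    unfolding set_integrable_def integrable_iff_bounded
  proof
    have "(\<integral>\<^sup>+x. ennreal (norm (indicator ?I x *\<^sub>R U x)) \<partial>lborel) \<le> (\<integral>\<^sup>+x. ennreal ((U x)\<^sup>2) * indicator ?I x + indicator ?I x \<partial>lborel)"
    proof (rule nn_integral_mono)
      fix x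
      have "0 \<le> (\<bar>U x\<bar> - 1)\<^sup>2" by simp
      then have "\<bar>U x\<bar> \<le> (U x)\<^sup>2 + 1" by (simp add: power2_eq_square algebra_simps)
      then have "ennreal \<bar>U x\<bar> \<le> ennreal ((U x)\<^sup>2) + 1"
        by (simp add: ennreal_leI flip: ennreal_plus ennreal_1)
      then show "ennreal (norm (indicator ?I x *\<^sub>R U x)) \<le> ennreal ((U x)\<^sup>2) * indicator ?I x + indicator ?I x"
        by (auto simp: indicator_def)
    qed
    also have "\<dots> = l2_norm_sq ?I U + emeasure lborel ?I"
      unfolding l2_norm_sq_def by (simp add: nn_integral_add)
    also have "\<dots> < \<infinity>" using l2 emeasure_bounded_finite[of ?I] by simp
    finally show "(\<integral>\<^sup>+x. ennreal (norm (indicator ?I x *\<^sub>R U x)) \<partial>lborel) < \<infinity>" .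
  qed auto
  then show "set_integrable lborel K U"
    by (rule set_integrable_subset) (use K in \<open>auto intro: borel_compact\<close>)
qed

text \<open>Each order of derivative converges almost everywhere along the fast Cauchy sequence,
  Fatou's lemma carries the Cauchy bound over to the limit, and the defining identity of a weak
  derivative passes to the limit by L2 convergence. The pointwise limit g is given in advance and
  identified with the limit of order 0.\<close>

lemma sobolev_complete:
  assumes fin: "\<And>n. sobolev_norm_sq {a<..<b} t (h n) < \<infinity>"
    and cauchy: "\<And>n k. n \<le> k \<Longrightarrow> sobolev_norm_sq {a<..<b} t (\<lambda>x. h k x - h n x) \<le> ennreal ((1/4) ^ n)"
    and lim: "\<And>x. x \<in> {a<..<b} \<Longrightarrow> (\<lambda>n. h n x) \<longlonglongrightarrow> g x"
    and cont: "continuous_on {a<..<b} g"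
  shows "sobolev_norm_sq {a<..<b} t (\<lambda>x. g x - h n x) \<le> ennreal ((1/4) ^ n)"
    and "sobolev_norm_sq {a<..<b} t g < \<infinity>"
proof -
  let ?I = "{a<..<b}" and ?m = "nat \<lfloor>t\<rfloor>"
  have "\<exists>u. (\<forall>\<alpha>\<le>?m. is_weak_deriv ?I \<alpha> (h n) (u \<alpha>)) \<and> (\<forall>\<alpha>. u \<alpha> \<in> borel_measurable borel)" for n
    using sobolev_norm_sq_finiteE[OF fin[of n]] by metis
  then obtain u where u: "\<And>n \<alpha>. \<alpha> \<le> ?m \<Longrightarrow> is_weak_deriv ?I \<alpha> (h n) (u n \<alpha>)"
    and [measurable]: "\<And>n \<alpha>. u n \<alpha> \<in> borel_measurable borel" by metis
  have diff: "sobolev_norm_sq ?I t (\<lambda>x. f x - h n x) = tuple_norm_sq ?I t (\<lambda>\<alpha> x. v \<alpha> x - u n \<alpha> x)"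
    if "\<And>\<alpha>. \<alpha> \<le> ?m \<Longrightarrow> is_weak_deriv ?I \<alpha> f (v \<alpha>)" for f v n
    using is_weak_deriv_lincomb[OF that u[of _ n], of _ 1 "-1"]
    by (intro sobolev_norm_sq_eq_tuple) simp
  have cau: "tuple_norm_sq ?I t (\<lambda>\<alpha> x. u k \<alpha> x - u n \<alpha> x) \<le> ennreal ((1/4) ^ n)" if "n \<le> k" for n k
    using cauchy[OF that] diff[of "h k" "u k" n] u by simp
  \<comment> \<open>\<open>lim\<close> produces a function that is Borel on the whole line; for the
    relevant orders the sequence diverges at most on a null subset of the interval.\<close>
  define U where "U = (\<lambda>\<alpha> x. lim (\<lambda>n. u n \<alpha> x))"
  have U_meas [measurable]: "U \<alpha> \<in> borel_measurable borel" for \<alpha>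
    unfolding U_def by measurable
  have conv: "AE x in lborel. x \<in> ?I \<longrightarrow> (\<lambda>n. u n \<alpha> x) \<longlonglongrightarrow> U \<alpha> x" if "\<alpha> \<le> ?m" for \<alpha>
  proof -
    have "l2_norm_sq ?I (\<lambda>x. u (Suc n) \<alpha> x - u n \<alpha> x) \<le> ennreal ((1/4) ^ n)" for n
      using l2_norm_sq_le_tuple[OF that, of ?I "\<lambda>\<alpha> x. u (Suc n) \<alpha> x - u n \<alpha> x"] cau[of n "Suc n"] by simp
    then have "AE x in lborel. x \<in> ?I \<longrightarrow> convergent (\<lambda>n. u n \<alpha> x)"
      by (intro AE_convergent_of_l2_fast_Cauchy) auto
    then show ?thesis
      by eventually_elim (simp add: U_def convergent_LIMSEQ_iff)
  qed
  have Un: "tuple_norm_sq ?I t (\<lambda>\<alpha> x. U \<alpha> x - u n \<alpha> x) \<le> ennreal ((1/4) ^ n)" for n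
  proof -
    have "tuple_norm_sq ?I t (\<lambda>\<alpha> x. U \<alpha> x - u n \<alpha> x) \<le> liminf (\<lambda>k. tuple_norm_sq ?I t (\<lambda>\<alpha> x. u k \<alpha> x - u n \<alpha> x))"
    proof (rule tuple_norm_sq_Fatou)
      show "AE x in lborel. x \<in> ?I \<longrightarrow> (\<lambda>k. u k \<alpha> x - u n \<alpha> x) \<longlonglongrightarrow> U \<alpha> x - u n \<alpha> x" if "\<alpha> \<le> ?m" for \<alpha>
        using conv[OF that] by eventually_elim (auto intro!: tendsto_intros)
    qed auto
    also have "\<dots> \<le> ennreal ((1/4) ^ n)"
      by (rule Liminf_le[OF trivial_limit_sequentially]) (auto intro: eventually_mono[OF eventually_ge_at_top[of n]] cau)
    finally show ?thesis .
  qed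
  have l2U: "l2_norm_sq ?I (\<lambda>x. U \<alpha> x - u n \<alpha> x) \<le> ennreal ((1/4) ^ n)" if "\<alpha> \<le> ?m" for \<alpha> n
    using l2_norm_sq_le_tuple[OF that, of ?I "\<lambda>\<alpha> x. U \<alpha> x - u n \<alpha> x"] Un[of n] by simp
  have g0: "AE x in lborel. x \<in> ?I \<longrightarrow> g x = U 0 x"
  proof -
    have "AE x in lborel. \<forall>n. x \<in> ?I \<longrightarrow> h n x = u n 0 x"
      unfolding AE_all_countable using is_weak_deriv_0_AE u by auto
    then show ?thesis using conv[of 0, simplified]
    proof eventually_elim
      case (elim x)
      show ?case
      proof
        assume x: "x \<in> ?I"
        then have "h n x = u n 0 x" for n using elim(1) by blast
        then show "g x = U 0 x" using lim[OF x] elim(2) x LIMSEQ_unique by auto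
      qed
    qed
  qed
  have locU: "locally_integrable_on ?I (U \<alpha>)" if "\<alpha> \<le> ?m" for \<alpha>
  proof -
    \<comment> \<open>The first summand is square-integrable by the bound for n = 0, the second is
      locally integrable because it is a weak derivative.\<close>
    have "locally_integrable_on ?I (\<lambda>x. 1 * (U \<alpha> x - u 0 \<alpha> x) + 1 * u 0 \<alpha> x)"
    proof (rule locally_integrable_lincomb)
      show "locally_integrable_on ?I (\<lambda>x. U \<alpha> x - u 0 \<alpha> x)"
        using le_less_trans[OF l2U[OF that, of 0]] by (intro locally_integrable_of_l2) auto
      show "locally_integrable_on ?I (u 0 \<alpha>)"
        using u[OF that, of 0] unfolding is_weak_deriv_def by blast
    qed
    then show ?thesis by simp
  qed
  have W: "is_weak_deriv ?I \<alpha> (U 0) (U \<alpha>)" if \<alpha>: "\<alpha> \<le> ?m" for \<alpha>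
  proof -
    have "(LINT x:?I|lborel. U 0 x * (deriv ^^ \<alpha>) \<phi> x) = (-1) ^ \<alpha> * (LINT x:?I|lborel. U \<alpha> x * \<phi> x)"
      if \<phi>: "\<phi> \<in> test_functions ?I" for \<phi>
    proof (rule LIMSEQ_unique)
      have tend: "(\<lambda>n. LINT x:?I|lborel. u n \<beta> x * \<psi> x) \<longlonglongrightarrow> (LINT x:?I|lborel. U \<beta> x * \<psi> x)"
        if \<psi>: "\<psi> \<in> test_functions ?I" and \<beta>: "\<beta> \<le> ?m" for \<psi> \<beta>
      proof -
        obtain B where B: "\<And>x. \<bar>\<psi> x\<bar> \<le> B" using test_function_bounded[OF \<psi>] by blast
        have "\<psi> \<in> borel_measurable borel" by (rule smooth_measurable[OF test_function_smooth[OF \<psi>]])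
        moreover have "set_integrable lborel ?I (\<lambda>x. u n \<beta> x * \<psi> x)" for n
          using u[OF \<beta>, of n] \<psi> unfolding is_weak_deriv_def
          by (intro set_integrable_locally_integrable_test_function) auto
        ultimately show ?thesis
          by (intro set_integral_tendsto_of_l2[OF _ _ _ B _ l2U[OF \<beta>]]) auto
      qed
      show "(\<lambda>n. LINT x:?I|lborel. u n 0 x * (deriv ^^ \<alpha>) \<phi> x) \<longlonglongrightarrow> (LINT x:?I|lborel. U 0 x * (deriv ^^ \<alpha>) \<phi> x)"
        by (intro tend test_function_higher_deriv \<phi>) simp
      have eq: "(LINT x:?I|lborel. u n 0 x * (deriv ^^ \<alpha>) \<phi> x) = (-1) ^ \<alpha> * (LINT x:?I|lborel. u n \<alpha> x * \<phi> x)" for n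
      proof -
        have "(LINT x:?I|lborel. u n 0 x * (deriv ^^ \<alpha>) \<phi> x) = (LINT x:?I|lborel. h n x * (deriv ^^ \<alpha>) \<phi> x)"
          using u[of 0 n] test_function_higher_deriv[OF \<phi>, of \<alpha>] unfolding is_weak_deriv_def by simp
        also have "\<dots> = (-1) ^ \<alpha> * (LINT x:?I|lborel. u n \<alpha> x * \<phi> x)"
          using u[OF \<alpha>, of n] \<phi> unfolding is_weak_deriv_def by blast
        finally show ?thesis .
      qed
      show "(\<lambda>n. LINT x:?I|lborel. u n 0 x * (deriv ^^ \<alpha>) \<phi> x) \<longlonglongrightarrow> (-1) ^ \<alpha> * (LINT x:?I|lborel. U \<alpha> x * \<phi> x)"
        unfolding eq by (intro tendsto_intros tend \<phi> \<alpha>)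
    qed
    then show ?thesis using locU[OF \<alpha>] locU[of 0] unfolding is_weak_deriv_def by simp
  qed
  have Wg: "is_weak_deriv ?I \<alpha> g (U \<alpha>)" if "\<alpha> \<le> ?m" for \<alpha>
  proof -
    have lg: "locally_integrable_on ?I g" by (rule locally_integrable_continuous[OF cont])
    have "(LINT x:?I|lborel. g x * \<psi> x) = (LINT x:?I|lborel. U 0 x * \<psi> x)" if "\<psi> \<in> test_functions ?I" for \<psi>
      unfolding set_lebesgue_integral_def
    proof (rule integral_cong_AE)
      have [measurable]: "\<psi> \<in> borel_measurable borel"
        by (rule smooth_measurable[OF test_function_smooth[OF that]])
      note [measurable] = locally_integrable_measurable[OF lg]
      have "(\<lambda>x. (indicator ?I x * g x) * \<psi> x) \<in> borel_measurable lborel" by measurable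
      then show "(\<lambda>x. indicator ?I x *\<^sub>R (g x * \<psi> x)) \<in> borel_measurable lborel" by (simp add: mult.assoc)
      show "AE x in lborel. indicator ?I x *\<^sub>R (g x * \<psi> x) = indicator ?I x *\<^sub>R (U 0 x * \<psi> x)"
        using g0 by eventually_elim (auto simp: indicator_def)
      show "(\<lambda>x. indicator ?I x *\<^sub>R (U 0 x * \<psi> x)) \<in> borel_measurable lborel" by measurable
    qed
    then show ?thesis
      using W[OF that] lg unfolding is_weak_deriv_def by (auto simp: test_function_higher_deriv)
  qed
  show le: "sobolev_norm_sq ?I t (\<lambda>x. g x - h n x) \<le> ennreal ((1/4) ^ n)" for n
    using diff[OF Wg] Un[of n] by simp
  have "sobolev_norm_sq ?I t (\<lambda>x. 1 * (g x - h 0 x) + 1 * h 0 x) \<le>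
      ennreal 2 * sobolev_norm_sq ?I t (\<lambda>x. g x - h 0 x) + ennreal 2 * sobolev_norm_sq ?I t (h 0)"
    by (rule sobolev_norm_sq_lincomb_le[OF le_less_trans[OF le] fin]) (use sum_squares_bound in \<open>auto simp: power2_sum add.commute\<close>)
  also have "\<dots> < \<infinity>" using fin[of 0] le_less_trans[OF le[of 0]] by (simp add: ennreal_mult_less_top)
  finally show "sobolev_norm_sq ?I t g < \<infinity>" by simp
qed

section \<open>Embedding into Hoelder spaces\<close>

text \<open>\<eta> is a smooth probability density on [p, q] and H its distribution function, a
  smooth step from 0 to 1. Both are kept: \<eta> localises integrals near a point, and the
  difference of two such H is a smooth plateau with known derivative.\<close>

definition mollifier :: "real \<Rightarrow> real \<Rightarrow> (real \<Rightarrow> real) \<Rightarrow> (real \<Rightarrow> real) \<Rightarrow> bool" where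
  "mollifier p q H \<eta> \<longleftrightarrow> smooth \<eta> \<and> (\<forall>s. (H has_real_derivative \<eta> s) (at s)) \<and>
     (\<forall>s. 0 \<le> \<eta> s) \<and> (\<forall>s. s \<notin> {p..q} \<longrightarrow> \<eta> s = 0) \<and>
     (\<forall>s\<le>p. H s = 0) \<and> (\<forall>s\<ge>q. H s = 1) \<and> (\<forall>s. 0 \<le> H s) \<and> (\<forall>s. H s \<le> 1)"

lemma mollifierD:
  assumes "mollifier p q H \<eta>"
  shows "smooth \<eta>" "(H has_real_derivative \<eta> s) (at s)" "0 \<le> \<eta> s" "s \<notin> {p..q} \<Longrightarrow> \<eta> s = 0"
    "s \<le> p \<Longrightarrow> H s = 0" "s \<ge> q \<Longrightarrow> H s = 1" "0 \<le> H s" "H s \<le> 1"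
  using assms unfolding mollifier_def by blast+

lemma mollifier_exists:
  fixes p q :: real
  assumes pq: "p < q"
  obtains H \<eta> where "mollifier p q H \<eta>"
proof -
  let ?\<beta> = "bump p q 1"
  have sm: "smooth ?\<beta>" by (rule smooth_bump) simp
  \<comment> \<open>The oriented integral makes G an antiderivative on the whole line, also to the
    left of p.\<close>
  define G where "G = (\<lambda>s::real. LBINT u=ereal p..ereal s. ?\<beta> u)"
  have G: "(G has_real_derivative ?\<beta> s) (at s)" for s
  proof -
    let ?l = "min p s - 1" and ?r = "max p s + 1"
    have "(G has_vector_derivative ?\<beta> s) (at s within {?l..?r})"
      unfolding G_def
      by (rule interval_integral_FTC2) (auto intro: smooth_continuous sm)
    then have "(G has_vector_derivative ?\<beta> s) (at s)"
      by (subst (asm) at_within_interior) (auto simp: interior_atLeastAtMost_real)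
    then show ?thesis by (simp add: has_real_derivative_iff_has_vector_derivative)
  qed
  have mono: "G s \<le> G s'" if "s \<le> s'" for s s'
    by (rule DERIV_nonneg_imp_nondecreasing[OF that]) (use G bump_nonneg in blast)
  have const: "G s = G s'" if "\<And>u. u \<in> {min s s'<..<max s s'} \<Longrightarrow> ?\<beta> u = 0" "s < s'" for s s'
  proof (rule DERIV_isconst_end[symmetric, OF \<open>s < s'\<close>])
    show "continuous_on {s..s'} G"
      by (rule DERIV_continuous_on[OF has_field_derivative_at_within[OF G]])
    show "DERIV G u :> 0" if "s < u" "u < s'" for u
      using G[of u] \<open>\<And>u. u \<in> {min s s'<..<max s s'} \<Longrightarrow> ?\<beta> u = 0\<close>[of u] that by simp
  qed
  have Gp: "G p = 0" by (simp add: G_def)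
  have left: "G s = 0" if "s \<le> p" for s
    using const[of s p] that Gp bump_outside[of _ p q 1] by (cases "s = p") auto
  have right: "G s = G q" if "s \<ge> q" for s
    using const[of q s] that bump_outside[of _ p q 1] by (cases "s = q") auto
  have "G p < G q"
  proof (rule DERIV_pos_imp_increasing_open[OF pq])
    show "\<exists>y. DERIV G x :> y \<and> 0 < y" if "p < x" "x < q" for x
      using G[of x] bump_pos[OF that] by blast
    show "continuous_on {p..q} G"
      by (rule DERIV_continuous_on[OF has_field_derivative_at_within[OF G]])
  qed
  then have Z: "G q > 0" using Gp by simp
  show ?thesis
  proof (rule that[of "\<lambda>s. G s * inverse (G q)" "\<lambda>s. ?\<beta> s * inverse (G q)"], unfold mollifier_def, intro conjI allI impI)
    show "smooth (\<lambda>s. ?\<beta> s * inverse (G q))" by (intro smooth_mult smooth_const sm)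
    show "((\<lambda>s. G s * inverse (G q)) has_real_derivative ?\<beta> s * inverse (G q)) (at s)" for s
      by (intro DERIV_cmult_right G)
    show "0 \<le> ?\<beta> s * inverse (G q)" for s using Z bump_nonneg[of p q 1 s] by simp
    show "?\<beta> s * inverse (G q) = 0" if "s \<notin> {p..q}" for s using that bump_outside[of s p q 1] by auto
    show "G s * inverse (G q) = 0" if "s \<le> p" for s using left[OF that] by simp
    show "G s * inverse (G q) = 1" if "s \<ge> q" for s using right[OF that] Z by simp
    show "0 \<le> G s * inverse (G q)" for s using mono[of p s] left[of s] Gp Z by (cases "s \<le> p") auto
    show "G s * inverse (G q) \<le> 1" for s using mono[of s q] right[of s] Z by (cases "s \<le> q") (auto simp: field_simps)
  qed
qed

lemma integral_mollifier:
  fixes p q :: real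
  assumes pq: "p < q" "{p..q} \<subseteq> \<Omega>" and sm: "smooth \<eta>" and H: "\<And>s. (H has_real_derivative \<eta> s) (at s)"
    and out: "\<And>s. s \<notin> {p..q} \<Longrightarrow> \<eta> s = 0" and ends: "H p = 0" "H q = 1"
  shows "(LINT s:\<Omega>|lborel. \<eta> s) = 1"
proof -
  have "integral\<^sup>L lborel (\<lambda>x. indicator {p..q} x *\<^sub>R \<eta> x) = H q - H p"
  proof (rule integral_FTC_Icc)
    show "continuous_on {p..q} \<eta>" by (rule smooth_continuous[OF sm])
    show "(H has_vector_derivative \<eta> x) (at x within {p..q})" for x
      using H[of x] by (simp add: has_field_derivative_at_within has_real_derivative_iff_has_vector_derivative
          has_vector_derivative_at_within)
  qed (use pq in simp)
  also have "integral\<^sup>L lborel (\<lambda>x. indicator {p..q} x *\<^sub>R \<eta> x) = (LINT s:\<Omega>|lborel. \<eta> s)"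
    unfolding set_lebesgue_integral_def
    using pq(2) out by (intro Bochner_Integration.integral_cong) (auto simp: indicator_def)
  finally show ?thesis using ends by simp
qed

lemma mollification_near:
  fixes p q :: real
  assumes f: "locally_integrable_on {a<..<b} f" and pq: "p < q" "{p..q} \<subseteq> {a<..<b}"
    and sm: "smooth \<eta>" and nn: "\<And>s. 0 \<le> \<eta> s" and out: "\<And>s. s \<notin> {p..q} \<Longrightarrow> \<eta> s = 0"
    and one: "(LINT s:{a<..<b}|lborel. \<eta> s) = 1"
    and near: "\<And>s. s \<in> {p..q} \<Longrightarrow> \<bar>f s - k\<bar> \<le> \<delta>"
  shows "\<bar>(LINT s:{a<..<b}|lborel. f s * \<eta> s) - k\<bar> \<le> \<delta>"
proof -
  let ?I = "{a<..<b}"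
  have \<eta>: "\<eta> \<in> test_functions ?I" by (rule test_functionsI[OF sm out pq(2)])
  have i1: "set_integrable lborel ?I (\<lambda>s. f s * \<eta> s)"
    by (rule set_integrable_locally_integrable_test_function[OF f \<eta>])
  have i2: "set_integrable lborel ?I (\<lambda>s. c * \<eta> s)" for c
    by (rule set_integrable_locally_integrable_test_function[OF locally_integrable_continuous \<eta>]) simp
  have c: "(LINT s:?I|lborel. c * \<eta> s) = c" for c using one by simp
  have le: "f s * \<eta> s \<le> (k + \<delta>) * \<eta> s" "(k - \<delta>) * \<eta> s \<le> f s * \<eta> s" for s
    using near[of s] out[of s] nn[of s] by (cases "s \<in> {p..q}"; auto intro!: mult_right_mono)+
  have "(LINT s:?I|lborel. f s * \<eta> s) \<le> (LINT s:?I|lborel. (k + \<delta>) * \<eta> s)"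
    by (rule set_integral_mono[OF i1 i2]) (rule le)
  moreover have "(LINT s:?I|lborel. (k - \<delta>) * \<eta> s) \<le> (LINT s:?I|lborel. f s * \<eta> s)"
    by (rule set_integral_mono[OF i2 i1]) (rule le)
  ultimately show ?thesis unfolding c by linarith
qed

text \<open>The weak derivative is tested with \<phi> = H1 - H2, where H1 steps up near x and H2
  near y. As \<phi>' = \<eta>1 - \<eta>2, one side of the identity is f x - f y up to \<delta>, by
  continuity of f. The other side is the integral of g \<phi> with \<bar>\<phi>\<bar> \<le> 1 on a
  support of length at most 2 (y - x), which the L2 bound controls.\<close>

lemma holder_of_weak_deriv:
  assumes w: "is_weak_deriv {a<..<b} 1 f g" and cont: "continuous_on {a<..<b} f"
    and [measurable]: "g \<in> borel_measurable borel" and l2: "l2_norm_sq {a<..<b} g \<le> ennreal (c\<^sup>2)" and c: "c > 0"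
    and xy: "a < x" "x < y" "y < b"
  shows "\<bar>f x - f y\<bar> \<le> 4 * c * sqrt (y - x)"
proof (rule field_le_epsilon)
  fix \<delta> :: real assume \<delta>: "\<delta> > 0"
  let ?I = "{a<..<b}"
  have near: "\<exists>e>0. \<forall>s. \<bar>s - z\<bar> \<le> e \<longrightarrow> \<bar>f s - f z\<bar> \<le> \<delta> / 2" if "z \<in> ?I" for z
  proof -
    have "isCont f z" using cont that by (simp add: continuous_on_eq_continuous_at)
    then obtain e where e: "e > 0" "\<And>s. dist s z < e \<Longrightarrow> dist (f s) (f z) < \<delta> / 2"
      using \<delta> unfolding continuous_at_eps_delta dist_real_def by (metis half_gt_zero)
    have "\<bar>f s - f z\<bar> \<le> \<delta> / 2" if "\<bar>s - z\<bar> \<le> e / 2" for s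
      using e(2)[of s] that e(1) by (simp add: dist_real_def)
    then show ?thesis using e(1) by (intro exI[of _ "e/2"]) auto
  qed
  obtain e1 where e1: "e1 > 0" "\<And>s. \<bar>s - x\<bar> \<le> e1 \<Longrightarrow> \<bar>f s - f x\<bar> \<le> \<delta> / 2" using near[of x] xy by auto
  obtain e2 where e2: "e2 > 0" "\<And>s. \<bar>s - y\<bar> \<le> e2 \<Longrightarrow> \<bar>f s - f y\<bar> \<le> \<delta> / 2" using near[of y] xy by auto
  \<comment> \<open>The first two bounds come from continuity at x and y, the next two keep the
    supports inside the interval, and the last one bounds the length l + 2 e of the support of
    \<phi> by 2 l.\<close>
  define e where "e = Min {e1, e2, (x - a) / 2, (b - y) / 2, (y - x) / 2}"
  have e: "e > 0" "e \<le> e1" "e \<le> e2" "e \<le> (x - a) / 2" "e \<le> (b - y) / 2" "e \<le> (y - x) / 2"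
  proof -
    have "\<forall>w\<in>{e1, e2, (x - a) / 2, (b - y) / 2, (y - x) / 2}. e \<le> w"
      unfolding e_def by (intro ballI Min_le) auto
    then show "e \<le> e1" "e \<le> e2" "e \<le> (x - a) / 2" "e \<le> (b - y) / 2" "e \<le> (y - x) / 2" by blast+
    show "e > 0" using e1(1) e2(1) xy by (simp add: e_def)
  qed
  have lt: "x - e < x + e" using e(1) by simp
  obtain H1 \<eta>1 where "mollifier (x-e) (x+e) H1 \<eta>1" by (rule mollifier_exists[OF lt])
  note m1 = mollifierD[OF this]
  have lt: "y - e < y + e" using e(1) by simp
  obtain H2 \<eta>2 where "mollifier (y-e) (y+e) H2 \<eta>2" by (rule mollifier_exists[OF lt])
  note m2 = mollifierD[OF this]
  have sub1: "{x-e..x+e} \<subseteq> ?I" and sub2: "{y-e..y+e} \<subseteq> ?I" and sub: "{x-e..y+e} \<subseteq> ?I"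
    using e xy by auto
  have fl: "locally_integrable_on ?I f" by (rule locally_integrable_continuous[OF cont])
  have one1: "(LINT s:?I|lborel. \<eta>1 s) = 1"
    by (rule integral_mollifier[OF _ sub1 m1(1,2,4)]) (use e m1(5,6) in auto)
  have one2: "(LINT s:?I|lborel. \<eta>2 s) = 1"
    by (rule integral_mollifier[OF _ sub2 m2(1,2,4)]) (use e m2(5,6) in auto)
  have n1: "\<bar>(LINT s:?I|lborel. f s * \<eta>1 s) - f x\<bar> \<le> \<delta> / 2"
    by (rule mollification_near[OF fl _ sub1 m1(1,3,4) one1]) (use e in simp, assumption, rule e1(2), use e in auto)
  have n2: "\<bar>(LINT s:?I|lborel. f s * \<eta>2 s) - f y\<bar> \<le> \<delta> / 2"
    by (rule mollification_near[OF fl _ sub2 m2(1,3,4) one2]) (use e in simp, assumption, rule e2(2), use e in auto)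
  define \<phi> where "\<phi> = (\<lambda>s. H1 s - H2 s)"
  have d\<phi>: "(\<phi> has_real_derivative \<eta>1 s - \<eta>2 s) (at s)" for s
    unfolding \<phi>_def by (intro DERIV_diff m1 m2)
  have \<phi>out: "\<phi> s = 0" if s: "s \<notin> {x-e..y+e}" for s
  proof -
    consider "s < x - e" | "s > y + e" using s by force
    then show ?thesis
      by cases (use m1(5,6)[of s] m2(5,6)[of s] xy e in \<open>auto simp: \<phi>_def\<close>)
  qed
  have \<phi>1: "\<bar>\<phi> s\<bar> \<le> 1" for s using m1(7,8)[of s] m2(7,8)[of s] by (auto simp: \<phi>_def)
  have \<phi>: "\<phi> \<in> test_functions ?I"
    by (rule test_functionsI[OF smooth_antideriv[OF d\<phi> smooth_diff[OF m1(1) m2(1)]] \<phi>out sub])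
  have [measurable]: "\<phi> \<in> borel_measurable borel" by (rule smooth_measurable[OF test_function_smooth[OF \<phi>]])
  have \<eta>1: "\<eta>1 \<in> test_functions ?I" by (rule test_functionsI[OF m1(1,4) sub1])
  have \<eta>2: "\<eta>2 \<in> test_functions ?I" by (rule test_functionsI[OF m2(1,4) sub2])
  have "(LINT s:?I|lborel. f s * \<eta>1 s) - (LINT s:?I|lborel. f s * \<eta>2 s) = (LINT s:?I|lborel. f s * \<eta>1 s - f s * \<eta>2 s)"
    by (rule set_integral_diff(2)[symmetric]) (intro set_integrable_locally_integrable_test_function fl \<eta>1 \<eta>2)+
  also have "\<dots> = (LINT s:?I|lborel. f s * deriv \<phi> s)"
    by (simp add: DERIV_imp_deriv[OF d\<phi>] algebra_simps)
  also have "\<dots> = - (LINT s:?I|lborel. g s * \<phi> s)"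
    using w \<phi> unfolding is_weak_deriv_def by simp
  finally have main: "(LINT s:?I|lborel. f s * \<eta>1 s) - (LINT s:?I|lborel. f s * \<eta>2 s) = - (LINT s:?I|lborel. g s * \<phi> s)" .
  define l where "l = y - x"
  have l: "l > 0" using xy by (simp add: l_def)
  \<comment> \<open>This weight gives both terms of \<sigma> c^2 + 2 l / \<sigma> the order c sqrt
    l; their sum is 3 c sqrt l.\<close>
  define \<sigma> where "\<sigma> = sqrt l / c"
  have \<sigma>: "\<sigma> > 0" using l c by (simp add: \<sigma>_def)
  have gl: "set_integrable lborel ?I (\<lambda>s. g s * \<phi> s)"
    using w \<phi> unfolding is_weak_deriv_def by (intro set_integrable_locally_integrable_test_function) auto
  have "ennreal \<bar>LINT s:?I|lborel. g s * \<phi> s\<bar> \<le> (\<integral>\<^sup>+s. ennreal (norm (indicator ?I s *\<^sub>R (g s * \<phi> s))) \<partial>lborel)"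
    using integral_norm_bound_ennreal[OF gl[unfolded set_integrable_def]] unfolding set_lebesgue_integral_def by simp
  also have "\<dots> \<le> (\<integral>\<^sup>+s. ennreal \<sigma> * (ennreal ((g s)\<^sup>2) * indicator ?I s) + ennreal (1 / \<sigma>) * indicator {x-e..y+e} s \<partial>lborel)"
  proof (rule nn_integral_mono)
    fix s
    show "ennreal (norm (indicator ?I s *\<^sub>R (g s * \<phi> s))) \<le> ennreal \<sigma> * (ennreal ((g s)\<^sup>2) * indicator ?I s) + ennreal (1 / \<sigma>) * indicator {x-e..y+e} s"
    proof (cases "s \<in> {x-e..y+e}")
      case True
      have "\<bar>g s * \<phi> s\<bar> \<le> \<bar>g s\<bar>" unfolding abs_mult using \<phi>1[of s] by (simp add: mult_left_le)
      also have "\<dots> \<le> \<sigma> * (g s)\<^sup>2 + 1 / \<sigma>" by (rule abs_le_weighted_square[OF \<sigma>])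
      finally have "ennreal \<bar>g s * \<phi> s\<bar> \<le> ennreal \<sigma> * ennreal ((g s)\<^sup>2) + ennreal (1 / \<sigma>)"
        using \<sigma> by (simp add: ennreal_leI flip: ennreal_mult ennreal_plus)
      then show ?thesis using True sub by (auto simp: indicator_def)
    qed (simp add: \<phi>out)
  qed
  also have "\<dots> = ennreal \<sigma> * l2_norm_sq ?I g + ennreal (1 / \<sigma>) * ennreal (l + 2 * e)"
    unfolding l2_norm_sq_def using e xy by (simp add: nn_integral_add nn_integral_cmult l_def algebra_simps)
  also have "\<dots> \<le> ennreal \<sigma> * ennreal (c\<^sup>2) + ennreal (1 / \<sigma>) * ennreal (2 * l)"
    using e by (intro add_mono mult_left_mono l2 ennreal_leI) (auto simp: l_def)
  also have "\<dots> = ennreal (\<sigma> * c\<^sup>2 + 2 * l / \<sigma>)" using \<sigma> l by (simp flip: ennreal_mult ennreal_plus)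
  also have "\<sigma> * c\<^sup>2 + 2 * l / \<sigma> = 3 * c * sqrt l"
    using l c by (simp add: \<sigma>_def power2_eq_square field_simps)
  finally have "\<bar>LINT s:?I|lborel. g s * \<phi> s\<bar> \<le> 3 * c * sqrt l"
    using c l by (subst (asm) ennreal_le_iff) auto
  moreover have "3 * c * sqrt l \<le> 4 * c * sqrt l" using c l by simp
  ultimately show "\<bar>f x - f y\<bar> \<le> 4 * c * sqrt (y - x) + \<delta>"
    using n1 n2 main unfolding l_def by linarith
qed

section \<open>Interval averages and the Gagliardo seminorm\<close>

definition average :: "real \<Rightarrow> real \<Rightarrow> (real \<Rightarrow> real) \<Rightarrow> real" where
  "average p q f = (LINT x:{p..q}|lborel. f x) / (q - p)"

lemma set_integrable_continuous_Icc: "continuous_on {p..q} f \<Longrightarrow> set_integrable lborel {p..q} (f :: real \<Rightarrow> real)"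
  unfolding set_integrable_def by (rule borel_integrable_compact) auto

text \<open>Jensen's inequality for the square. With A the average, the tangent bound (f - k)^2
  \<ge> (A - k)^2 + 2 (A - k) (f - A) is integrated; the linear term has integral 0.\<close>

lemma average_minus_const_sq_le:
  fixes p q :: real
  assumes pq: "p < q" and f: "continuous_on {p..q} f"
  shows "ennreal ((average p q f - k)\<^sup>2) \<le> ennreal (1 / (q - p)) * (\<integral>\<^sup>+x\<in>{p..q}. ennreal ((f x - k)\<^sup>2) \<partial>lborel)"
proof -
  let ?A = "average p q f"
  note i = set_integrable_continuous_Icc
  have c: "(LINT x:{p..q}|lborel. d) = (q - p) * d" for d :: real
    using pq by (simp add: set_integral_const)
  have "(q - p) * (?A - k)\<^sup>2 = 2 * (?A - k) * ((LINT x:{p..q}|lborel. f x) - (LINT x:{p..q}|lborel. ?A)) + (LINT x:{p..q}|lborel. (?A - k)\<^sup>2)"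
    using pq unfolding c by (simp add: average_def)
  also have "\<dots> = (LINT x:{p..q}|lborel. 2 * (?A - k) * (f x - ?A) + (?A - k)\<^sup>2)"
    by (subst set_integral_add(2); (subst set_integral_mult_right)?; (subst set_integral_diff(2))?)
      (auto intro!: i continuous_intros f)
  also have "\<dots> \<le> (LINT x:{p..q}|lborel. (f x - k)\<^sup>2)"
  proof (rule set_integral_mono)
    fix x
    have "0 \<le> (f x - ?A)\<^sup>2" by simp
    then show "2 * (?A - k) * (f x - ?A) + (?A - k)\<^sup>2 \<le> (f x - k)\<^sup>2"
      by (simp add: power2_eq_square algebra_simps)
  qed (auto intro!: i continuous_intros f)
  finally have le: "(?A - k)\<^sup>2 \<le> 1 / (q - p) * (LINT x:{p..q}|lborel. (f x - k)\<^sup>2)"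
    using pq by (simp add: field_simps)
  have "(\<integral>\<^sup>+x\<in>{p..q}. ennreal ((f x - k)\<^sup>2) \<partial>lborel) = (\<integral>\<^sup>+x. ennreal (indicator {p..q} x *\<^sub>R (f x - k)\<^sup>2) \<partial>lborel)"
    by (intro nn_integral_cong) (auto simp: indicator_def)
  also have "\<dots> = ennreal (LINT x:{p..q}|lborel. (f x - k)\<^sup>2)"
    unfolding set_lebesgue_integral_def
    by (rule nn_integral_eq_integral[OF i[unfolded set_integrable_def]]) (auto intro!: continuous_intros f)
  finally show ?thesis
    using pq le Bochner_Integration.integral_nonneg[of lborel "\<lambda>x. indicator {p..q} x *\<^sub>R (f x - k)\<^sup>2"]
    unfolding set_lebesgue_integral_def by (simp add: ennreal_leI flip: ennreal_mult)
qed

lemma average_near: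
  fixes p q :: real
  assumes pq: "p < q" and f: "continuous_on {p..q} f" and near: "\<And>s. s \<in> {p..q} \<Longrightarrow> \<bar>f s - k\<bar> \<le> \<delta>"
  shows "\<bar>average p q f - k\<bar> \<le> \<delta>"
proof -
  note i = set_integrable_continuous_Icc
  have c: "(LINT x:{p..q}|lborel. d) = (q - p) * d" for d :: real
    using pq by (simp add: set_integral_const)
  have "(LINT x:{p..q}|lborel. k - \<delta>) \<le> (LINT x:{p..q}|lborel. f x)" "(LINT x:{p..q}|lborel. f x) \<le> (LINT x:{p..q}|lborel. k + \<delta>)"
    unfolding set_lebesgue_integral_def
    by (intro integral_mono i[unfolded set_integrable_def] continuous_intros f; use near in \<open>fastforce simp: indicator_def abs_le_iff\<close>)+
  then have "k - \<delta> \<le> average p q f" "average p q f \<le> k + \<delta>"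
    unfolding c average_def using pq by (simp_all add: field_simps)
  then show ?thesis by linarith
qed

text \<open>Jensen's inequality, used once per interval, bounds the squared difference of the
  averages by the mean of (f x - f y)^2 over both intervals. There \<bar>x - y\<bar> \<le> h = q -
  p, so inserting the Gagliardo kernel costs h^(1 + 2 r). The means contribute the factors 2/h and
  1/h, which gives 2 c^2 h^(2 r - 1).\<close>

lemma average_nested_diff:
  fixes p q p' q' :: real
  assumes c: "c \<ge> 0" "r > 1 / 2" and sub: "{p..q} \<subseteq> {a<..<b}" "p \<le> p'" "q' \<le> q" "p < q" "q' - p' = (q - p) / 2"
    and f: "continuous_on {a<..<b} f" and gag: "gagliardo_sq {a<..<b} r f \<le> ennreal (c\<^sup>2)"
  shows "\<bar>average p q f - average p' q' f\<bar> \<le> 2 * c * (q - p) powr (r - 1/2)"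
proof -
  let ?A = "average p q f" and ?B = "average p' q' f" and ?h = "q - p"
  have sub': "{p'..q'} \<subseteq> {p..q}" using sub by auto
  have f1: "continuous_on {p..q} f" by (rule continuous_on_subset[OF f sub(1)])
  have f2: "continuous_on {p'..q'} f" by (rule continuous_on_subset[OF f1 sub'])
  have kern: "ennreal ((f x - f y)\<^sup>2) \<le> ennreal (?h powr (1 + 2 * r)) * ennreal ((f x - f y)\<^sup>2 / \<bar>x - y\<bar> powr (1 + 2 * r))"
    if "x \<in> {p..q}" "y \<in> {p..q}" for x y
  proof (cases "x = y")
    case False
    have "\<bar>x - y\<bar> powr (1 + 2 * r) \<le> ?h powr (1 + 2 * r)"
      using that c by (intro powr_mono2) auto
    then have "(f x - f y)\<^sup>2 \<le> ?h powr (1 + 2 * r) * ((f x - f y)\<^sup>2 / \<bar>x - y\<bar> powr (1 + 2 * r))"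
      using False by (simp add: field_simps mult_left_mono)
    then show ?thesis by (simp add: ennreal_leI flip: ennreal_mult)
  qed simp
  \<comment> \<open>The cut-off is Borel on the whole line, as the integration rules require, and
    has the same seminorm as f.\<close>
  define F where "F = (\<lambda>x. indicator {a<..<b} x * f x)"
  have [measurable]: "F \<in> borel_measurable borel"
    unfolding F_def by (rule locally_integrable_measurable[OF locally_integrable_continuous[OF f]])
  let ?G = "\<lambda>y. \<integral>\<^sup>+x\<in>{a<..<b}. ennreal ((F x - F y)\<^sup>2 / \<bar>x - y\<bar> powr (1 + 2 * r)) \<partial>lborel"
  have gag': "gagliardo_sq {a<..<b} r F \<le> ennreal (c\<^sup>2)"
    using gag gagliardo_sq_cong_AE[of "{a<..<b}" F f r] by (simp add: F_def)
  have kernF: "ennreal ((f x - f y)\<^sup>2) * indicator {p..q} x \<le>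
      ennreal (?h powr (1 + 2 * r)) * (ennreal ((F x - F y)\<^sup>2 / \<bar>x - y\<bar> powr (1 + 2 * r)) * indicator {a<..<b} x)"
    if "y \<in> {p..q}" for x y
  proof (cases "x \<in> {p..q}")
    case True
    have "x \<in> {a<..<b}" "y \<in> {a<..<b}" using True that sub(1) by blast+
    then show ?thesis using kern[OF True that] True by (simp add: F_def)
  qed simp
  have "ennreal ((?A - ?B)\<^sup>2) = ennreal ((?B - ?A)\<^sup>2)" by (simp add: power2_commute)
  also have "\<dots> \<le> ennreal (1 / (q' - p')) * (\<integral>\<^sup>+y\<in>{p'..q'}. ennreal ((f y - ?A)\<^sup>2) \<partial>lborel)"
    using sub by (intro average_minus_const_sq_le f2) auto
  also have "\<dots> \<le> ennreal (2 / ?h) * (\<integral>\<^sup>+y. ennreal (1 / ?h) * (ennreal (?h powr (1 + 2 * r)) *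
      (?G y * indicator {a<..<b} y)) \<partial>lborel)"
  proof (rule mult_mono)
    show "ennreal (1 / (q' - p')) \<le> ennreal (2 / ?h)" using sub by (simp add: field_simps)
    show "(\<integral>\<^sup>+y\<in>{p'..q'}. ennreal ((f y - ?A)\<^sup>2) \<partial>lborel) \<le> (\<integral>\<^sup>+y. ennreal (1 / ?h) * (ennreal (?h powr (1 + 2 * r)) *
      (?G y * indicator {a<..<b} y)) \<partial>lborel)"
    proof (rule nn_integral_mono)
      fix y
      show "ennreal ((f y - ?A)\<^sup>2) * indicator {p'..q'} y \<le> ennreal (1 / ?h) * (ennreal (?h powr (1 + 2 * r)) *
      (?G y * indicator {a<..<b} y))"
      proof (cases "y \<in> {p'..q'}")
        case True
        then have y: "y \<in> {p..q}" "y \<in> {a<..<b}" using sub' sub(1) by blast+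
        have "ennreal ((f y - ?A)\<^sup>2) = ennreal ((?A - f y)\<^sup>2)" by (simp add: power2_commute)
        also have "\<dots> \<le> ennreal (1 / ?h) * (\<integral>\<^sup>+x\<in>{p..q}. ennreal ((f x - f y)\<^sup>2) \<partial>lborel)"
          by (rule average_minus_const_sq_le[OF sub(4) f1])
        also have "\<dots> \<le> ennreal (1 / ?h) * (\<integral>\<^sup>+x. ennreal (?h powr (1 + 2 * r)) * (ennreal ((F x - F y)\<^sup>2 / \<bar>x - y\<bar> powr (1 + 2 * r)) * indicator {a<..<b} x) \<partial>lborel)"
          by (intro mult_left_mono nn_integral_mono kernF y) auto
        also have "\<dots> = ennreal (1 / ?h) * (ennreal (?h powr (1 + 2 * r)) * ?G y)"
          by (subst nn_integral_cmult) auto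
        finally show ?thesis using True y(2) by simp
      qed simp
    qed
  qed auto
  also have "\<dots> = ennreal (2 / ?h) * (ennreal (1 / ?h) * (ennreal (?h powr (1 + 2 * r)) * gagliardo_sq {a<..<b} r F))"
    unfolding gagliardo_sq_def by (simp add: nn_integral_cmult)
  also have "\<dots> \<le> ennreal (2 / ?h) * (ennreal (1 / ?h) * (ennreal (?h powr (1 + 2 * r)) * ennreal (c\<^sup>2)))"
    by (intro mult_left_mono gag') auto
  also have "\<dots> = ennreal (2 / ?h * (1 / ?h * (?h powr (1 + 2 * r) * c\<^sup>2)))"
  proof -
    have nn: "0 \<le> 2 / ?h" "0 \<le> 1 / ?h" "0 \<le> ?h powr (1 + 2 * r)" using sub by auto
    show ?thesis by (simp only: nn[THEN ennreal_mult'])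
  qed
  also have "2 / ?h * (1 / ?h * (?h powr (1 + 2 * r) * c\<^sup>2)) = 2 * c\<^sup>2 * (?h powr (1 + 2 * r) / ?h\<^sup>2)"
    by (simp add: power2_eq_square)
  also have "?h powr (1 + 2 * r) / ?h\<^sup>2 = (?h powr (r - 1/2))\<^sup>2"
  proof -
    have "?h powr (1 + 2 * r) = ?h powr (r - 1/2) * ?h powr (r - 1/2) * ?h powr 2"
      by (simp flip: powr_add)
    then show ?thesis using sub by (simp add: power2_eq_square)
  qed
  finally have "(?A - ?B)\<^sup>2 \<le> 2 * c\<^sup>2 * (?h powr (r - 1/2))\<^sup>2"
    by (subst (asm) ennreal_le_iff) auto
  \<comment> \<open>Raising the factor 2 to 4 makes the right-hand side the square of a simple
    expression.\<close>
  also have "\<dots> \<le> (2 * c * ?h powr (r - 1/2))\<^sup>2" by (simp add: power_mult_distrib)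
  finally show ?thesis using c by (intro power2_le_imp_le[of "\<bar>_\<bar>"]) auto
qed

lemma geometric_limit_bound:
  fixes A :: "nat \<Rightarrow> real"
  assumes lim: "A \<longlonglongrightarrow> l" and step: "\<And>k. \<bar>A k - A (Suc k)\<bar> \<le> B * \<rho> ^ k" and \<rho>: "0 \<le> \<rho>" "\<rho> < 1" and B: "B \<ge> 0"
  shows "\<bar>A 0 - l\<bar> \<le> B / (1 - \<rho>)"
proof (rule LIMSEQ_le_const2)
  show "(\<lambda>n. \<bar>A 0 - A n\<bar>) \<longlonglongrightarrow> \<bar>A 0 - l\<bar>" by (intro tendsto_intros lim)
  have "\<bar>A 0 - A n\<bar> \<le> (\<Sum>k<n. B * \<rho> ^ k)" for n
  proof (induction n)
    case (Suc n)
    then show ?case using step[of n] by simp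
  qed simp
  also have "(\<Sum>k<n. B * \<rho> ^ k) = B * (1 - \<rho> ^ n) / (1 - \<rho>)" for n
    using \<rho> by (simp add: sum_gp_strict flip: sum_distrib_left)
  also have "B * (1 - \<rho> ^ n) / (1 - \<rho>) \<le> B / (1 - \<rho>)" for n
    using \<rho> B by (intro divide_right_mono mult_left_le) auto
  finally show "\<exists>N. \<forall>n\<ge>N. \<bar>A 0 - A n\<bar> \<le> B / (1 - \<rho>)" by blast
qed

text \<open>The intervals shrink to z by halving, so their averages tend to f z by continuity. By
  the preceding estimate consecutive averages differ by terms of a geometric sequence with ratio
  2^(1/2 - r), which is below 1 exactly because r > 1/2.\<close>

lemma average_at_point:
  fixes p q :: "nat \<Rightarrow> real"
  assumes c: "c \<ge> 0" "r > 1 / 2" and f: "continuous_on {a<..<b} f" and gag: "gagliardo_sq {a<..<b} r f \<le> ennreal (c\<^sup>2)"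
    and h: "h > 0" "\<And>k. q k - p k = h / 2 ^ k"
    and nest: "\<And>k. p k \<le> p (Suc k)" "\<And>k. q (Suc k) \<le> q k" "a < p 0" "q 0 < b"
    and z: "\<And>k. p k \<le> z" "\<And>k. z \<le> q k"
  shows "\<bar>average (p 0) (q 0) f - f z\<bar> \<le> 2 * c * h powr (r - 1/2) / (1 - 2 powr (1/2 - r))"
proof (rule geometric_limit_bound)
  have mono: "p 0 \<le> p k" "q k \<le> q 0" for k
    using lift_Suc_mono_le[of p 0 k] lift_Suc_antimono_le[of q 0 k] nest by auto
  have sub: "{p k..q k} \<subseteq> {a<..<b}" for k using mono[of k] nest(3,4) by auto
  have pq: "p k < q k" for k using h(1) h(2)[of k] by (smt (verit) divide_pos_pos zero_less_power)
  show "\<bar>average (p k) (q k) f - average (p (Suc k)) (q (Suc k)) f\<bar> \<le> 2 * c * h powr (r - 1/2) * (2 powr (1/2 - r)) ^ k" for k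
  proof -
    have "\<bar>average (p k) (q k) f - average (p (Suc k)) (q (Suc k)) f\<bar> \<le> 2 * c * (q k - p k) powr (r - 1/2)"
      using h(2)[of k] h(2)[of "Suc k"]
      by (intro average_nested_diff[OF c sub nest(1,2) pq _ f gag]) simp
    also have "(q k - p k) powr (r - 1/2) = h powr (r - 1/2) * (2 powr (1/2 - r)) ^ k"
    proof -
      have "(h / 2 ^ k) powr (r - 1/2) = h powr (r - 1/2) / (2 powr real k) powr (r - 1/2)"
        using h(1) by (simp add: powr_divide powr_realpow)
      also have "(2 powr real k) powr (r - 1/2) = (2 powr (r - 1/2)) ^ k"
        by (simp add: powr_powr powr_power mult.commute)
      also have "h powr (r - 1/2) / (2 powr (r - 1/2)) ^ k = h powr (r - 1/2) * (2 powr (1/2 - r)) ^ k"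
      proof -
        have "2 powr (1/2 - r) = inverse (2 powr (r - 1/2))" by (simp flip: powr_minus)
        then show ?thesis by (simp only: power_inverse divide_inverse)
      qed
      finally show ?thesis using h(2)[of k] by simp
    qed
    finally show ?thesis by (simp add: mult.assoc)
  qed
  show "(\<lambda>k. average (p k) (q k) f) \<longlonglongrightarrow> f z"
  proof (rule LIMSEQ_I)
    fix \<delta> :: real assume \<delta>: "\<delta> > 0"
    have "z \<in> {a<..<b}" using z[of 0] nest(3,4) by auto
    then have "isCont f z" using f by (simp add: continuous_on_eq_continuous_at)
    then obtain e where e: "e > 0" "\<And>s. dist s z < e \<Longrightarrow> dist (f s) (f z) < \<delta> / 2"
      using \<delta> unfolding continuous_at_eps_delta dist_real_def by (metis half_gt_zero)
    have "(\<lambda>k. h * (1/2) ^ k) \<longlonglongrightarrow> 0" by (intro tendsto_mult_right_zero LIMSEQ_realpow_zero) auto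
    then obtain N where N: "\<And>k. k \<ge> N \<Longrightarrow> h * (1/2) ^ k < e"
      using e(1) by (metis (no_types, lifting) eventually_sequentially order_tendstoD(2))
    have "norm (average (p k) (q k) f - f z) < \<delta>" if "k \<ge> N" for k
    proof -
      have "\<bar>average (p k) (q k) f - f z\<bar> \<le> \<delta> / 2"
      proof (rule average_near[OF pq continuous_on_subset[OF f sub]])
        fix s assume "s \<in> {p k..q k}"
        then have "\<bar>s - z\<bar> \<le> q k - p k" using z[of k] by auto
        also have "\<dots> < e" using N[OF that] h(2)[of k] by (simp add: power_one_over)
        finally show "\<bar>f s - f z\<bar> \<le> \<delta> / 2" using e(2)[of s] by (simp add: dist_real_def)
      qed
      then show ?thesis using \<delta> by simp
    qed
    then show "\<exists>N. \<forall>k\<ge>N. norm (average (p k) (q k) f - f z) < \<delta>" by blast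
  qed
  show "2 powr (1/2 - r) < (1::real)" using c by (simp add: powr_less_one)
qed (use c in auto)

text \<open>Campanato's argument: f x and f y are both compared with the average over [x, y], along
  the nested intervals that share the left and the right endpoint, respectively. For k = 0 both
  families start with [x, y].\<close>

lemma holder_of_gagliardo:
  assumes c: "c \<ge> 0" "r > 1 / 2" and f: "continuous_on {a<..<b} f" and gag: "gagliardo_sq {a<..<b} r f \<le> ennreal (c\<^sup>2)"
    and xy: "a < x" "x < y" "y < b"
  shows "\<bar>f x - f y\<bar> \<le> 4 / (1 - 2 powr (1/2 - r)) * c * (y - x) powr (r - 1/2)"
proof -
  let ?B = "2 * c * (y - x) powr (r - 1/2) / (1 - 2 powr (1/2 - r))"
  have le: "(y - x) / 2 ^ Suc k \<le> (y - x) / 2 ^ k" "(y - x) / 2 ^ k > 0" for k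
    using xy by (simp_all add: field_simps)
  have "\<bar>average x (x + (y - x) / 2 ^ 0) f - f x\<bar> \<le> ?B"
    by (rule average_at_point[OF c f gag, of "y - x" "\<lambda>k. x + (y - x) / 2 ^ k" "\<lambda>k. x"])
      (use le xy in \<open>auto simp: less_imp_le simp del: power_Suc\<close>)
  moreover have "\<bar>average (y - (y - x) / 2 ^ 0) y f - f y\<bar> \<le> ?B"
    by (rule average_at_point[OF c f gag, of "y - x" "\<lambda>k. y" "\<lambda>k. y - (y - x) / 2 ^ k"])
      (use le xy in \<open>auto simp: less_imp_le simp del: power_Suc\<close>)
  ultimately have "\<bar>f x - f y\<bar> \<le> 2 * ?B" by simp
  then show ?thesis by simp
qed

text \<open>A larger value at one point would, by the bound on the oscillation, force \<bar>f\<bar>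
  \<ge> 2 c / sqrt (b - a) everywhere, and hence a squared L2 norm of at least 4 c^2.\<close>

lemma le_of_l2_norm_sq:
  fixes a b :: real
  assumes ab: "a < b" and c: "c > 0" and l2: "l2_norm_sq {a<..<b} f \<le> ennreal (c\<^sup>2)"
    and osc: "\<And>x y. x \<in> {a<..<b} \<Longrightarrow> y \<in> {a<..<b} \<Longrightarrow> \<bar>f x - f y\<bar> \<le> K" and x: "x \<in> {a<..<b}"
  shows "\<bar>f x\<bar> \<le> K + 2 * c / sqrt (b - a)"
proof (rule ccontr)
  assume "\<not> ?thesis"
  then have big: "\<bar>f y\<bar> \<ge> 2 * c / sqrt (b - a)" if "y \<in> {a<..<b}" for y
    using osc[OF x that] by linarith
  have "ennreal (4 * c\<^sup>2) = ennreal ((2 * c / sqrt (b - a))\<^sup>2) * emeasure lborel {a<..<b}"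
    using ab by (simp add: power_divide power_mult_distrib flip: ennreal_mult)
  also have "\<dots> = (\<integral>\<^sup>+y\<in>{a<..<b}. ennreal ((2 * c / sqrt (b - a))\<^sup>2) \<partial>lborel)"
    by (simp add: nn_integral_cmult_indicator)
  also have "\<dots> \<le> l2_norm_sq {a<..<b} f"
    unfolding l2_norm_sq_def
  proof (rule nn_integral_mono)
    fix y
    show "ennreal ((2 * c / sqrt (b - a))\<^sup>2) * indicator {a<..<b} y \<le> ennreal ((f y)\<^sup>2) * indicator {a<..<b} y"
    proof (cases "y \<in> {a<..<b}")
      case True
      have "(2 * c / sqrt (b - a))\<^sup>2 \<le> \<bar>f y\<bar>\<^sup>2"
        using big[OF True] c ab by (intro power_mono) auto
      then show ?thesis using True by (simp add: ennreal_leI)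
    qed simp
  qed
  also have "\<dots> \<le> ennreal (c\<^sup>2)" by (rule l2)
  finally show False using c by (subst (asm) ennreal_le_iff) auto
qed

text \<open>For t \<ge> 1 the first weak derivative yields the exponent 1/2; for 1/2 < t < 1 the
  form contains the Gagliardo seminorm of f itself, which yields t - 1/2. The bounds are linear in
  the free scale c, so they apply to a difference of two densities as well as to a single
  one.\<close>

lemma sobolev_embedding:
  fixes a b :: real
  assumes ab: "a < b" and t: "t > 1 / 2"
  obtains C \<gamma> where "C > 0" "\<gamma> > 0"
    "\<And>f c x y. continuous_on {a<..<b} f \<Longrightarrow> c > 0 \<Longrightarrow> sobolev_norm_sq {a<..<b} t f \<le> ennreal (c\<^sup>2) \<Longrightarrow>
       x \<in> {a<..<b} \<Longrightarrow> y \<in> {a<..<b} \<Longrightarrow> \<bar>f x - f y\<bar> \<le> C * c * \<bar>x - y\<bar> powr \<gamma>"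
    "\<And>f c x. continuous_on {a<..<b} f \<Longrightarrow> c > 0 \<Longrightarrow> sobolev_norm_sq {a<..<b} t f \<le> ennreal (c\<^sup>2) \<Longrightarrow>
       x \<in> {a<..<b} \<Longrightarrow> \<bar>f x\<bar> \<le> C * c"
proof -
  let ?I = "{a<..<b}"
  have "\<exists>C>0. \<exists>\<gamma>>0. \<forall>f c x y. continuous_on ?I f \<longrightarrow> c > 0 \<longrightarrow> sobolev_norm_sq ?I t f \<le> ennreal (c\<^sup>2) \<longrightarrow>
       a < x \<longrightarrow> x < y \<longrightarrow> y < b \<longrightarrow> \<bar>f x - f y\<bar> \<le> C * c * (y - x) powr \<gamma>"
  proof (cases "t \<ge> 1")
    case True
    have "\<bar>f x - f y\<bar> \<le> 4 * c * (y - x) powr (1/2)"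
      if "continuous_on ?I f" "c > 0" and le: "sobolev_norm_sq ?I t f \<le> ennreal (c\<^sup>2)" and xy: "a < x" "x < y" "y < b" for f c x y
    proof -
      have "sobolev_norm_sq ?I t f < \<infinity>" using le by (simp add: le_less_trans)
      then obtain u where u: "\<And>\<alpha>. \<alpha> \<le> nat \<lfloor>t\<rfloor> \<Longrightarrow> is_weak_deriv ?I \<alpha> f (u \<alpha>)"
        "\<And>\<alpha>. u \<alpha> \<in> borel_measurable borel" "sobolev_norm_sq ?I t f = tuple_norm_sq ?I t u"
        using sobolev_norm_sq_finiteE by blast
      have m: "1 \<le> nat \<lfloor>t\<rfloor>" using True by linarith
      have "l2_norm_sq ?I (u 1) \<le> ennreal (c\<^sup>2)"
        using l2_norm_sq_le_tuple[OF m] le u(3) by (metis order_trans)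
      then show ?thesis
        using holder_of_weak_deriv[OF u(1)[OF m] that(1) u(2) _ that(2) xy] xy by (simp add: powr_half_sqrt)
    qed
    then show ?thesis by (intro exI[of _ 4] conjI exI[of _ "1/2"]) auto
  next
    case False
    have fl: "\<lfloor>t\<rfloor> = 0" using False t by linarith
    have nint: "t \<notin> \<int>" using False t by (metis Ints_cases fl floor_of_int of_int_0 less_eq_real_def linorder_not_less zero_less_divide_1_iff zero_less_numeral)
    have "\<bar>f x - f y\<bar> \<le> 4 / (1 - 2 powr (1/2 - t)) * c * (y - x) powr (t - 1/2)"
      if f: "continuous_on ?I f" and c: "c > 0" and le: "sobolev_norm_sq ?I t f \<le> ennreal (c\<^sup>2)" and xy: "a < x" "x < y" "y < b" for f c x y
    proof -
      have "sobolev_norm_sq ?I t f < \<infinity>" using le by (simp add: le_less_trans)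
      then obtain u where u: "\<And>\<alpha>. \<alpha> \<le> nat \<lfloor>t\<rfloor> \<Longrightarrow> is_weak_deriv ?I \<alpha> f (u \<alpha>)"
        "sobolev_norm_sq ?I t f = tuple_norm_sq ?I t u"
        using sobolev_norm_sq_finiteE by blast
      have "gagliardo_sq ?I t f = gagliardo_sq ?I t (u 0)"
        by (intro gagliardo_sq_cong_AE is_weak_deriv_0_AE u(1)) simp
      also have "\<dots> \<le> tuple_norm_sq ?I t u"
        unfolding tuple_norm_sq_def using nint fl by simp
      also have "\<dots> \<le> ennreal (c\<^sup>2)" using le u(2) by simp
      finally show ?thesis by (intro holder_of_gagliardo[OF _ t f _ xy]) (use c in auto)
    qed
    moreover have "2 powr (1/2 - t) < (1::real)" using t by (simp add: powr_less_one)
    ultimately show ?thesis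
      using t by (intro exI[of _ "4 / (1 - 2 powr (1/2 - t))"] conjI exI[of _ "t - 1/2"]) auto
  qed
  then obtain C \<gamma> where C: "C > 0" "\<gamma> > 0" and ord: "\<And>f c x y. continuous_on ?I f \<Longrightarrow> c > 0 \<Longrightarrow> sobolev_norm_sq ?I t f \<le> ennreal (c\<^sup>2) \<Longrightarrow>
       a < x \<Longrightarrow> x < y \<Longrightarrow> y < b \<Longrightarrow> \<bar>f x - f y\<bar> \<le> C * c * (y - x) powr \<gamma>" by metis
  have hol: "\<bar>f x - f y\<bar> \<le> C * c * \<bar>x - y\<bar> powr \<gamma>"
    if f: "continuous_on ?I f" "c > 0" "sobolev_norm_sq ?I t f \<le> ennreal (c\<^sup>2)" and "x \<in> ?I" "y \<in> ?I" for f c x y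
    using ord[OF f, of x y] ord[OF f, of y x] that by (cases x y rule: linorder_cases) auto
  define K where "K = C * (b - a) powr \<gamma>"
  have K: "K > 0" using C ab by (simp add: K_def)
  have bnd: "\<bar>f x\<bar> \<le> (K + 2 / sqrt (b - a)) * c"
    if f: "continuous_on ?I f" and c: "c > 0" and le: "sobolev_norm_sq ?I t f \<le> ennreal (c\<^sup>2)" and x: "x \<in> ?I" for f c x
  proof -
    have "\<bar>f x\<bar> \<le> K * c + 2 * c / sqrt (b - a)"
    proof (rule le_of_l2_norm_sq[OF ab c _ _ x])
      show "l2_norm_sq ?I f \<le> ennreal (c\<^sup>2)" using l2_norm_sq_le_sobolev le by (rule order_trans)
      fix x y assume xy: "x \<in> ?I" "y \<in> ?I"
      have "\<bar>f x - f y\<bar> \<le> C * c * \<bar>x - y\<bar> powr \<gamma>" by (rule hol[OF f c le xy])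
      also have "\<dots> \<le> C * c * (b - a) powr \<gamma>"
        using xy C c by (intro mult_left_mono powr_mono2) auto
      finally show "\<bar>f x - f y\<bar> \<le> K * c" by (simp add: K_def mult_ac)
    qed
    then show ?thesis by (simp add: algebra_simps)
  qed
  have s: "0 < 2 / sqrt (b - a)" using ab by simp
  show ?thesis
  proof (rule that[of "C + (K + 2 / sqrt (b - a))" \<gamma>])
    show "C + (K + 2 / sqrt (b - a)) > 0" "\<gamma> > 0" using C K s by linarith+
    show "\<bar>f x - f y\<bar> \<le> (C + (K + 2 / sqrt (b - a))) * c * \<bar>x - y\<bar> powr \<gamma>"
      if f: "continuous_on ?I f" "c > 0" "sobolev_norm_sq ?I t f \<le> ennreal (c\<^sup>2)" "x \<in> ?I" "y \<in> ?I" for f c x y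
      using hol[OF f] K s that(2) by (elim order_trans) (intro mult_right_mono, auto)
    show "\<bar>f x\<bar> \<le> (C + (K + 2 / sqrt (b - a))) * c"
      if f: "continuous_on ?I f" "c > 0" "sobolev_norm_sq ?I t f \<le> ennreal (c\<^sup>2)" "x \<in> ?I" for f c x
      using bnd[OF f] C that(2) by (elim order_trans) (intro mult_right_mono, auto)
  qed
qed

section \<open>Smooth functions have finite Sobolev norm\<close>

lemma nn_integral_powr_from_0:
  assumes s: "s > -1" and L: "L \<ge> 0"
  shows "(\<integral>\<^sup>+z\<in>{0..L}. ennreal (z powr s) \<partial>lborel) = ennreal (L powr (s + 1) / (s + 1))"
proof -
  have "((\<lambda>z. if z \<in> {0..L} then z powr s else 0) has_integral (L powr (s + 1) / (s + 1))) UNIV"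
    using has_integral_powr_from_0[OF s L] by (subst has_integral_restrict_UNIV)
  then have "(\<integral>\<^sup>+z. ennreal (if z \<in> {0..L} then z powr s else 0) \<partial>lborel) = ennreal (L powr (s + 1) / (s + 1))"
    by (intro nn_integral_has_integral_lborel) auto
  also have "(\<integral>\<^sup>+z. ennreal (if z \<in> {0..L} then z powr s else 0) \<partial>lborel) = (\<integral>\<^sup>+z\<in>{0..L}. ennreal (z powr s) \<partial>lborel)"
    by (intro nn_integral_cong) (auto simp: indicator_def)
  finally show ?thesis .
qed

text \<open>After the shift of y to the origin both halves of the interval, the left one reflected,
  lie in [0, b - a].\<close>

lemma nn_integral_dist_powr_le:
  fixes a b y :: real
  assumes s: "s > -1" and y: "y \<in> {a<..<b}"
  shows "(\<integral>\<^sup>+x\<in>{a<..<b}. ennreal (\<bar>x - y\<bar> powr s) \<partial>lborel) \<le> ennreal (2 * ((b - a) powr (s + 1) / (s + 1)))"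
proof -
  let ?L = "b - a"
  have L: "?L \<ge> 0" using y by simp
  have "(\<integral>\<^sup>+x\<in>{a<..<b}. ennreal (\<bar>x - y\<bar> powr s) \<partial>lborel) = (\<integral>\<^sup>+z. ennreal (\<bar>z\<bar> powr s) * indicator {a<..<b} (y + z) \<partial>lborel)"
    using nn_integral_real_affine[of "\<lambda>x. ennreal (\<bar>x - y\<bar> powr s) * indicator {a<..<b} x" 1 y] by simp
  also have "\<dots> \<le> (\<integral>\<^sup>+z. ennreal (z powr s) * indicator {0..?L} z + ennreal ((-z) powr s) * indicator {0..?L} (-z) \<partial>lborel)"
  proof (rule nn_integral_mono)
    fix z
    show "ennreal (\<bar>z\<bar> powr s) * indicator {a<..<b} (y + z) \<le> ennreal (z powr s) * indicator {0..?L} z + ennreal ((-z) powr s) * indicator {0..?L} (-z)"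
      using y by (cases "z \<ge> 0") (auto simp: indicator_def)
  qed
  also have "\<dots> = (\<integral>\<^sup>+z\<in>{0..?L}. ennreal (z powr s) \<partial>lborel) + (\<integral>\<^sup>+z. ennreal ((-z) powr s) * indicator {0..?L} (-z) \<partial>lborel)"
    by (rule nn_integral_add) auto
  also have "(\<integral>\<^sup>+z. ennreal ((-z) powr s) * indicator {0..?L} (-z) \<partial>lborel) = (\<integral>\<^sup>+z\<in>{0..?L}. ennreal (z powr s) \<partial>lborel)"
    using nn_integral_real_affine[of "\<lambda>z. ennreal (z powr s) * indicator {0..?L} z" "-1" 0] by simp
  also have "(\<integral>\<^sup>+z\<in>{0..?L}. ennreal (z powr s) \<partial>lborel) + (\<integral>\<^sup>+z\<in>{0..?L}. ennreal (z powr s) \<partial>lborel) = ennreal (2 * (?L powr (s + 1) / (s + 1)))"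
    unfolding nn_integral_powr_from_0[OF s L] using s L by (simp flip: ennreal_plus)
  finally show ?thesis .
qed

lemma smooth_bounded_on_Icc:
  assumes "smooth u"
  obtains B where "B \<ge> 0" "\<And>x. x \<in> {a..b} \<Longrightarrow> \<bar>u x\<bar> \<le> B"
proof -
  have "compact (u ` {a..b})" by (intro compact_continuous_image smooth_continuous assms) simp
  then obtain B where "B > 0" "\<forall>x\<in>{a..b}. norm (u x) \<le> B"
    by (metis bounded_pos compact_imp_bounded image_iff)
  then show ?thesis using that[of B] by auto
qed

lemma l2_norm_sq_smooth_finite:
  assumes "smooth u"
  shows "l2_norm_sq {a<..<b} u < \<infinity>"
proof -
  obtain B where B: "B \<ge> 0" "\<And>x. x \<in> {a..b} \<Longrightarrow> \<bar>u x\<bar> \<le> B" using smooth_bounded_on_Icc[OF assms] by blast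
  have "l2_norm_sq {a<..<b} u \<le> (\<integral>\<^sup>+x. ennreal (B\<^sup>2) * indicator {a<..<b} x \<partial>lborel)"
    unfolding l2_norm_sq_def
  proof (rule nn_integral_mono)
    fix x
    have "(u x)\<^sup>2 \<le> B\<^sup>2" if "x \<in> {a<..<b}"
      using B(2)[of x] that power_mono[of "\<bar>u x\<bar>" B 2] by auto
    then show "ennreal ((u x)\<^sup>2) * indicator {a<..<b} x \<le> ennreal (B\<^sup>2) * indicator {a<..<b} x"
      by (auto simp: indicator_def ennreal_leI)
  qed
  also have "\<dots> = ennreal (B\<^sup>2) * emeasure lborel {a<..<b}" by (simp add: nn_integral_cmult_indicator)
  also have "\<dots> < \<infinity>" using emeasure_bounded_finite[of "{a<..<b}"] by (simp add: ennreal_mult_less_top)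
  finally show ?thesis .
qed

text \<open>A smooth function is Lipschitz on [a, b], which reduces the kernel to a multiple of
  \<bar>x - y\<bar>^(1 - 2 r). The exponent exceeds -1 exactly when r < 1.\<close>

lemma gagliardo_sq_smooth_finite:
  assumes sm: "smooth u" and r: "r < 1"
  shows "gagliardo_sq {a<..<b} r u < \<infinity>"
proof -
  let ?I = "{a<..<b}"
  obtain K where K: "K \<ge> 0" "\<And>x. x \<in> {a..b} \<Longrightarrow> \<bar>deriv u x\<bar> \<le> K"
    using smooth_bounded_on_Icc[OF smooth_deriv[OF sm]] by blast
  have lip: "\<bar>u x - u y\<bar> \<le> K * \<bar>x - y\<bar>" if "x \<in> ?I" "y \<in> ?I" for x y
    using field_differentiable_bound[of "?I" u "deriv u" K x y] that K(2)
    by (auto intro: has_field_derivative_at_within smooth_DERIV[OF sm])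
  have pt: "(u x - u y)\<^sup>2 / \<bar>x - y\<bar> powr (1 + 2 * r) \<le> K\<^sup>2 * \<bar>x - y\<bar> powr (1 - 2 * r)" if "x \<in> ?I" "y \<in> ?I" for x y
  proof (cases "x = y")
    case False
    have "(u x - u y)\<^sup>2 = \<bar>u x - u y\<bar>\<^sup>2" by simp
    also have "\<dots> \<le> (K * \<bar>x - y\<bar>)\<^sup>2" by (intro power_mono lip that) auto
    also have "\<dots> = K\<^sup>2 * \<bar>x - y\<bar> powr 2" using False by (simp add: power_mult_distrib)
    also have "\<bar>x - y\<bar> powr 2 = \<bar>x - y\<bar> powr (1 - 2 * r) * \<bar>x - y\<bar> powr (1 + 2 * r)"
      by (simp flip: powr_add)
    finally show ?thesis using False by (simp add: field_simps)
  qed simp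
  define Z where "Z = 2 * ((b - a) powr (1 - 2 * r + 1) / (1 - 2 * r + 1))"
  have "gagliardo_sq ?I r u \<le> (\<integral>\<^sup>+y\<in>?I. ennreal (K\<^sup>2) * ennreal Z \<partial>lborel)"
    unfolding gagliardo_sq_def
  proof (rule nn_integral_mono)
    fix y
    show "(\<integral>\<^sup>+x\<in>?I. ennreal ((u x - u y)\<^sup>2 / \<bar>x - y\<bar> powr (1 + 2 * r)) \<partial>lborel) * indicator ?I y \<le> ennreal (K\<^sup>2) * ennreal Z * indicator ?I y"
    proof (cases "y \<in> ?I")
      case True
      have "(\<integral>\<^sup>+x\<in>?I. ennreal ((u x - u y)\<^sup>2 / \<bar>x - y\<bar> powr (1 + 2 * r)) \<partial>lborel) \<le>
        (\<integral>\<^sup>+x. ennreal (K\<^sup>2) * (ennreal (\<bar>x - y\<bar> powr (1 - 2 * r)) * indicator ?I x) \<partial>lborel)"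
        by (rule nn_integral_mono) (use pt[OF _ True] in \<open>auto simp: indicator_def simp flip: ennreal_mult intro: ennreal_leI\<close>)
      also have "\<dots> = ennreal (K\<^sup>2) * (\<integral>\<^sup>+x\<in>?I. ennreal (\<bar>x - y\<bar> powr (1 - 2 * r)) \<partial>lborel)"
        by (rule nn_integral_cmult) auto
      also have "\<dots> \<le> ennreal (K\<^sup>2) * ennreal Z"
        unfolding Z_def using r by (intro mult_left_mono nn_integral_dist_powr_le True) auto
      finally show ?thesis using True by simp
    qed simp
  qed
  also have "\<dots> = ennreal (K\<^sup>2) * ennreal Z * emeasure lborel ?I" by (simp add: nn_integral_cmult_indicator)
  also have "\<dots> < \<infinity>" using emeasure_bounded_finite[of "?I"] by (simp add: ennreal_mult_less_top)
  finally show ?thesis .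
qed

lemma sobolev_norm_sq_smooth_finite:
  assumes "smooth u"
  shows "sobolev_norm_sq {a<..<b} t u < \<infinity>"
proof -
  have "sobolev_norm_sq {a<..<b} t u = tuple_norm_sq {a<..<b} t (\<lambda>\<alpha>. (deriv ^^ \<alpha>) u)"
    by (intro sobolev_norm_sq_eq_tuple is_weak_deriv_smooth assms)
  also have "\<dots> < \<infinity>"
    unfolding tuple_norm_sq_def infinity_ennreal_def
    using l2_norm_sq_smooth_finite[OF smooth_higher_deriv[OF assms]]
      gagliardo_sq_smooth_finite[OF smooth_higher_deriv[OF assms], of "t - \<lfloor>t\<rfloor>"]
    by (simp add: frac_lt_1[unfolded frac_def])
  finally show ?thesis .
qed

lemma sobolev_norm_sq_const:
  assumes "a < b"
  shows "sobolev_norm_sq {a<..<b} t (\<lambda>x. c) = ennreal (c\<^sup>2 * (b - a))"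
proof -
  have d: "(deriv ^^ \<alpha>) (\<lambda>x. c) = (\<lambda>x. if \<alpha> = 0 then c else 0)" for \<alpha>
    by (induction \<alpha>) auto
  have "sobolev_norm_sq {a<..<b} t (\<lambda>x. c) = tuple_norm_sq {a<..<b} t (\<lambda>\<alpha>. (deriv ^^ \<alpha>) (\<lambda>x. c))"
    by (intro sobolev_norm_sq_eq_tuple is_weak_deriv_smooth smooth_const)
  also have "\<dots> = (\<Sum>\<alpha>\<le>nat \<lfloor>t\<rfloor>. if \<alpha> = 0 then ennreal (c\<^sup>2 * (b - a)) else 0)"
  proof -
    have l2: "l2_norm_sq {a<..<b} (\<lambda>x. k) = ennreal (k\<^sup>2 * (b - a))" for k
      unfolding l2_norm_sq_def using assms by (simp add: nn_integral_cmult_indicator ennreal_mult)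
    have "gagliardo_sq {a<..<b} r (\<lambda>x. k) = 0" for r k :: real
      unfolding gagliardo_sq_def by simp
    then show ?thesis
      unfolding tuple_norm_sq_def d l2 by (auto intro!: sum.cong simp del: sum.delta)
  qed
  also have "\<dots> = ennreal (c\<^sup>2 * (b - a))" by simp
  finally show ?thesis .
qed

section \<open>Maximising the likelihood over the sieve\<close>

lemma sobolev_norm_le_iff:
  assumes "D > 0"
  shows "sobolev_norm \<Omega> t f \<le> ennreal D \<longleftrightarrow> sobolev_norm_sq \<Omega> t f \<le> ennreal (D\<^sup>2)"
proof (cases "sobolev_norm_sq \<Omega> t f = \<infinity>")
  case False
  then obtain x where x: "sobolev_norm_sq \<Omega> t f = ennreal x" "x \<ge> 0"
    by (cases "sobolev_norm_sq \<Omega> t f" rule: ennreal_cases) auto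
  show ?thesis
    using assms x real_sqrt_le_iff[of x "D\<^sup>2"] by (simp add: sobolev_norm_def)
qed (simp add: sobolev_norm_def top_unique)

lemma sobolev_norm_eq_iff:
  assumes "D > 0"
  shows "sobolev_norm \<Omega> t f = ennreal D \<longleftrightarrow> sobolev_norm_sq \<Omega> t f = ennreal (D\<^sup>2)"
proof (cases "sobolev_norm_sq \<Omega> t f = \<infinity>")
  case False
  then obtain x where x: "sobolev_norm_sq \<Omega> t f = ennreal x" "x \<ge> 0"
    by (cases "sobolev_norm_sq \<Omega> t f" rule: ennreal_cases) auto
  show ?thesis
    using assms x real_sqrt_eq_iff[of x "D\<^sup>2"] by (simp add: sobolev_norm_def)
qed (simp add: sobolev_norm_def)

definition lik :: "nat \<Rightarrow> (nat \<Rightarrow> real) \<Rightarrow> (real \<Rightarrow> real) \<Rightarrow> real" where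
  "lik n X p = (\<Prod>i=1..n. p (X i))"

text \<open>The rule includes vanishing arguments: \<open>log_ext\<close> never takes the value
  \<infinity>, so -\<infinity> absorbs every other summand.\<close>

lemma log_ext_mult: "0 \<le> x \<Longrightarrow> 0 \<le> y \<Longrightarrow> log_ext x + log_ext y = log_ext (x * y)"
  by (auto simp: log_ext_def ln_mult mult_le_0_iff)

lemma log_ext_le_iff: "0 \<le> x \<Longrightarrow> 0 \<le> y \<Longrightarrow> log_ext x \<le> log_ext y \<longleftrightarrow> x \<le> y"
  by (auto simp: log_ext_def)

lemma log_lik_eq:
  assumes "\<And>i. i \<in> {1..n} \<Longrightarrow> 0 \<le> p (X i)"
  shows "log_lik n X p = ereal (1 / real n) * log_ext (lik n X p)"
proof -
  have "(\<Sum>i\<in>A. log_ext (p (X i))) = log_ext (\<Prod>i\<in>A. p (X i))" if "finite A" "A \<subseteq> {1..n}" for A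
    using that
  proof (induction A rule: finite_induct)
    case empty
    then show ?case by (simp add: log_ext_def)
  next
    case (insert i A)
    then show ?case using assms by (simp add: log_ext_mult prod_nonneg subset_eq)
  qed
  then show ?thesis by (simp add: log_lik_def lik_def)
qed

lemma log_lik_le_iff:
  assumes n: "n \<ge> 1" and p: "\<And>i. i \<in> {1..n} \<Longrightarrow> 0 \<le> p (X i)" and q: "\<And>i. i \<in> {1..n} \<Longrightarrow> 0 \<le> q (X i)"
  shows "log_lik n X p \<le> log_lik n X q \<longleftrightarrow> lik n X p \<le> lik n X q"
proof -
  have "lik n X p \<ge> 0" "lik n X q \<ge> 0" unfolding lik_def using p q by (auto intro!: prod_nonneg)
  then have "log_ext (lik n X p) \<le> log_ext (lik n X q) \<longleftrightarrow> lik n X p \<le> lik n X q" by (rule log_ext_le_iff)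
  moreover have "log_lik n X p \<le> log_lik n X q \<longleftrightarrow> log_ext (lik n X p) \<le> log_ext (lik n X q)"
  proof -
    have "log_lik n X p = ereal (1 / real n) * log_ext (lik n X p)"
      "log_lik n X q = ereal (1 / real n) * log_ext (lik n X q)"
      by (rule log_lik_eq; use p q in auto)+
    \<comment> \<open>For n \<ge> 1 the factor is a positive real, so the order is preserved at
      infinite arguments too; for n = 0 HOL would read it as 0.\<close>
    moreover have "ereal (1 / real n) * u \<le> ereal (1 / real n) * v \<longleftrightarrow> u \<le> v" for u v :: ereal
      using n by (cases u; cases v) (auto simp: divide_le_cancel)
    ultimately show ?thesis by simp
  qed
  ultimately show ?thesis by simp
qed

text \<open>Division by B brings all factors into the unit ball, where products differ by at most
  the sum of the differences. The quotient by B at the end avoids the truncated exponent card I -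
  1.\<close>

lemma prod_diff_le:
  fixes z w :: "nat \<Rightarrow> real"
  assumes B: "B > 0" and "\<And>i. i \<in> I \<Longrightarrow> \<bar>z i\<bar> \<le> B" "\<And>i. i \<in> I \<Longrightarrow> \<bar>w i\<bar> \<le> B"
  shows "\<bar>(\<Prod>i\<in>I. z i) - (\<Prod>i\<in>I. w i)\<bar> \<le> B ^ card I * (\<Sum>i\<in>I. \<bar>z i - w i\<bar>) / B"
proof -
  have "\<bar>(\<Prod>i\<in>I. z i / B) - (\<Prod>i\<in>I. w i / B)\<bar> \<le> (\<Sum>i\<in>I. \<bar>z i / B - w i / B\<bar>)"
    using norm_prod_diff[of I "\<lambda>i. z i / B" "\<lambda>i. w i / B"] assms by simp
  also have "(\<Sum>i\<in>I. \<bar>z i / B - w i / B\<bar>) = (\<Sum>i\<in>I. \<bar>z i - w i\<bar>) / B"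
    using B by (simp add: sum_divide_distrib flip: diff_divide_distrib)
  also have "(\<Prod>i\<in>I. z i / B) - (\<Prod>i\<in>I. w i / B) = ((\<Prod>i\<in>I. z i) - (\<Prod>i\<in>I. w i)) / B ^ card I"
    by (simp add: prod_dividef diff_divide_distrib)
  finally show ?thesis using B by (simp add: field_simps)
qed

text \<open>AM--GM in each factor bounds the square of the midpoint product below by the product of
  the two given products, hence by m^2. For m \<le> 0 squaring would lose the sign, but then
  nonnegativity suffices.\<close>

lemma prod_midpoint_ge_min:
  fixes z w :: "nat \<Rightarrow> real"
  assumes fin: "finite I" and nn: "\<And>i. i \<in> I \<Longrightarrow> 0 \<le> z i" "\<And>i. i \<in> I \<Longrightarrow> 0 \<le> w i"
    and m: "m \<le> (\<Prod>i\<in>I. z i)" "m \<le> (\<Prod>i\<in>I. w i)"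
  shows "m \<le> (\<Prod>i\<in>I. (z i + w i) / 2)"
proof (cases "m \<le> 0")
  case True
  have "0 \<le> (z i + w i) / 2" if "i \<in> I" for i using nn[OF that] by simp
  then have "0 \<le> (\<Prod>i\<in>I. (z i + w i) / 2)" by (rule prod_nonneg)
  then show ?thesis using True by simp
next
  case False
  have "m\<^sup>2 \<le> (\<Prod>i\<in>I. z i) * (\<Prod>i\<in>I. w i)"
    unfolding power2_eq_square using False m by (intro mult_mono) auto
  also have "\<dots> = (\<Prod>i\<in>I. z i * w i)" by (simp add: prod.distrib)
  also have "\<dots> \<le> (\<Prod>i\<in>I. ((z i + w i) / 2)\<^sup>2)"
  proof (rule prod_mono)
    fix i assume i: "i \<in> I"
    have "0 \<le> (z i - w i)\<^sup>2" by simp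
    then have "z i * w i \<le> ((z i + w i) / 2)\<^sup>2" by (simp add: power2_eq_square field_simps)
    then show "0 \<le> z i * w i \<and> z i * w i \<le> ((z i + w i) / 2)\<^sup>2" using nn[OF i] by simp
  qed
  also have "\<dots> = (\<Prod>i\<in>I. (z i + w i) / 2)\<^sup>2" by (simp add: prod_power_distrib)
  finally show ?thesis
  proof (rule power2_le_imp_le)
    have "0 \<le> (z i + w i) / 2" if "i \<in> I" for i using nn[OF that] by simp
    then show "0 \<le> (\<Prod>i\<in>I. (z i + w i) / 2)" by (rule prod_nonneg)
  qed
qed

locale density_sieve =
  fixes a b t \<zeta> D :: real
  assumes ab: "a < b" and t: "t > 1 / 2" and \<zeta>: "0 \<le> \<zeta>" "\<zeta> < 1 / (b - a)"
    and D: "1 / (b - a) < D\<^sup>2" "0 < D"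
begin

abbreviation "I \<equiv> {a<..<b}"
abbreviation "P \<equiv> sieve I t \<zeta> D"
abbreviation "Q \<equiv> sobolev_norm_sq I t"

text \<open>The real-valued form admits subtraction, but an infinite \<open>Q f\<close> is sent to
  0; this explains the finiteness conditions in the estimates for \<open>R\<close>.\<close>

definition R :: "(real \<Rightarrow> real) \<Rightarrow> real" where
  "R f = enn2real (Q f)"

lemma Q_eq_R: "Q f < \<infinity> \<Longrightarrow> Q f = ennreal (R f)"
  by (simp add: R_def)

lemma R_nonneg: "R f \<ge> 0"
  by (simp add: R_def)

text \<open>Membership in the sieve apart from extensionality, so that constructions can be written
  as plain functions and restricted to the interval at the end.\<close>

definition admissible :: "(real \<Rightarrow> real) \<Rightarrow> bool" where
  "admissible f \<longleftrightarrow> continuous_on I f \<and> Q f \<le> ennreal (D\<^sup>2) \<and> (LINT x:I|lborel. f x) = 1 \<and> (\<forall>x\<in>I. \<zeta> \<le> f x)"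

lemma admissible_bounded: "admissible f \<Longrightarrow> bounded (f ` I)"
proof -
  assume f: "admissible f"
  obtain C where "\<And>f c x. continuous_on I f \<Longrightarrow> c > 0 \<Longrightarrow> Q f \<le> ennreal (c\<^sup>2) \<Longrightarrow> x \<in> I \<Longrightarrow> \<bar>f x\<bar> \<le> C * c"
    using sobolev_embedding[OF ab t] by metis
  then have "\<bar>f x\<bar> \<le> C * D" if "x \<in> I" for x
    using f D that unfolding admissible_def by blast
  then show ?thesis by (intro boundedI[of _ "C * D"]) auto
qed

lemma mem_P_iff: "p \<in> P \<longleftrightarrow> p \<in> extensional I \<and> admissible p"
proof
  have ne: "I \<noteq> {}" using ab by simp
  {
    assume p: "p \<in> P"
    then have "bounded (p ` I)" by (auto simp: sieve_def sobolev_space_def mspace_bounded_cont)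
    then have "bdd_below (p ` I)" by (rule bounded_imp_bdd_below)
    then have "(INF x\<in>I. p x) \<le> p x" if "x \<in> I" for x using that by (intro cINF_lower) auto
    then show "p \<in> extensional I \<and> admissible p"
      using p sobolev_norm_le_iff[OF D(2)] unfolding admissible_def
      by (fastforce simp: sieve_def sobolev_space_def mspace_bounded_cont)
  }
  assume p: "p \<in> extensional I \<and> admissible p"
  then have "\<zeta> \<le> (INF x\<in>I. p x)" using ne by (intro cINF_greatest) (auto simp: admissible_def)
  moreover have le: "sobolev_norm I t p \<le> ennreal D"
    using p sobolev_norm_le_iff[OF D(2)] by (auto simp: admissible_def)
  moreover have "sobolev_norm I t p < \<infinity>" using le_less_trans[OF le] by simp
  ultimately show "p \<in> P"
    using p admissible_bounded[of p] by (auto simp: sieve_def sobolev_space_def mspace_bounded_cont admissible_def)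
qed

lemma restrict_in_P: "admissible f \<Longrightarrow> restrict f I \<in> P"
proof -
  assume f: "admissible f"
  have "Q (restrict f I) = Q f" by (rule sobolev_norm_sq_cong) simp
  moreover have "(LINT x:I|lborel. restrict f I x) = (LINT x:I|lborel. f x)"
    unfolding set_lebesgue_integral_def by (intro Bochner_Integration.integral_cong) (auto simp: indicator_def)
  moreover have "continuous_on I (restrict f I) \<longleftrightarrow> continuous_on I f"
    by (rule continuous_on_cong) auto
  ultimately show ?thesis using f by (simp add: mem_P_iff admissible_def)
qed

lemma R_restrict: "R (restrict f I) = R f"
  unfolding R_def by (subst sobolev_norm_sq_cong[of I "restrict f I" f]) auto

lemma lik_restrict: "(\<And>i. i \<in> {1..n} \<Longrightarrow> X i \<in> I) \<Longrightarrow> lik n X (restrict f I) = lik n X f"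
  unfolding lik_def by (intro prod.cong) auto

lemma P_finite: "p \<in> P \<Longrightarrow> Q p < \<infinity>"
  by (auto simp: mem_P_iff admissible_def intro: le_less_trans)

lemma P_R_le: "p \<in> P \<Longrightarrow> R p \<le> D\<^sup>2"
  unfolding R_def by (rule enn2real_leI) (auto simp: mem_P_iff admissible_def)

lemma P_cont: "p \<in> P \<Longrightarrow> continuous_on I p"
  and P_ge: "p \<in> P \<Longrightarrow> x \<in> I \<Longrightarrow> \<zeta> \<le> p x"
  and P_nonneg: "p \<in> P \<Longrightarrow> x \<in> I \<Longrightarrow> 0 \<le> p x"
  and P_int: "p \<in> P \<Longrightarrow> (LINT x:I|lborel. p x) = 1"
  using \<zeta> by (auto simp: mem_P_iff admissible_def intro: order_trans)

lemma diff_finite: "Q p < \<infinity> \<Longrightarrow> Q q < \<infinity> \<Longrightarrow> Q (\<lambda>x. p x - q x) < \<infinity>"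
proof -
  assume f: "Q p < \<infinity>" "Q q < \<infinity>"
  have sq: "(1 * x + -1 * y)\<^sup>2 \<le> 2 * x\<^sup>2 + 2 * y\<^sup>2" for x y :: real
    using zero_le_power2[of "x + y"] by (simp add: power2_eq_square algebra_simps)
  have "Q (\<lambda>x. 1 * p x + -1 * q x) \<le> ennreal 2 * Q p + ennreal 2 * Q q"
    by (rule sobolev_norm_sq_lincomb_le[OF f _ _ sq]) auto
  also have "\<dots> < \<infinity>" using f by (simp add: ennreal_mult_less_top)
  finally show ?thesis by simp
qed

text \<open>The underlying identity is 4 ((x + y)/2)^2 + (x - y)^2 = 2 x^2 + 2 y^2. The bound is
  first taken in \<open>ennreal\<close>, where it also shows that the midpoint term is finite and
  that \<open>R\<close> represents it faithfully.\<close>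

lemma R_parallelogram:
  assumes f: "Q p < \<infinity>" "Q q < \<infinity>"
  shows "4 * R (\<lambda>x. (p x + q x) / 2) + R (\<lambda>x. p x - q x) \<le> 2 * R p + 2 * R q"
    and "Q (\<lambda>x. (p x + q x) / 2) < \<infinity>"
proof -
  have "ennreal 4 * Q (\<lambda>x. 1/2 * p x + 1/2 * q x) + ennreal 1 * Q (\<lambda>x. 1 * p x + -1 * q x) \<le> ennreal 2 * Q p + ennreal 2 * Q q"
    by (rule sobolev_norm_sq_lincomb2_le[OF f]) (auto simp: power2_eq_square algebra_simps)
  moreover have "(\<lambda>x. 1/2 * p x + 1/2 * q x) = (\<lambda>x. (p x + q x) / 2)" by (auto simp: fun_eq_iff field_simps)
  ultimately have le: "ennreal 4 * Q (\<lambda>x. (p x + q x) / 2) + Q (\<lambda>x. p x - q x) \<le> ennreal 2 * Q p + ennreal 2 * Q q"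
    by simp
  have "ennreal 2 * Q p + ennreal 2 * Q q < \<infinity>" using f by (simp add: ennreal_mult_less_top)
  from le_less_trans[OF le this] show fin: "Q (\<lambda>x. (p x + q x) / 2) < \<infinity>"
    by (auto simp: ennreal_mult_less_top)
  have "ennreal (4 * R (\<lambda>x. (p x + q x) / 2) + R (\<lambda>x. p x - q x)) \<le> ennreal (2 * R p + 2 * R q)"
    using le unfolding Q_eq_R[OF fin] Q_eq_R[OF f(1)] Q_eq_R[OF f(2)] Q_eq_R[OF diff_finite[OF f]]
    using R_nonneg by (simp add: ennreal_mult ennreal_plus)
  then show "4 * R (\<lambda>x. (p x + q x) / 2) + R (\<lambda>x. p x - q x) \<le> 2 * R p + 2 * R q"
    using R_nonneg[of p] R_nonneg[of q] by (subst (asm) ennreal_le_iff) auto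
qed

text \<open>The coefficients stay free because there are two uses: A = 1 with a vanishing remainder
  q when limits are taken, and a small A with a fixed perturbation q.\<close>

lemma R_young:
  assumes f: "Q p < \<infinity>" "Q q < \<infinity>" and nn: "c3 \<ge> 0" "c4 \<ge> 0"
    and le: "\<And>x y :: real. (x + A * y)\<^sup>2 \<le> c3 * x\<^sup>2 + c4 * y\<^sup>2"
  shows "R (\<lambda>x. p x + A * q x) \<le> c3 * R p + c4 * R q" and "Q (\<lambda>x. p x + A * q x) < \<infinity>"
proof -
  have "Q (\<lambda>x. 1 * p x + A * q x) \<le> ennreal c3 * Q p + ennreal c4 * Q q"
    by (rule sobolev_norm_sq_lincomb_le[OF f nn]) (use le in simp)
  also have "\<dots> = ennreal (c3 * R p + c4 * R q)"
    unfolding Q_eq_R[OF f(1)] Q_eq_R[OF f(2)] using R_nonneg nn by (simp add: ennreal_mult ennreal_plus)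
  finally have *: "Q (\<lambda>x. p x + A * q x) \<le> ennreal (c3 * R p + c4 * R q)" by simp
  then show "R (\<lambda>x. p x + A * q x) \<le> c3 * R p + c4 * R q"
    unfolding R_def[of "\<lambda>x. p x + A * q x"] using R_nonneg nn by (intro enn2real_leI) auto
  show "Q (\<lambda>x. p x + A * q x) < \<infinity>" using * by (rule le_less_trans) simp
qed

lemma midpoint_in_P:
  assumes "p \<in> P" "q \<in> P"
  shows "restrict (\<lambda>x. (p x + q x) / 2) I \<in> P"
proof (rule restrict_in_P, unfold admissible_def, intro conjI ballI)
  let ?m = "\<lambda>x. (p x + q x) / 2"
  note f = P_finite[OF assms(1)] P_finite[OF assms(2)]
  show "continuous_on I ?m" using assms P_cont by (intro continuous_intros) auto
  have "4 * R ?m \<le> 2 * D\<^sup>2 + 2 * D\<^sup>2"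
    using R_parallelogram(1)[OF f] R_nonneg[of "\<lambda>x. p x - q x"] P_R_le assms by smt
  then show "Q ?m \<le> ennreal (D\<^sup>2)"
    unfolding Q_eq_R[OF R_parallelogram(2)[OF f]] by (intro ennreal_leI) simp
  show "(LINT x:I|lborel. ?m x) = 1"
  proof -
    \<comment> \<open>Integrability can be read off from the value 1: the integral of a
      non-integrable function is 0 by convention.\<close>
    have i: "set_integrable lborel I p" "set_integrable lborel I q"
      using P_int[OF assms(1)] P_int[OF assms(2)]
      unfolding set_integrable_def set_lebesgue_integral_def
      by (metis not_integrable_integral_eq zero_neq_one)+
    have "(LINT x:I|lborel. ?m x) = (LINT x:I|lborel. (p x + q x)) / 2" by simp
    also have "(LINT x:I|lborel. (p x + q x)) = (LINT x:I|lborel. p x) + (LINT x:I|lborel. q x)"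
      by (rule set_integral_add(2)[OF i])
    finally show ?thesis using assms P_int by simp
  qed
  show "\<zeta> \<le> ?m x" if "x \<in> I" for x
    using P_ge[OF assms(1) that] P_ge[OF assms(2) that] by simp
qed

text \<open>The uniform density has both value and squared norm 1/(b - a), a number between \<zeta>
  and D^2.\<close>

lemma const_in_P: "restrict (\<lambda>x. 1 / (b - a)) I \<in> P"
proof (rule restrict_in_P, unfold admissible_def, intro conjI ballI)
  have "Q (\<lambda>x. 1 / (b - a)) = ennreal (1 / (b - a))"
    unfolding sobolev_norm_sq_const[OF ab] using ab by (simp add: power2_eq_square)
  then show "Q (\<lambda>x. 1 / (b - a)) \<le> ennreal (D\<^sup>2)" using D by (simp add: ennreal_leI)
  show "(LINT x:I|lborel. 1 / (b - a)) = 1" using ab by (simp add: set_integral_const)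
qed (use \<zeta> in auto)

lemma close_of_R:
  obtains C where "C > 0" "\<And>p q c x. p \<in> P \<Longrightarrow> q \<in> P \<Longrightarrow> c > 0 \<Longrightarrow> R (\<lambda>x. p x - q x) \<le> c\<^sup>2 \<Longrightarrow> x \<in> I \<Longrightarrow> \<bar>p x - q x\<bar> \<le> C * c"
proof -
  obtain C where C: "C > 0" "\<And>f c x. continuous_on I f \<Longrightarrow> c > 0 \<Longrightarrow> Q f \<le> ennreal (c\<^sup>2) \<Longrightarrow> x \<in> I \<Longrightarrow> \<bar>f x\<bar> \<le> C * c"
    using sobolev_embedding[OF ab t] by metis
  show ?thesis
  proof (rule that[OF C(1)])
    fix p q :: "real \<Rightarrow> real" and c x
    assume p: "p \<in> P" "q \<in> P" and c: "c > 0" and le: "R (\<lambda>x. p x - q x) \<le> c\<^sup>2" and x: "x \<in> I"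
    have "Q (\<lambda>x. p x - q x) \<le> ennreal (c\<^sup>2)"
      unfolding Q_eq_R[OF diff_finite[OF P_finite[OF p(1)] P_finite[OF p(2)]]] by (rule ennreal_leI[OF le])
    moreover have "continuous_on I (\<lambda>x. p x - q x)" using p P_cont by (intro continuous_intros) auto
    ultimately show "\<bar>p x - q x\<bar> \<le> C * c" using C(2) c x by blast
  qed
qed

lemma P_bounded:
  obtains B where "B > 0" "\<And>p x. p \<in> P \<Longrightarrow> x \<in> I \<Longrightarrow> \<bar>p x\<bar> \<le> B"
proof -
  obtain C where C: "C > 0" "\<And>f c x. continuous_on I f \<Longrightarrow> c > 0 \<Longrightarrow> Q f \<le> ennreal (c\<^sup>2) \<Longrightarrow> x \<in> I \<Longrightarrow> \<bar>f x\<bar> \<le> C * c"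
    using sobolev_embedding[OF ab t] by metis
  have "\<bar>p x\<bar> \<le> C * D" if "p \<in> P" "x \<in> I" for p x
    using C(2)[of p D x] that D(2) by (auto simp: mem_P_iff admissible_def)
  then show ?thesis using that[of "C * D"] C(1) D(2) by auto
qed

lemma P_holder:
  obtains K \<gamma> where "K > 0" "\<gamma> > 0" "\<And>p x y. p \<in> P \<Longrightarrow> x \<in> I \<Longrightarrow> y \<in> I \<Longrightarrow> \<bar>p x - p y\<bar> \<le> K * \<bar>x - y\<bar> powr \<gamma>"
proof -
  obtain C \<gamma> where C: "C > 0" "\<gamma> > 0" "\<And>f c x y. continuous_on I f \<Longrightarrow> c > 0 \<Longrightarrow> Q f \<le> ennreal (c\<^sup>2) \<Longrightarrow> x \<in> I \<Longrightarrow> y \<in> I \<Longrightarrow> \<bar>f x - f y\<bar> \<le> C * c * \<bar>x - y\<bar> powr \<gamma>"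
    using sobolev_embedding[OF ab t] by metis
  have "\<bar>p x - p y\<bar> \<le> C * D * \<bar>x - y\<bar> powr \<gamma>" if "p \<in> P" "x \<in> I" "y \<in> I" for p x y
    using C(3)[of p D x y] that D(2) by (auto simp: mem_P_iff admissible_def)
  then show ?thesis using that[of "C * D" \<gamma>] C(1,2) D(2) by auto
qed

text \<open>Young's inequality for g = h n + (g - h n) with weight u = (1/2)^n: the factor 1 + 1/u
  in front of the remainder grows like 2^n only, while the remainder is at most u^2 =
  (1/4)^n.\<close>

lemma R_limit_le:
  assumes fin: "\<And>n. Q (h n) < \<infinity>" "\<And>n. Q (\<lambda>x. g x - h n x) < \<infinity>"
    and close: "\<And>n. R (\<lambda>x. g x - h n x) \<le> (1/4) ^ n" and le: "\<And>n. R (h n) \<le> c + (1/4) ^ n"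
  shows "R g \<le> c"
proof (rule LIMSEQ_le_const)
  define u where "u = (\<lambda>n. (1/2 :: real) ^ n)"
  have u: "u n > 0" "(1/4) ^ n = (u n)\<^sup>2" for n
    by (simp_all add: u_def power2_eq_square flip: power_mult_distrib)
  have "u \<longlonglongrightarrow> 0" unfolding u_def by (rule LIMSEQ_realpow_zero) auto
  then have "(\<lambda>n. (1 + u n) * (c + (u n)\<^sup>2) + ((u n)\<^sup>2 + u n)) \<longlonglongrightarrow> (1 + 0) * (c + 0\<^sup>2) + (0\<^sup>2 + 0)"
    by (intro tendsto_intros)
  then show "(\<lambda>n. (1 + u n) * (c + (u n)\<^sup>2) + ((u n)\<^sup>2 + u n)) \<longlonglongrightarrow> c" by simp
  have "R g \<le> (1 + u n) * (c + (u n)\<^sup>2) + ((u n)\<^sup>2 + u n)" for n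
  proof -
    have young: "(x + 1 * y)\<^sup>2 \<le> (1 + u n) * x\<^sup>2 + (1 + 1 / u n) * y\<^sup>2" for x y
    proof -
      have "0 \<le> (u n * x - y)\<^sup>2 / u n" using u(1)[of n] by simp
      also have "\<dots> = u n * x\<^sup>2 - 2 * x * y + y\<^sup>2 / u n"
        using u(1)[of n] by (simp add: field_simps power2_eq_square)
      finally show ?thesis by (simp add: power2_sum algebra_simps)
    qed
    have "R (\<lambda>x. h n x + 1 * (g x - h n x)) \<le> (1 + u n) * R (h n) + (1 + 1 / u n) * R (\<lambda>x. g x - h n x)"
      using u(1)[of n] by (intro R_young fin young) auto
    also have "\<dots> \<le> (1 + u n) * (c + (u n)\<^sup>2) + (1 + 1 / u n) * (u n)\<^sup>2"
      using le[of n] close[of n] u(1)[of n] unfolding u(2) by (intro add_mono mult_left_mono) auto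
    also have "(1 + 1 / u n) * (u n)\<^sup>2 = (u n)\<^sup>2 + u n"
      using u(1)[of n] by (simp add: field_simps power2_eq_square)
    finally show ?thesis by simp
  qed
  then show "\<exists>N. \<forall>n\<ge>N. R g \<le> (1 + u n) * (c + (u n)\<^sup>2) + ((u n)\<^sup>2 + u n)" by blast
qed

text \<open>The embedding turns the rate (1/4)^n of the squared norm into uniform convergence with
  rate (1/2)^n and so supplies a continuous limit. \<open>sobolev_complete\<close> then bounds its
  distance to h n in the Sobolev norm, and every constraint of the sieve is closed under this
  convergence.\<close>

lemma limit_in_P:
  assumes h: "\<And>k. h k \<in> P" and cauchy: "\<And>n k. n \<le> k \<Longrightarrow> R (\<lambda>x. h k x - h n x) \<le> (1/4) ^ n"
  obtains g where "g \<in> P" "\<And>x. x \<in> I \<Longrightarrow> (\<lambda>k. h k x) \<longlonglongrightarrow> g x"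
    "\<And>n. Q (\<lambda>x. g x - h n x) < \<infinity>" "\<And>n. R (\<lambda>x. g x - h n x) \<le> (1/4) ^ n"
proof -
  obtain C where C: "C > 0" "\<And>p q c x. p \<in> P \<Longrightarrow> q \<in> P \<Longrightarrow> c > 0 \<Longrightarrow> R (\<lambda>x. p x - q x) \<le> c\<^sup>2 \<Longrightarrow> x \<in> I \<Longrightarrow> \<bar>p x - q x\<bar> \<le> C * c"
    using close_of_R by blast
  obtain B where B: "B > 0" "\<And>p x. p \<in> P \<Longrightarrow> x \<in> I \<Longrightarrow> \<bar>p x\<bar> \<le> B" using P_bounded by blast
  have quarter: "(1/4 :: real) ^ n = ((1/2) ^ n)\<^sup>2" for n
    by (simp add: power2_eq_square flip: power_mult_distrib)
  have unif: "\<bar>h k x - h n x\<bar> \<le> C * (1/2) ^ n" if "n \<le> k" "x \<in> I" for n k x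
    using cauchy[OF that(1)] unfolding quarter by (intro C(2) h that(2)) auto
  have small: "(\<lambda>n. C * (1/2) ^ n) \<longlonglongrightarrow> 0"
    by (intro tendsto_mult_right_zero LIMSEQ_realpow_zero) auto
  define g where "g = (\<lambda>x. lim (\<lambda>k. h k x))"
  have conv: "(\<lambda>k. h k x) \<longlonglongrightarrow> g x" if x: "x \<in> I" for x
  proof -
    have "Cauchy (\<lambda>k. h k x)"
    proof (rule CauchyI')
      fix e :: real assume "e > 0"
      then obtain N where N: "C * (1/2) ^ N < e"
        using order_tendstoD(2)[OF small, of e] by (auto simp: eventually_sequentially)
      have "dist (h m x) (h n x) < e" if "m \<ge> N" "n > m" for m n
      proof -
        have "\<bar>h n x - h m x\<bar> \<le> C * (1/2) ^ m" using that by (intro unif x) auto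
        also have "\<dots> \<le> C * (1/2) ^ N" using that C(1) by (intro mult_left_mono power_decreasing) auto
        finally show ?thesis using N by (simp add: dist_real_def abs_minus_commute)
      qed
      then show "\<exists>N. \<forall>m\<ge>N. \<forall>n>m. dist (h m x) (h n x) < e" by blast
    qed
    then show ?thesis unfolding g_def using Cauchy_convergent convergent_LIMSEQ_iff by blast
  qed
  have near: "\<bar>g x - h n x\<bar> \<le> C * (1/2) ^ n" if x: "x \<in> I" for n x
  proof (rule LIMSEQ_le_const2)
    show "(\<lambda>k. \<bar>h k x - h n x\<bar>) \<longlonglongrightarrow> \<bar>g x - h n x\<bar>" by (intro tendsto_intros conv x)
    show "\<exists>N. \<forall>k\<ge>N. \<bar>h k x - h n x\<bar> \<le> C * (1/2) ^ n" using unif x by blast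
  qed
  have "uniform_limit I h g sequentially"
  proof (rule uniform_limitI)
    fix e :: real assume "e > 0"
    then have "\<forall>\<^sub>F n in sequentially. C * (1/2) ^ n < e" using small by (rule order_tendstoD(2)[rotated])
    then show "\<forall>\<^sub>F n in sequentially. \<forall>x\<in>I. dist (h n x) (g x) < e"
    proof eventually_elim
      case (elim n)
      show ?case
      proof
        fix x assume "x \<in> I"
        then have "\<bar>g x - h n x\<bar> < e" using near[of x n] elim by linarith
        then show "dist (h n x) (g x) < e" by (simp add: dist_real_def abs_minus_commute)
      qed
    qed
  qed
  then have gc: "continuous_on I g"
    by (rule uniform_limit_theorem[rotated]) (auto intro!: always_eventually P_cont h)
  have fin: "Q (h n) < \<infinity>" for n by (rule P_finite[OF h])
  have caQ: "Q (\<lambda>x. h k x - h n x) \<le> ennreal ((1/4) ^ n)" if "n \<le> k" for n k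
    unfolding Q_eq_R[OF diff_finite[OF fin fin]] by (rule ennreal_leI[OF cauchy[OF that]])
  have gQ: "Q (\<lambda>x. g x - h n x) \<le> ennreal ((1/4) ^ n)" for n
    by (rule sobolev_complete(1)[OF fin caQ conv gc])
  have gF: "Q g < \<infinity>" by (rule sobolev_complete(2)[OF fin caQ conv gc])
  have gR: "R (\<lambda>x. g x - h n x) \<le> (1/4) ^ n" for n
    unfolding R_def using gQ[of n] by (intro enn2real_leI) auto
  have gF': "Q (\<lambda>x. g x - h n x) < \<infinity>" for n by (rule diff_finite[OF gF fin])
  have "R g \<le> D\<^sup>2"
    using P_R_le[OF h] by (intro R_limit_le[OF fin gF' gR]) (simp add: add_increasing2)
  then have "Q g \<le> ennreal (D\<^sup>2)" unfolding Q_eq_R[OF gF] by (rule ennreal_leI)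
  moreover have "\<zeta> \<le> g x" if "x \<in> I" for x
    by (rule LIMSEQ_le_const[OF conv[OF that]]) (use P_ge[OF h that] in blast)
  moreover have "(LINT x:I|lborel. g x) = 1"
  proof (rule LIMSEQ_unique)
    have meas: "(\<lambda>x. indicator I x *\<^sub>R f x) \<in> borel_measurable lborel" if "continuous_on I f" for f :: "real \<Rightarrow> real"
      using locally_integrable_measurable[OF locally_integrable_continuous[OF that]] by simp
    show "(\<lambda>k. LINT x:I|lborel. h k x) \<longlonglongrightarrow> (LINT x:I|lborel. g x)"
      unfolding set_lebesgue_integral_def
    proof (rule integral_dominated_convergence[where w = "\<lambda>x. indicator I x *\<^sub>R B"])
      have "set_integrable lborel I (\<lambda>x. B)"
        unfolding set_integrable_def by (intro integrable_scaleR_left integrable_real_indicator emeasure_bounded_finite) auto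
      then show "integrable lborel (\<lambda>x. indicator I x *\<^sub>R B)" by (simp add: set_integrable_def)
      show "AE x in lborel. (\<lambda>k. indicator I x *\<^sub>R h k x) \<longlonglongrightarrow> indicator I x *\<^sub>R g x"
        using conv by (intro AE_I2) (auto simp: indicator_def)
      show "AE x in lborel. norm (indicator I x *\<^sub>R h k x) \<le> indicator I x *\<^sub>R B" for k
        using B(2)[OF h] by (intro AE_I2) (auto simp: indicator_def)
    qed (rule meas, use gc P_cont[OF h] in blast)+
    show "(\<lambda>k. LINT x:I|lborel. h k x) \<longlonglongrightarrow> 1" using P_int[OF h] by simp
  qed
  ultimately have "restrict g I \<in> P" using gc by (intro restrict_in_P) (simp add: admissible_def)
  moreover have "R (\<lambda>x. restrict g I x - h n x) = R (\<lambda>x. g x - h n x)" "Q (\<lambda>x. restrict g I x - h n x) = Q (\<lambda>x. g x - h n x)" for n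
  proof -
    show "Q (\<lambda>x. restrict g I x - h n x) = Q (\<lambda>x. g x - h n x)" by (rule sobolev_norm_sq_cong) simp
    then show "R (\<lambda>x. restrict g I x - h n x) = R (\<lambda>x. g x - h n x)" by (simp add: R_def)
  qed
  ultimately show ?thesis using that[of "restrict g I"] conv gF' gR by simp
qed

section \<open>Existence of a maximiser\<close>

definition is_max :: "nat \<Rightarrow> (nat \<Rightarrow> real) \<Rightarrow> (real \<Rightarrow> real) \<Rightarrow> bool" where
  "is_max n X g \<longleftrightarrow> g \<in> P \<and> (\<forall>q\<in>P. lik n X q \<le> lik n X g)"

text \<open>The second conclusion says that near-maximisers cannot have a norm much below that of g.
  It holds because g is a limit of near-minimisers of the norm on ever smaller superlevel
  sets.\<close>

lemma exists_max:
  assumes XX: "\<forall>i\<in>{1..n}. X i \<in> I"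
  obtains g where "is_max n X g"
    "\<And>\<delta>. \<delta> > 0 \<Longrightarrow> \<exists>e>0. \<forall>p\<in>P. lik n X g - e \<le> lik n X p \<longrightarrow> R g - \<delta> \<le> R p"
proof -
  have X: "X i \<in> I" if "i \<in> {1..n}" for i using XX that by blast
  let ?L = "lik n X"
  obtain B where B: "B > 0" "\<And>p x. p \<in> P \<Longrightarrow> x \<in> I \<Longrightarrow> \<bar>p x\<bar> \<le> B" using P_bounded by blast
  have "?L p \<le> B ^ n" if "p \<in> P" for p
  proof -
    have "?L p \<le> (\<Prod>i=1..n. B)"
      unfolding lik_def using B(2)[OF that X] P_nonneg[OF that X] by (intro prod_mono) auto
    then show ?thesis by simp
  qed
  then have bdd: "bdd_above (?L ` P)" by (intro bdd_aboveI2)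
  have ne: "P \<noteq> {}" using const_in_P by blast
  define M where "M = (SUP p\<in>P. ?L p)"
  have M: "?L p \<le> M" if "p \<in> P" for p unfolding M_def by (rule cSUP_upper[OF that bdd])
  define A where "A = (\<lambda>m::nat. {p \<in> P. M - 1 / real (Suc m) \<le> ?L p})"
  have A_ne: "A m \<noteq> {}" for m
  proof -
    have "M - 1 / real (Suc m) < M" by simp
    then obtain p where "p \<in> P" "M - 1 / real (Suc m) < ?L p"
      unfolding M_def using less_cSUP_iff[OF ne bdd] by blast
    then show ?thesis unfolding A_def by force
  qed
  have A_mono: "A m' \<subseteq> A m" if "m \<le> m'" for m m'
  proof -
    have "1 / real (Suc m') \<le> 1 / real (Suc m)" using that by (simp add: frac_le)
    then show ?thesis unfolding A_def by force
  qed
  have A_P: "p \<in> P" if "p \<in> A m" for p m using that by (simp add: A_def)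
  define d where "d = (\<lambda>m. Inf (R ` A m))"
  have bb: "bdd_below (R ` S)" for S using R_nonneg by (intro bdd_belowI2)
  have d_le: "d m \<le> R p" if "p \<in> A m" for m p
    unfolding d_def by (rule cINF_lower[OF bb that])
  have d_mono: "d m \<le> d m'" if "m \<le> m'" for m m'
    unfolding d_def using A_ne by (intro cInf_superset_mono image_mono A_mono that bb) auto
  have "d m \<le> D\<^sup>2" for m
    using A_ne[of m] d_le[of _ m] P_R_le A_P[of _ m] by (meson all_not_in_conv order_trans)
  then have d_bdd: "bdd_above (range d)" by (intro bdd_aboveI2)
  \<comment> \<open>The least norms d m grow with m, since the sets shrink, and are bounded by D^2;
    so the supremum is their limit.\<close>
  define dd where "dd = (SUP m. d m)"
  have d_dd: "d m \<le> dd" for m unfolding dd_def by (rule cSUP_upper[OF _ d_bdd]) simp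
  have ex: "\<exists>m. dd - \<delta> < d m" if "\<delta> > 0" for \<delta>
  proof -
    have "dd - \<delta> < dd" using that by simp
    then show ?thesis unfolding dd_def using less_cSUP_iff[OF _ d_bdd] by auto
  qed
  have mid: "R (\<lambda>x. p x - q x) \<le> 2 * R p + 2 * R q - 4 * d m" if p: "p \<in> A m" and q: "q \<in> A m" for p q m
  proof -
    let ?m = "restrict (\<lambda>x. (p x + q x) / 2) I"
    note PP = A_P[OF p] A_P[OF q]
    have "M - 1 / real (Suc m) \<le> (\<Prod>i=1..n. (p (X i) + q (X i)) / 2)"
      using p q P_nonneg[OF PP(1) X] P_nonneg[OF PP(2) X] unfolding A_def lik_def
      by (intro prod_midpoint_ge_min) auto
    also have "\<dots> = ?L ?m" by (subst lik_restrict[OF X]) (auto simp: lik_def)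
    finally have "?m \<in> A m" using midpoint_in_P[OF PP] by (simp add: A_def)
    then have "d m \<le> R (\<lambda>x. (p x + q x) / 2)" using d_le R_restrict by metis
    then show ?thesis using R_parallelogram(1)[OF P_finite[OF PP(1)] P_finite[OF PP(2)]] by linarith
  qed
  \<comment> \<open>The divisor 8 is the sum 2 + 2 + 4 of the coefficients in \<open>mid\<close>, so
    that the Cauchy bound comes out as (1/4)^j.\<close>
  define \<delta> where "\<delta> = (\<lambda>k::nat. (1/4 :: real) ^ k / 8)"
  have \<delta>: "\<delta> k > 0" for k by (simp add: \<delta>_def)
  obtain N where N: "\<And>k. dd - \<delta> k < d (N k)" using ex[OF \<delta>] by metis
  \<comment> \<open>The partial sums make the index monotone and at least N k; the summand k forces
    the tolerance 1/(m k + 1) of the likelihood to tend to 0.\<close>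
  define m where "m = (\<lambda>k. k + (\<Sum>j\<le>k. N j))"
  have m_mono: "m k \<le> m k'" if "k \<le> k'" for k k'
    unfolding m_def using that by (intro add_mono sum_mono2) auto
  have dm: "dd - \<delta> k < d (m k)" for k
  proof -
    have "N k \<le> (\<Sum>j\<le>k. N j)" by (rule member_le_sum) auto
    then have "d (N k) \<le> d (m k)" by (intro d_mono) (simp add: m_def)
    then show ?thesis using N[of k] by linarith
  qed
  have "\<exists>p\<in>A (m k). R p < d (m k) + \<delta> k" for k
    using cInf_lessD[of "R ` A (m k)" "d (m k) + \<delta> k"] A_ne[of "m k"] \<delta>[of k] by (auto simp: d_def)
  then obtain h where h: "\<And>k. h k \<in> A (m k)" "\<And>k. R (h k) < d (m k) + \<delta> k" by metis
  have hP: "h k \<in> P" for k by (rule A_P[OF h(1)])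
  have cauchy: "R (\<lambda>x. h k x - h j x) \<le> (1/4) ^ j" if "j \<le> k" for j k
  proof -
    have "h k \<in> A (m j)" using h(1)[of k] A_mono[OF m_mono[OF that]] by blast
    then have "R (\<lambda>x. h k x - h j x) \<le> 2 * R (h k) + 2 * R (h j) - 4 * d (m j)" using h(1) by (intro mid)
    moreover have "\<delta> k \<le> \<delta> j" using that by (simp add: \<delta>_def power_decreasing)
    ultimately have "R (\<lambda>x. h k x - h j x) \<le> 8 * \<delta> j"
      using h(2)[of k] h(2)[of j] dm[of j] d_dd[of "m k"] d_dd[of "m j"] by linarith
    then show ?thesis by (simp add: \<delta>_def)
  qed
  obtain g where g: "g \<in> P" "\<And>x. x \<in> I \<Longrightarrow> (\<lambda>k. h k x) \<longlonglongrightarrow> g x"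
    "\<And>n. Q (\<lambda>x. g x - h n x) < \<infinity>" "\<And>n. R (\<lambda>x. g x - h n x) \<le> (1/4) ^ n"
    using limit_in_P[OF hP cauchy] by blast
  have "R (h k) \<le> dd + (1/4) ^ k" for k
    using h(2)[of k] d_dd[of "m k"] \<delta>[of k] unfolding \<delta>_def by linarith
  then have Rg: "R g \<le> dd" by (intro R_limit_le[OF P_finite[OF hP] g(3,4)])
  have "M \<le> ?L g"
  proof (rule LIMSEQ_le)
    show "(\<lambda>k. M - inverse (real (Suc k))) \<longlonglongrightarrow> M"
      using tendsto_diff[OF tendsto_const LIMSEQ_inverse_real_of_nat] by simp
    show "(\<lambda>k. ?L (h k)) \<longlonglongrightarrow> ?L g" unfolding lik_def using X by (intro tendsto_prod g(2)) auto
    have "M - inverse (real (Suc k)) \<le> ?L (h k)" for k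
    proof -
      have "real (Suc k) \<le> real (Suc (m k))" by (simp add: m_def del: of_nat_Suc)
      then have "1 / real (Suc (m k)) \<le> 1 / real (Suc k)" by (intro divide_left_mono) auto
      then show ?thesis using h(1)[of k] unfolding A_def inverse_eq_divide by force
    qed
    then show "\<exists>N. \<forall>k\<ge>N. M - inverse (real (Suc k)) \<le> ?L (h k)" by blast
  qed
  show ?thesis
  proof (rule that[of g])
    show "is_max n X g" unfolding is_max_def using g(1) \<open>M \<le> ?L g\<close> M order_trans by blast
    fix \<epsilon> :: real assume "\<epsilon> > 0"
    then obtain j where j: "dd - \<epsilon> < d j" using ex by blast
    have "R g - \<epsilon> \<le> R p" if "p \<in> P" "?L g - 1 / real (Suc j) \<le> ?L p" for p
    proof -
      have "p \<in> A j" using that \<open>M \<le> ?L g\<close> by (simp add: A_def)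
      then show ?thesis using d_le[of p j] j Rg by linarith
    qed
    then show "\<exists>e>0. \<forall>p\<in>P. ?L g - e \<le> ?L p \<longrightarrow> R g - \<epsilon> \<le> R p"
      by (intro exI[of _ "1 / real (Suc j)"]) auto
  qed
qed

section \<open>The norm bound is attained\<close>

lemma exists_above_zeta:
  assumes g: "g \<in> P"
  shows "\<exists>x\<in>I. \<zeta> < g x"
proof (rule ccontr)
  assume "\<not> ?thesis"
  then have "g x = \<zeta>" if "x \<in> I" for x using P_ge[OF g that] that by force
  then have "(LINT x:I|lborel. g x) = (LINT x:I|lborel. \<zeta>)"
    unfolding set_lebesgue_integral_def by (intro Bochner_Integration.integral_cong) (auto simp: indicator_def)
  also have "\<dots> = (b - a) * \<zeta>" using ab by (simp add: set_integral_const)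
  also have "\<dots> < 1" using \<zeta>(2) ab by (simp add: field_simps)
  finally show False using P_int[OF g] by simp
qed

text \<open>If the norm bound left room, g could be perturbed by a small multiple of a function u of
  total mass 0 that is 1 at all sample points and negative at most where g exceeds \<zeta> by a
  margin. Every factor of the likelihood would increase.\<close>

lemma max_norm_eq:
  assumes n: "n \<ge> 1" and XX: "\<forall>i\<in>{1..n}. X i \<in> I" and g: "is_max n X g"
  shows "R g = D\<^sup>2"
proof (rule ccontr)
  assume "R g \<noteq> D\<^sup>2"
  have X: "X i \<in> I" if "i \<in> {1..n}" for i using XX that by blast
  have gP: "g \<in> P" using g by (simp add: is_max_def)
  have lt: "R g < D\<^sup>2" using P_R_le[OF gP] \<open>R g \<noteq> D\<^sup>2\<close> by simp
  obtain x0 where x0: "x0 \<in> I" "\<zeta> < g x0" using exists_above_zeta[OF gP] by blast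
  define \<delta> where "\<delta> = (g x0 - \<zeta>) / 2"
  have \<delta>: "\<delta> > 0" using x0 by (simp add: \<delta>_def)
  let ?U = "{x \<in> I. \<zeta> + \<delta> < g x}"
  have "open ?U"
    using continuous_open_preimage[OF P_cont[OF gP], of "{\<zeta> + \<delta><..}"] by (simp add: vimage_def Int_def)
  moreover have "x0 \<in> ?U" using x0 by (simp add: \<delta>_def field_simps)
  ultimately obtain e where e: "e > 0" "ball x0 e \<subseteq> ?U" by (meson open_contains_ball)
  let ?F = "X ` {1..n}"
  have "infinite (ball x0 e)" using e(1) by (simp add: ball_eq_greaterThanLessThan)
  \<comment> \<open>The sample is finite and the ball is not, so a small interval free of sample
    points fits into the ball.\<close>
  then have "ball x0 e - ?F \<noteq> {}" by (metis finite_Diff2 finite.emptyI finite_imageI finite_atLeastAtMost)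
  moreover have "open (ball x0 e - ?F)" by (intro open_Diff finite_imp_closed) auto
  ultimately obtain z r where r: "r > 0" "cball z r \<subseteq> ball x0 e - ?F" by (meson ex_in_conv open_contains_cball)
  let ?p = "z - r" and ?q = "z + r"
  have pq: "?p < ?q" using r(1) by simp
  have J: "{?p..?q} \<subseteq> ?U" "{?p..?q} \<inter> ?F = {}"
    using r(2) e(2) unfolding cball_eq_atLeastAtMost by blast+
  obtain H \<psi> where "mollifier ?p ?q H \<psi>" by (rule mollifier_exists[OF pq])
  note \<psi> = mollifierD[OF this]
  have JI: "{?p..?q} \<subseteq> I" using J(1) by blast
  have one: "(LINT s:I|lborel. \<psi> s) = 1"
    by (rule integral_mollifier[OF pq JI \<psi>(1,2,4)]) (use \<psi>(5)[of ?p] \<psi>(6)[of ?q] in auto)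
  have \<psi>T: "\<psi> \<in> test_functions I" by (rule test_functionsI[OF \<psi>(1,4) JI])
  obtain K where K: "\<And>x. \<bar>\<psi> x\<bar> \<le> K" "K > 0" using test_function_bounded[OF \<psi>T] by blast
  \<comment> \<open>The factor b - a balances the mass of the constant 1 against the unit mass of
    \<psi>.\<close>
  define u where "u = (\<lambda>x. 1 - (b - a) * \<psi> x)"
  have su: "smooth u" unfolding u_def by (intro smooth_diff smooth_mult smooth_const \<psi>(1))
  have uQ: "Q u < \<infinity>" by (rule sobolev_norm_sq_smooth_finite[OF su])
  \<comment> \<open>The bound 1 is for the quadratic inequality \<open>conv\<close>, the second one
    keeps f above \<zeta> on the support of \<psi>, the third keeps the norm below D. The summand 1
    makes the last denominator positive.\<close>
  define \<epsilon> where "\<epsilon> = Min {1, \<delta> / ((b - a) * K), (D\<^sup>2 - R g) / (R g + 2 * R u + 1)}"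
  have pos: "R g + 2 * R u + 1 > 0" using R_nonneg[of g] R_nonneg[of u] by simp
  have \<epsilon>: "\<epsilon> > 0" "\<epsilon> \<le> 1" "\<epsilon> \<le> \<delta> / ((b - a) * K)" "\<epsilon> \<le> (D\<^sup>2 - R g) / (R g + 2 * R u + 1)"
  proof -
    have "\<forall>w\<in>{1, \<delta> / ((b - a) * K), (D\<^sup>2 - R g) / (R g + 2 * R u + 1)}. \<epsilon> \<le> w"
      unfolding \<epsilon>_def by (intro ballI Min_le) auto
    then show "\<epsilon> \<le> 1" "\<epsilon> \<le> \<delta> / ((b - a) * K)" "\<epsilon> \<le> (D\<^sup>2 - R g) / (R g + 2 * R u + 1)" by blast+
    show "\<epsilon> > 0" using \<delta> ab K(2) lt pos by (simp add: \<epsilon>_def)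
  qed
  define f where "f = (\<lambda>x. g x + \<epsilon> * u x)"
  have conv: "(x + \<epsilon> * y)\<^sup>2 \<le> (1 + \<epsilon>) * x\<^sup>2 + 2 * \<epsilon> * y\<^sup>2" for x y
  proof -
    have "0 \<le> \<epsilon> * (x - y)\<^sup>2" "0 \<le> \<epsilon> * (1 - \<epsilon>) * y\<^sup>2" using \<epsilon> by auto
    then show ?thesis by (simp add: power2_eq_square algebra_simps)
  qed
  have "R f \<le> (1 + \<epsilon>) * R g + 2 * \<epsilon> * R u"
    unfolding f_def using \<epsilon> by (intro R_young(1) P_finite gP uQ conv) auto
  also have "\<dots> \<le> D\<^sup>2"
  proof -
    have "\<epsilon> * (R g + 2 * R u + 1) \<le> D\<^sup>2 - R g" using \<epsilon>(4) pos by (simp add: pos_le_divide_eq)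
    then show ?thesis using \<epsilon>(1) by (simp add: algebra_simps)
  qed
  finally have Rf: "R f \<le> D\<^sup>2" .
  have fQ: "Q f < \<infinity>"
    unfolding f_def using \<epsilon> by (intro R_young(2)[OF _ _ _ _ conv] P_finite gP uQ) auto
  have uout: "u x = 1" if "x \<notin> {?p..?q}" for x using \<psi>(4)[OF that] by (simp add: u_def)
  have "admissible f"
    unfolding admissible_def
  proof (intro conjI ballI)
    show "continuous_on I f" unfolding f_def by (intro continuous_intros P_cont[OF gP] smooth_continuous[OF su])
    show "Q f \<le> ennreal (D\<^sup>2)" unfolding Q_eq_R[OF fQ] by (rule ennreal_leI[OF Rf])
    show "(LINT x:I|lborel. f x) = 1"
    proof -
      have ig: "set_integrable lborel I g"
        using P_int[OF gP] unfolding set_integrable_def set_lebesgue_integral_def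
        by (metis not_integrable_integral_eq zero_neq_one)
      have i\<psi>: "set_integrable lborel I \<psi>"
        using one unfolding set_integrable_def set_lebesgue_integral_def
        by (metis not_integrable_integral_eq zero_neq_one)
      have i1: "set_integrable lborel I (\<lambda>x. \<epsilon>)"
        unfolding set_integrable_def by (intro integrable_scaleR_left integrable_real_indicator emeasure_bounded_finite) auto
      have i2: "set_integrable lborel I (\<lambda>x. \<epsilon> * (b - a) * \<psi> x)" by (intro set_integrable_mult_right i\<psi>)
      have i3: "set_integrable lborel I (\<lambda>x. \<epsilon> - \<epsilon> * (b - a) * \<psi> x)" by (rule set_integral_diff(1)[OF i1 i2])
      have "(LINT x:I|lborel. f x) = (LINT x:I|lborel. g x + (\<epsilon> - \<epsilon> * (b - a) * \<psi> x))"
        by (simp add: f_def u_def algebra_simps)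
      also have "\<dots> = (LINT x:I|lborel. g x) + ((LINT x:I|lborel. \<epsilon>) - (LINT x:I|lborel. \<epsilon> * (b - a) * \<psi> x))"
        by (simp only: set_integral_add(2)[OF ig i3] set_integral_diff(2)[OF i1 i2])
      also have "(LINT x:I|lborel. \<epsilon> * (b - a) * \<psi> x) = \<epsilon> * (b - a)" using one by simp
      also have "(LINT x:I|lborel. \<epsilon>) = \<epsilon> * (b - a)" using ab by (simp add: set_integral_const)
      finally show ?thesis using P_int[OF gP] by simp
    qed
    show "\<zeta> \<le> f x" if x: "x \<in> I" for x
    proof (cases "x \<in> {?p..?q}")
      case True
      have "\<epsilon> * ((b - a) * \<psi> x) \<le> \<epsilon> * ((b - a) * K)"
        using \<epsilon>(1) ab K(1)[of x] by (intro mult_left_mono) auto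
      also have "\<dots> \<le> \<delta>" using \<epsilon>(3) ab K(2) by (simp add: pos_le_divide_eq)
      finally have "\<epsilon> * ((b - a) * \<psi> x) \<le> \<delta>" .
      moreover have "\<zeta> + \<delta> < g x" using J(1) True by blast
      moreover have "f x = g x + \<epsilon> - \<epsilon> * ((b - a) * \<psi> x)" by (simp add: f_def u_def algebra_simps)
      ultimately show ?thesis using \<epsilon>(1) by linarith
    next
      case False
      then show ?thesis using uout[OF False] \<epsilon>(1) P_ge[OF gP x] by (simp add: f_def)
    qed
  qed
  then have "lik n X (restrict f I) \<le> lik n X g" using g restrict_in_P unfolding is_max_def by blast
  moreover have "lik n X g < lik n X (restrict f I)"
  proof -
    have fX: "f (X i) = g (X i) + \<epsilon>" if "i \<in> {1..n}" for i
    proof -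
      have "X i \<notin> {?p..?q}" using J(2) that by blast
      then show ?thesis using uout by (simp add: f_def)
    qed
    have gX: "0 \<le> g (X i)" if "i \<in> {1..n}" for i using P_nonneg[OF gP X[OF that]] .
    have "(\<Prod>i=1..n. g (X i)) < (\<Prod>i=1..n. f (X i))"
    \<comment> \<open>Strictness holds even if g vanishes at sample points, because all new factors
      are positive; the index 1 is available since n \<ge> 1.\<close>
    proof (rule prod_mono_strict[of 1])
      show "0 < f (X i)" "0 \<le> g (X i) \<and> g (X i) \<le> f (X i)" if "i \<in> {1..n}" for i
        using fX[OF that] gX[OF that] \<epsilon>(1) by auto
    qed (use n fX[of 1] \<epsilon>(1) in auto)
    then show ?thesis by (subst lik_restrict[OF X]) (auto simp: lik_def)
  qed
  ultimately show False by simp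
qed

text \<open>With R g = D^2, the form at g is at once the largest on the sieve and nearly the least
  on the superlevel sets. A midpoint of g with a near-maximiser p therefore has almost the form D^2,
  and the parallelogram law makes p - g small, uniformly in p.\<close>

lemma exists_stable_max:
  assumes n: "n \<ge> 1" and XX: "\<forall>i\<in>{1..n}. X i \<in> I"
  obtains g where "is_max n X g" "\<And>p. is_max n X p \<Longrightarrow> p = g"
    "\<And>\<eta>. \<eta> > 0 \<Longrightarrow> \<exists>e>0. \<forall>p\<in>P. lik n X g - e \<le> lik n X p \<longrightarrow> (\<forall>x\<in>I. \<bar>p x - g x\<bar> \<le> \<eta>)"
proof -
  have X: "X i \<in> I" if "i \<in> {1..n}" for i using XX that by blast
  let ?L = "lik n X"
  obtain g where g: "is_max n X g"
    and low: "\<And>\<delta>. \<delta> > 0 \<Longrightarrow> \<exists>e>0. \<forall>p\<in>P. ?L g - e \<le> ?L p \<longrightarrow> R g - \<delta> \<le> R p"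
    using exists_max[OF XX] by blast
  have gP: "g \<in> P" using g by (simp add: is_max_def)
  have Rg: "R g = D\<^sup>2" by (rule max_norm_eq[OF n XX g])
  obtain C where C: "C > 0" "\<And>p q c x. p \<in> P \<Longrightarrow> q \<in> P \<Longrightarrow> c > 0 \<Longrightarrow> R (\<lambda>x. p x - q x) \<le> c\<^sup>2 \<Longrightarrow> x \<in> I \<Longrightarrow> \<bar>p x - q x\<bar> \<le> C * c"
    using close_of_R by blast
  have near: "\<exists>e>0. \<forall>p\<in>P. ?L g - e \<le> ?L p \<longrightarrow> (\<forall>x\<in>I. \<bar>p x - g x\<bar> \<le> \<eta>)" if \<eta>: "\<eta> > 0" for \<eta>
  proof -
    \<comment> \<open>The quarter cancels the 4 in the parallelogram law, and the division by C
      anticipates the embedding constant.\<close>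
    have "(\<eta> / C)\<^sup>2 / 4 > 0" using \<eta> C(1) by simp
    then obtain e where e: "e > 0" "\<And>p. p \<in> P \<Longrightarrow> ?L g - e \<le> ?L p \<Longrightarrow> R g - (\<eta> / C)\<^sup>2 / 4 \<le> R p"
      using low by blast
    have "\<bar>p x - g x\<bar> \<le> \<eta>" if p: "p \<in> P" and Lp: "?L g - e \<le> ?L p" and x: "x \<in> I" for p x
    proof -
      let ?m = "restrict (\<lambda>x. (p x + g x) / 2) I"
      have "?L g - e \<le> (\<Prod>i=1..n. (p (X i) + g (X i)) / 2)"
        using Lp e(1) P_nonneg[OF p X] P_nonneg[OF gP X] unfolding lik_def
        by (intro prod_midpoint_ge_min) auto
      also have "\<dots> = ?L ?m" by (subst lik_restrict[OF X]) (auto simp: lik_def)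
      finally have "R g - (\<eta> / C)\<^sup>2 / 4 \<le> R ?m" by (intro e(2) midpoint_in_P p gP)
      then have "R (\<lambda>x. p x - g x) \<le> (\<eta> / C)\<^sup>2"
        using R_parallelogram(1)[OF P_finite[OF p] P_finite[OF gP]] P_R_le[OF p] Rg unfolding R_restrict by linarith
      then have "\<bar>p x - g x\<bar> \<le> C * (\<eta> / C)" using \<eta> C(1) by (intro C(2) p gP x) auto
      then show ?thesis using C(1) by simp
    qed
    then show ?thesis using e(1) by blast
  qed
  \<comment> \<open>A maximiser lies in every superlevel set, hence within every positive \<eta> of
    g; both are extensional, so agreement on the interval is equality.\<close>
  have uniq: "p = g" if p: "is_max n X p" for p
  proof (rule extensionalityI)
    have pP: "p \<in> P" using p by (simp add: is_max_def)
    show "p \<in> extensional I" "g \<in> extensional I" using pP gP by (auto simp: mem_P_iff)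
    fix x assume x: "x \<in> I"
    have "\<bar>p x - g x\<bar> \<le> 0 + \<eta>" if "\<eta> > 0" for \<eta>
      using near[OF that] p g pP x unfolding is_max_def by (smt (verit, best))
    then have "\<bar>p x - g x\<bar> \<le> 0" by (rule field_le_epsilon)
    then show "p x = g x" by simp
  qed
  show ?thesis by (rule that[OF g uniq near])
qed

section \<open>Continuous dependence on the sample\<close>

definition phat :: "nat \<Rightarrow> (nat \<Rightarrow> real) \<Rightarrow> real \<Rightarrow> real" where
  "phat n X = (THE p. is_max n X p)"

lemma phat_is_max:
  assumes "n \<ge> 1" "\<forall>i\<in>{1..n}. X i \<in> I"
  shows "is_max n X (phat n X)" and "is_max n X p \<Longrightarrow> p = phat n X"
    and "\<eta> > 0 \<Longrightarrow> \<exists>e>0. \<forall>p\<in>P. lik n X (phat n X) - e \<le> lik n X p \<longrightarrow> (\<forall>x\<in>I. \<bar>p x - phat n X x\<bar> \<le> \<eta>)"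
proof -
  obtain g where g: "is_max n X g" "\<And>p. is_max n X p \<Longrightarrow> p = g"
    "\<And>\<eta>. \<eta> > 0 \<Longrightarrow> \<exists>e>0. \<forall>p\<in>P. lik n X g - e \<le> lik n X p \<longrightarrow> (\<forall>x\<in>I. \<bar>p x - g x\<bar> \<le> \<eta>)"
    using exists_stable_max[OF assms] by blast
  have eq: "phat n X = g" unfolding phat_def using g(1,2) by blast
  show "is_max n X (phat n X)" unfolding eq by (rule g(1))
  show "p = phat n X" if "is_max n X p" unfolding eq by (rule g(2)[OF that])
  show "\<exists>e>0. \<forall>p\<in>P. lik n X (phat n X) - e \<le> lik n X p \<longrightarrow> (\<forall>x\<in>I. \<bar>p x - phat n X x\<bar> \<le> \<eta>)"
    if "\<eta> > 0" unfolding eq by (rule g(3)[OF that])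
qed

lemma lik_equicontinuous:
  assumes e: "e > 0"
  obtains \<theta> where "\<theta> > 0" "\<And>X Y p. p \<in> P \<Longrightarrow> (\<And>i. i \<in> {1..n} \<Longrightarrow> X i \<in> I \<and> Y i \<in> I \<and> \<bar>Y i - X i\<bar> < \<theta>) \<Longrightarrow> \<bar>lik n Y p - lik n X p\<bar> \<le> e"
proof -
  obtain B where B: "B > 0" "\<And>p x. p \<in> P \<Longrightarrow> x \<in> I \<Longrightarrow> \<bar>p x\<bar> \<le> B" using P_bounded by blast
  obtain K \<gamma> where K: "K > 0" "\<gamma> > 0" "\<And>p x y. p \<in> P \<Longrightarrow> x \<in> I \<Longrightarrow> y \<in> I \<Longrightarrow> \<bar>p x - p y\<bar> \<le> K * \<bar>x - y\<bar> powr \<gamma>"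
    using P_holder by blast
  \<comment> \<open>The factor n + 1 keeps E positive also for n = 0; \<theta> then solves E
    \<theta>^\<gamma> = e. Neither depends on p, since all densities of the sieve share B, K and
    \<gamma>.\<close>
  define E where "E = B ^ n * (real n + 1) * K / B"
  have E: "E > 0" using B K by (simp add: E_def)
  define \<theta> where "\<theta> = (e / E) powr (1 / \<gamma>)"
  have \<theta>: "\<theta> > 0" "\<theta> powr \<gamma> = e / E" using e E K(2) by (simp_all add: \<theta>_def powr_powr)
  show ?thesis
  proof (rule that[OF \<theta>(1)])
    fix X Y p assume p: "p \<in> P" and XY: "\<And>i. i \<in> {1..n} \<Longrightarrow> X i \<in> I \<and> Y i \<in> I \<and> \<bar>Y i - X i\<bar> < \<theta>"
    have "\<bar>p (Y i) - p (X i)\<bar> \<le> K * (e / E)" if "i \<in> {1..n}" for i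
    proof -
      have "\<bar>p (Y i) - p (X i)\<bar> \<le> K * \<bar>Y i - X i\<bar> powr \<gamma>" using XY[OF that] by (intro K(3) p) auto
      also have "\<dots> \<le> K * \<theta> powr \<gamma>" using XY[OF that] K by (intro mult_left_mono powr_mono2) auto
      finally show ?thesis using \<theta>(2) by simp
    qed
    then have s: "(\<Sum>i=1..n. \<bar>p (Y i) - p (X i)\<bar>) \<le> real n * (K * (e / E))"
      using sum_mono[of "{1..n}" "\<lambda>i. \<bar>p (Y i) - p (X i)\<bar>" "\<lambda>_. K * (e / E)"] by simp
    have "\<bar>lik n Y p - lik n X p\<bar> \<le> B ^ card {1..n} * (\<Sum>i=1..n. \<bar>p (Y i) - p (X i)\<bar>) / B"
      unfolding lik_def using XY by (intro prod_diff_le B p) auto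
    also have "\<dots> \<le> B ^ n * ((real n + 1) * (K * (e / E))) / B"
    proof -
      have "0 \<le> K * (e / E)" using K e E by simp
      then have "(\<Sum>i=1..n. \<bar>p (Y i) - p (X i)\<bar>) \<le> (real n + 1) * (K * (e / E))"
        using s unfolding distrib_right by linarith
      then show ?thesis using B(1) by (intro divide_right_mono mult_mono) (auto simp: sum_nonneg)
    qed
    also have "\<dots> = E * (e / E)" unfolding E_def by (simp add: mult_ac)
    also have "\<dots> = e" using E by simp
    finally show "\<bar>lik n Y p - lik n X p\<bar> \<le> e" .
  qed
qed

text \<open>The maximiser for Y is a near-maximiser for X: passing from X to Y at
  \<open>phat n X\<close> and back at \<open>phat n Y\<close> costs e/2 each, and in between the
  likelihood at Y can only grow. Stability at X then applies.\<close>

lemma phat_continuous: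
  assumes n: "n \<ge> 1" and XX: "\<forall>i\<in>{1..n}. X i \<in> I" and \<eta>: "\<eta> > 0"
  obtains \<theta> where "\<theta> > 0" "\<And>Y x. (\<And>i. i \<in> {1..n} \<Longrightarrow> Y i \<in> I \<and> \<bar>Y i - X i\<bar> < \<theta>) \<Longrightarrow> x \<in> I \<Longrightarrow> \<bar>phat n Y x - phat n X x\<bar> \<le> \<eta>"
proof -
  obtain e where e: "e > 0" "\<And>p x. p \<in> P \<Longrightarrow> lik n X (phat n X) - e \<le> lik n X p \<Longrightarrow> x \<in> I \<Longrightarrow> \<bar>p x - phat n X x\<bar> \<le> \<eta>"
    using phat_is_max(3)[OF n XX \<eta>] by blast
  have "e / 2 > 0" using e(1) by simp
  then obtain \<theta> where \<theta>: "\<theta> > 0" "\<And>X Y p. p \<in> P \<Longrightarrow> (\<And>i. i \<in> {1..n} \<Longrightarrow> X i \<in> I \<and> Y i \<in> I \<and> \<bar>Y i - X i\<bar> < \<theta>) \<Longrightarrow> \<bar>lik n Y p - lik n X p\<bar> \<le> e / 2"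
    using lik_equicontinuous by blast
  show ?thesis
  proof (rule that[OF \<theta>(1)])
    fix Y x assume Y: "\<And>i. i \<in> {1..n} \<Longrightarrow> Y i \<in> I \<and> \<bar>Y i - X i\<bar> < \<theta>" and x: "x \<in> I"
    have mX: "is_max n X (phat n X)" by (rule phat_is_max(1)[OF n XX])
    have mY: "is_max n Y (phat n Y)" by (rule phat_is_max(1)[OF n]) (use Y in blast)
    have P: "phat n X \<in> P" "phat n Y \<in> P" using mX mY by (auto simp: is_max_def)
    have "\<bar>lik n Y p - lik n X p\<bar> \<le> e / 2" if "p \<in> P" for p
      by (rule \<theta>(2)[OF that]) (use XX Y in blast)
    then have "\<bar>lik n Y (phat n X) - lik n X (phat n X)\<bar> \<le> e / 2" "\<bar>lik n Y (phat n Y) - lik n X (phat n Y)\<bar> \<le> e / 2"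
      using P by auto
    moreover have "lik n Y (phat n X) \<le> lik n Y (phat n Y)" using mY P by (auto simp: is_max_def)
    ultimately have "lik n X (phat n X) - e \<le> lik n X (phat n Y)" by linarith
    then show "\<bar>phat n Y x - phat n X x\<bar> \<le> \<eta>" by (rule e(2)[OF P(2) _ x])
  qed
qed

section \<open>Transfer to the log-likelihood; measurability and continuity by composition\<close>

abbreviation "PT \<equiv> mtopology_of (sieve_metric I t \<zeta> D)"

lemma maximizes_on_log_lik_iff:
  assumes n: "n \<ge> 1" and X: "\<forall>i\<in>{1..n}. X i \<in> I"
  shows "maximizes_on P (log_lik n X) p \<longleftrightarrow> is_max n X p"
proof -
  have "log_lik n X p = (SUP q\<in>P. log_lik n X q) \<longleftrightarrow> (\<forall>q\<in>P. log_lik n X q \<le> log_lik n X p)" if "p \<in> P"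
    using that by (auto intro: SUP_upper antisym SUP_least)
  moreover have "log_lik n X q \<le> log_lik n X p \<longleftrightarrow> lik n X q \<le> lik n X p" if "p \<in> P" "q \<in> P" for q
    using that X by (intro log_lik_le_iff n) (auto intro: P_nonneg)
  ultimately show ?thesis unfolding maximizes_on_def is_max_def by blast
qed

lemma the_maximizer_log_lik:
  assumes "n \<ge> 1" "\<forall>i\<in>{1..n}. X i \<in> I"
  shows "the_maximizer P (log_lik n X) = phat n X"
  unfolding the_maximizer_def phat_def maximizes_on_log_lik_iff[OF assms] ..

lemma unique_maximizer_log_lik:
  assumes "n \<ge> 1" "\<forall>i\<in>{1..n}. X i \<in> I"
  shows "\<exists>!p. maximizes_on P (log_lik n X) p"
    and "sobolev_norm I t (the_maximizer P (log_lik n X)) = ennreal D"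
proof -
  note m = phat_is_max(1,2)[OF assms]
  show "\<exists>!p. maximizes_on P (log_lik n X) p"
    unfolding maximizes_on_log_lik_iff[OF assms] using m by blast
  have "phat n X \<in> P" using m(1) by (simp add: is_max_def)
  then show "sobolev_norm I t (the_maximizer P (log_lik n X)) = ennreal D"
    using Q_eq_R[OF P_finite] max_norm_eq[OF assms m(1)]
    by (simp add: the_maximizer_log_lik[OF assms] sobolev_norm_eq_iff[OF D(2)])
qed

lemma phat_cong:
  assumes "\<And>i. i \<in> {1..n} \<Longrightarrow> X i = Y i"
  shows "phat n X = phat n Y"
proof -
  have "lik n X = lik n Y" using assms by (auto simp: lik_def fun_eq_iff intro: prod.cong)
  then show ?thesis by (simp add: phat_def is_max_def)
qed

text \<open>Samples are sequences indexed by all naturals with the product topology, and the set is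
  a cylinder over the coordinates 1 to n. Preimages of this single open set give both measurability
  in the data and continuity in the parameter.\<close>

lemma open_phat_preimage:
  assumes n: "n \<ge> 1" and U: "openin PT U"
  shows "open {X :: nat \<Rightarrow> real. (\<forall>i\<in>{1..n}. X i \<in> I) \<and> phat n X \<in> U}" (is "open ?S")
proof (subst open_subopen, intro ballI)
  fix X assume X: "X \<in> ?S"
  then have XI: "\<forall>i\<in>{1..n}. X i \<in> I" and XU: "phat n X \<in> U" by auto
  let ?m = "sieve_metric I t \<zeta> D"
  have PM: "p \<in> mspace (bounded_cont I)" if "p \<in> P" for p
    using that by (simp add: sieve_def sobolev_space_def)
  have d: "mdist ?m p q \<le> \<eta>" if "p \<in> P" "q \<in> P" "\<And>x. x \<in> I \<Longrightarrow> \<bar>p x - q x\<bar> \<le> \<eta>" for p q \<eta>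
  proof -
    have "mdist ?m p q = (SUP x\<in>I. \<bar>p x - q x\<bar>)"
      unfolding sieve_metric_def mdist_submetric
      using ab by (intro mdist_bounded_cont PM that) auto
    also have "\<dots> \<le> \<eta>" using ab that by (intro cSUP_least) auto
    finally show ?thesis .
  qed
  obtain r where r: "r > 0" "\<And>q. q \<in> P \<Longrightarrow> mdist ?m (phat n X) q < r \<Longrightarrow> q \<in> U"
  proof -
    obtain r where r: "r > 0" "Metric_space.mball (mspace ?m) (mdist ?m) (phat n X) r \<subseteq> U"
      using U XU unfolding mtopology_of_def Metric_space.openin_mtopology[OF Metric_space_mspace_mdist] by blast
    have "q \<in> U" if "q \<in> P" "mdist ?m (phat n X) q < r" for q
    proof -
      have "q \<in> Metric_space.mball (mspace ?m) (mdist ?m) (phat n X) r"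
        using that phat_is_max(1)[OF n XI] Metric_space.in_mball[OF Metric_space_mspace_mdist, of q ?m]
        by (simp add: is_max_def mspace_sieve_metric)
      then show ?thesis using r(2) by blast
    qed
    then show ?thesis using that r(1) by blast
  qed
  \<comment> \<open>Pointwise bounds yield only a weak inequality for the supremum; r/2 leaves the
    distance strictly below r.\<close>
  have "r / 2 > 0" using r(1) by simp
  then obtain \<theta> where \<theta>: "\<theta> > 0" "\<And>Y x. (\<And>i. i \<in> {1..n} \<Longrightarrow> Y i \<in> I \<and> \<bar>Y i - X i\<bar> < \<theta>) \<Longrightarrow> x \<in> I \<Longrightarrow> \<bar>phat n Y x - phat n X x\<bar> \<le> r / 2"
    using phat_continuous[OF n XI] by blast
  define T where "T = (\<Inter>i\<in>{1..n}. (\<lambda>Y :: nat \<Rightarrow> real. Y i) -` (ball (X i) \<theta> \<inter> I))"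
  have "open T"
    unfolding T_def by (intro open_INT ballI open_vimage open_Int) auto
  moreover have "X \<in> T" using XI \<theta>(1) by (auto simp: T_def)
  moreover have "T \<subseteq> ?S"
  proof
    fix Y assume "Y \<in> T"
    then have Y: "Y i \<in> I \<and> \<bar>Y i - X i\<bar> < \<theta>" if "i \<in> {1..n}" for i
      using that by (auto simp: T_def dist_real_def abs_minus_commute)
    then have YI: "\<forall>i\<in>{1..n}. Y i \<in> I" by blast
    have P: "phat n X \<in> P" "phat n Y \<in> P"
      using phat_is_max(1)[OF n XI] phat_is_max(1)[OF n YI] by (auto simp: is_max_def)
    have "mdist ?m (phat n X) (phat n Y) \<le> r / 2"
      using \<theta>(2)[OF Y] by (intro d P) (simp add: abs_minus_commute)
    then have "phat n Y \<in> U" using r(1) by (intro r(2) P) auto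
    then show "Y \<in> ?S" using YI by blast
  qed
  ultimately show "\<exists>T. open T \<and> X \<in> T \<and> T \<subseteq> ?S" by blast
qed

lemma phat_in_P: "n \<ge> 1 \<Longrightarrow> \<forall>i\<in>{1..n}. X i \<in> I \<Longrightarrow> phat n X \<in> P"
  using phat_is_max(1) by (simp add: is_max_def)

text \<open>The sample is an arbitrary random vector f w, so that the identity serves for the data
  and w = V with entries \<rho>(V_i, \<theta>) for the simulations.\<close>

lemma measurable_phat:
  assumes n: "n \<ge> 1" and f: "\<And>i. i \<in> {1..n} \<Longrightarrow> (\<lambda>w. f w i) \<in> measurable N (restrict_space borel I)"
  shows "(\<lambda>w. phat n (f w)) \<in> measurable N (metric_borel (sieve_metric I t \<zeta> D))"
  unfolding metric_borel_def
proof (rule measurable_measure_of)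
  show "{U. openin PT U} \<subseteq> Pow (mspace (sieve_metric I t \<zeta> D))"
    by (auto dest!: openin_subset)
  have fI: "\<forall>i\<in>{1..n}. f w i \<in> I" if "w \<in> space N" for w
    using measurable_space[OF f that] by (simp add: space_restrict_space)
  show "(\<lambda>w. phat n (f w)) \<in> space N \<rightarrow> mspace (sieve_metric I t \<zeta> D)"
    unfolding mspace_sieve_metric using phat_in_P[OF n fI] by auto
  fix U assume "U \<in> {U. openin PT U}"
  then have o: "open {X :: nat \<Rightarrow> real. (\<forall>i\<in>{1..n}. X i \<in> I) \<and> phat n X \<in> U}" (is "open ?S")
    using open_phat_preimage[OF n] by blast
  \<comment> \<open>Coordinates outside 1 to n are uncontrolled; set to 0 they are measurable, and
    by \<open>phat_cong\<close> the maximiser does not change. Coordinatewise measurability then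
    suffices for the Borel sets of the sequence space.\<close>
  define F where "F = (\<lambda>w i. if i \<in> {1..n} then f w i else 0)"
  have [measurable]: "(\<lambda>w. f w i) \<in> borel_measurable N" if "i \<in> {1..n}" for i
    using f[OF that] by (simp add: measurable_restrict_space2_iff)
  have "F \<in> borel_measurable N"
  proof (rule measurable_coordinatewise_then_product)
    show "(\<lambda>w. F w i) \<in> borel_measurable N" for i
      unfolding F_def by (cases "i \<in> {1..n}") auto
  qed
  then have "F -` ?S \<inter> space N \<in> sets N" using o by (intro measurable_sets) auto
  also have "F -` ?S \<inter> space N = (\<lambda>w. phat n (f w)) -` U \<inter> space N"
  proof -
    have "phat n (F w) = phat n (f w)" for w by (rule phat_cong) (simp add: F_def)
    moreover have "\<forall>i\<in>{1..n}. F w i \<in> I" if "w \<in> space N" for w using fI[OF that] by (simp add: F_def)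
    ultimately show ?thesis by auto
  qed
  finally show "(\<lambda>w. phat n (f w)) -` U \<inter> space N \<in> sets N" .
qed

lemma continuous_map_phat:
  fixes f :: "'c :: topological_space \<Rightarrow> nat \<Rightarrow> real"
  assumes n: "n \<ge> 1" and f: "\<And>i. i \<in> {1..n} \<Longrightarrow> continuous_on S (\<lambda>w. f w i)"
    and fI: "\<And>w i. w \<in> S \<Longrightarrow> i \<in> {1..n} \<Longrightarrow> f w i \<in> I"
  shows "continuous_map (top_of_set S) PT (\<lambda>w. phat n (f w))"
  unfolding continuous_map_def
proof (intro conjI allI impI)
  show "(\<lambda>w. phat n (f w)) \<in> topspace (top_of_set S) \<rightarrow> topspace PT"
    unfolding topspace_mtopology_of mspace_sieve_metric using phat_in_P[OF n] fI by auto
  fix U assume "openin PT U"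
  then have o: "open {X :: nat \<Rightarrow> real. (\<forall>i\<in>{1..n}. X i \<in> I) \<and> phat n X \<in> U}" (is "open ?S")
    by (rule open_phat_preimage[OF n])
  define F where "F = (\<lambda>w i. if i \<in> {1..n} then f w i else 0)"
  have "continuous_on S F"
  proof (rule continuous_on_coordinatewise_then_product)
    show "continuous_on S (\<lambda>w. F w i)" for i
      unfolding F_def using f by (cases "i \<in> {1..n}") auto
  qed
  then have "openin (top_of_set S) (S \<inter> F -` ?S)" using o by (rule continuous_openin_preimage_gen)
  also have "S \<inter> F -` ?S = {w \<in> topspace (top_of_set S). phat n (f w) \<in> U}"
  proof -
    have "phat n (F w) = phat n (f w)" for w by (rule phat_cong) (simp add: F_def)
    then show ?thesis using fI by (auto simp: F_def)
  qed
  finally show "openin (top_of_set S) {w \<in> topspace (top_of_set S). phat n (f w) \<in> U}" .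
qed

end

lemma open_bounded_interval_cases:
  fixes \<Omega> :: "real set"
  assumes op: "open \<Omega>" and int: "is_interval \<Omega>" and bdd: "bounded \<Omega>" and ne: "\<Omega> \<noteq> {}"
  obtains a b where "a < b" "\<Omega> = {a<..<b}"
proof -
  have b: "bdd_below \<Omega>" "bdd_above \<Omega>"
    using bdd by (auto intro: bounded_imp_bdd_below bounded_imp_bdd_above)
  have eq: "\<Omega> = {Inf \<Omega><..<Sup \<Omega>}"
  proof (intro equalityI subsetI)
    fix x assume x: "x \<in> \<Omega>"
    then obtain e where e: "e > 0" "cball x e \<subseteq> \<Omega>" using op open_contains_cball by blast
    then have "x - e \<in> \<Omega>" "x + e \<in> \<Omega>" by (auto simp: subset_eq dist_real_def)
    then have "Inf \<Omega> \<le> x - e" "x + e \<le> Sup \<Omega>" using b by (auto intro: cInf_lower cSup_upper)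
    then show "x \<in> {Inf \<Omega><..<Sup \<Omega>}" using e(1) by auto
  next
    fix x assume "x \<in> {Inf \<Omega><..<Sup \<Omega>}"
    then obtain u v where "u \<in> \<Omega>" "u < x" "v \<in> \<Omega>" "x < v"
      using cInf_lessD[OF ne] less_cSup_iff[OF ne b(2)] by (metis greaterThanLessThan_iff)
    then show "x \<in> \<Omega>" using int unfolding is_interval_1 by (meson less_imp_le)
  qed
  moreover have "Inf \<Omega> < Sup \<Omega>" using eq ne by auto
  ultimately show ?thesis using that by blast
qed

theorem theorem5:
  fixes \<Omega> :: "real set"
    and t \<zeta> D :: real
    and \<Theta> :: "(real ^ 'm) set"
    and pd :: "real ^ 'm \<Rightarrow> real \<Rightarrow> real"
    and M :: "'v measure"
    and \<rho> :: "'v \<Rightarrow> real ^ 'm \<Rightarrow> real"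
  assumes "open \<Omega>" and "is_interval \<Omega>" and "bounded \<Omega>" and "\<Omega> \<noteq> {}"
    and "t > 1 / 2"
    and "0 \<le> \<zeta>" and "\<zeta> < 1 / measure lborel \<Omega>" and "1 / measure lborel \<Omega> < D\<^sup>2" and "0 < D"
    and "compact \<Theta>" and "\<Theta> \<noteq> {}"
    and "\<And>\<theta>. \<theta> \<in> \<Theta> \<Longrightarrow> prob_density_on \<Omega> (pd \<theta>)"
    and "prob_space M"
    and "\<And>\<theta>. \<theta> \<in> \<Theta> \<Longrightarrow> (\<lambda>v. \<rho> v \<theta>) \<in> measurable M (restrict_space borel \<Omega>)"
    and "\<And>\<theta>. \<theta> \<in> \<Theta> \<Longrightarrow>
           distributed M (restrict_space lborel \<Omega>) (\<lambda>v. \<rho> v \<theta>) (\<lambda>x. ennreal (pd \<theta> x))"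
  shows
    "(\<forall>n\<ge>1.
        (\<forall>X \<in> space (\<Pi>\<^sub>M i\<in>{1..n}. restrict_space borel \<Omega>).
           (\<exists>!p. maximizes_on (sieve \<Omega> t \<zeta> D) (log_lik n X) p) \<and>
           sobolev_norm \<Omega> t (the_maximizer (sieve \<Omega> t \<zeta> D) (log_lik n X)) = ennreal D) \<and>
        (\<lambda>X. the_maximizer (sieve \<Omega> t \<zeta> D) (log_lik n X))
          \<in> measurable (\<Pi>\<^sub>M i\<in>{1..n}. restrict_space borel \<Omega>) (metric_borel (sieve_metric \<Omega> t \<zeta> D)))
     \<and>
     (\<forall>k\<ge>1.
        (\<forall>\<theta>\<in>\<Theta>.
          (\<forall>V \<in> space (\<Pi>\<^sub>M i\<in>{1..k}. M).
             (\<exists>!p. maximizes_on (sieve \<Omega> t \<zeta> D) (sim_log_lik \<rho> k V \<theta>) p) \<and>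
             sobolev_norm \<Omega> t (the_maximizer (sieve \<Omega> t \<zeta> D) (sim_log_lik \<rho> k V \<theta>)) = ennreal D) \<and>
          (\<lambda>V. the_maximizer (sieve \<Omega> t \<zeta> D) (sim_log_lik \<rho> k V \<theta>))
            \<in> measurable (\<Pi>\<^sub>M i\<in>{1..k}. M) (metric_borel (sieve_metric \<Omega> t \<zeta> D))) \<and>
        ((\<forall>v\<in>space M. continuous_on \<Theta> (\<lambda>\<theta>. \<rho> v \<theta>)) \<longrightarrow>
          (\<forall>V \<in> space (\<Pi>\<^sub>M i\<in>{1..k}. M).
             continuous_map (top_of_set \<Theta>) (mtopology_of (sieve_metric \<Omega> t \<zeta> D))
               (\<lambda>\<theta>. the_maximizer (sieve \<Omega> t \<zeta> D) (sim_log_lik \<rho> k V \<theta>)))))"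
proof -
  obtain a b where ab: "a < b" and \<Omega>: "\<Omega> = {a<..<b}"
    using open_bounded_interval_cases assms(1-4) by blast
  interpret density_sieve a b t \<zeta> D
    using assms(5-9) ab unfolding \<Omega> by unfold_locales simp_all
  \<comment> \<open>The simulated likelihood is an ordinary likelihood at the sample \<rho>(V_i,
    \<theta>), so both parts of the theorem use the same lemmas.\<close>
  have sim: "sim_log_lik \<rho> k V \<theta> = log_lik k (\<lambda>i. \<rho> (V i) \<theta>)" for k V \<theta>
    by (simp add: fun_eq_iff sim_log_lik_def log_lik_def)
  have X: "\<forall>i\<in>{1..n}. X i \<in> I" if "X \<in> space (\<Pi>\<^sub>M i\<in>{1..n}. restrict_space borel I)" for n X
    using that by (auto simp: space_PiM space_restrict_space)
  have V: "\<forall>i\<in>{1..k}. \<rho> (V i) \<theta> \<in> I" if "V \<in> space (\<Pi>\<^sub>M i\<in>{1..k}. M)" "\<theta> \<in> \<Theta>" for k V \<theta>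
  proof
    fix i assume "i \<in> {1..k}"
    then have "V i \<in> space M" using that(1) by (auto simp: space_PiM)
    then show "\<rho> (V i) \<theta> \<in> I"
      using measurable_space[OF assms(14)[OF that(2)]] \<Omega> by (simp add: space_restrict_space)
  qed
  show ?thesis
    unfolding \<Omega> sim
  proof (intro conjI allI impI ballI)
    fix n :: nat assume n: "n \<ge> 1"
    show "(\<lambda>X. the_maximizer P (log_lik n X)) \<in> measurable (\<Pi>\<^sub>M i\<in>{1..n}. restrict_space borel I) (metric_borel (sieve_metric I t \<zeta> D))"
    proof (subst measurable_cong)
      show "the_maximizer P (log_lik n X) = phat n X" if "X \<in> space (\<Pi>\<^sub>M i\<in>{1..n}. restrict_space borel I)" for X
        by (rule the_maximizer_log_lik[OF n X[OF that]])
      show "(\<lambda>X. phat n X) \<in> measurable (\<Pi>\<^sub>M i\<in>{1..n}. restrict_space borel I) (metric_borel (sieve_metric I t \<zeta> D))"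
        by (rule measurable_phat[OF n, where f = "\<lambda>X. X"]) (rule measurable_component_singleton)
    qed
    fix X assume "X \<in> space (\<Pi>\<^sub>M i\<in>{1..n}. restrict_space borel I)"
    note u = unique_maximizer_log_lik[OF n X[OF this]]
    show "\<exists>!p. maximizes_on P (log_lik n X) p" "sobolev_norm I t (the_maximizer P (log_lik n X)) = ennreal D"
      by (rule u)+
  next
    fix k :: nat and \<theta> assume k: "k \<ge> 1" and \<theta>: "\<theta> \<in> \<Theta>"
    show "(\<lambda>V. the_maximizer P (log_lik k (\<lambda>i. \<rho> (V i) \<theta>))) \<in> measurable (\<Pi>\<^sub>M i\<in>{1..k}. M) (metric_borel (sieve_metric I t \<zeta> D))"
    proof (subst measurable_cong)
      show "the_maximizer P (log_lik k (\<lambda>i. \<rho> (V i) \<theta>)) = phat k (\<lambda>i. \<rho> (V i) \<theta>)" if "V \<in> space (\<Pi>\<^sub>M i\<in>{1..k}. M)" for V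
        by (rule the_maximizer_log_lik[OF k V[OF that \<theta>]])
      show "(\<lambda>V. phat k (\<lambda>i. \<rho> (V i) \<theta>)) \<in> measurable (\<Pi>\<^sub>M i\<in>{1..k}. M) (metric_borel (sieve_metric I t \<zeta> D))"
        using assms(14)[OF \<theta>] unfolding \<Omega>
        by (intro measurable_phat[OF k] measurable_compose[OF measurable_component_singleton]) auto
    qed
    fix V assume "V \<in> space (\<Pi>\<^sub>M i\<in>{1..k}. M)"
    note u = unique_maximizer_log_lik[OF k V[OF this \<theta>]]
    show "\<exists>!p. maximizes_on P (log_lik k (\<lambda>i. \<rho> (V i) \<theta>)) p"
      "sobolev_norm I t (the_maximizer P (log_lik k (\<lambda>i. \<rho> (V i) \<theta>))) = ennreal D"
      by (rule u)+
  next
    fix k :: nat and W assume k: "k \<ge> 1" and cont: "\<forall>v\<in>space M. continuous_on \<Theta> (\<lambda>\<theta>. \<rho> v \<theta>)"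
      and W: "W \<in> space (\<Pi>\<^sub>M i\<in>{1..k}. M)"
    have "continuous_map (top_of_set \<Theta>) PT (\<lambda>\<theta>. phat k (\<lambda>i. \<rho> (W i) \<theta>))"
    proof (rule continuous_map_phat[OF k])
      show "continuous_on \<Theta> (\<lambda>\<theta>. \<rho> (W i) \<theta>)" if "i \<in> {1..k}" for i
        using cont W that by (auto simp: space_PiM)
      show "\<rho> (W i) \<theta> \<in> I" if "\<theta> \<in> \<Theta>" "i \<in> {1..k}" for \<theta> i
        using V[OF W that(1)] that(2) by blast
    qed
    then show "continuous_map (top_of_set \<Theta>) PT (\<lambda>\<theta>. the_maximizer P (log_lik k (\<lambda>i. \<rho> (W i) \<theta>)))"
      by (rule continuous_map_eq) (use the_maximizer_log_lik[OF k V[OF W]] in auto)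
  qed
qed

end
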